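(* Let $\epsilon\in(0,1/2)$ be the fraction of corruptions and let $c\in(0,1/2)$. Assume the dimension $d\in\mathbb{N}$ is sufficiently large. Consider the $\epsilon$-corrupted rank-one matrix sensing problem with ground-truth matrix $M^*=uu^\top$, $u\in\mathbb{R}^d$, and noise $\sigma^2=O(1)$. Any Statistical Query (SQ) algorithm that outputs $\hat u$ with $\|\hat u-u\|=O(\epsilon^{1/4})$ either requires $2^{\Omega(d^c)}/d^{2-4c}$ queries or makes at least one query to $\mathsf{STAT}\bigl(e^{O(1/\sqrt\epsilon)}/O(d^{1-2c})\bigr)$.
   Context: Rank-one matrix sensing with noise $\sigma^2$: a clean sample $(A,y)$ has $A\in\mathbb{R}^{d\times d}$ with i.i.d. standard Gaussian entries and $y=\langle A,uu^\top\rangle+\zeta$, $\zeta\sim\mathcal{N}(0,\sigma^2)$ independent of $A$, where $u\in\mathbb{R}^d$ is unknown. Let $Q$ be the law of a clean sample on $\mathbb{R}^{d^2+1}$. An adversary corrupts an $\epsilon$-fraction of the samples; for the lower bound it suffices to consider Huber contamination, where samples come from $\mathcal{P}=(1-\epsilon)Q+\epsilon N$ with $N$ an arbitrary distribution chosen by the adversary. SQ model: let $\mathcal{P}$ be the unknown corrupted distribution on $\mathbb{R}^{d^2+1}$. A statistical query is a bounded function $q:\mathbb{R}^{d^2+1}\to[-1,1]$. For $\tau>0$, the oracle $\mathsf{STAT}(\tau)$ responds to $q$ with a value $v$ such that $|v-\mathbb{E}_{X\sim\mathcal{P}}[q(X)]|\le\tau$. An SQ algorithm aims to learn information about $\mathcal{P}$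 (here, $u$) solely by making adaptive calls to $\mathsf{STAT}$ oracles for $\mathcal{P}$. "Makes at least one query to $\mathsf{STAT}(\tau)$" means that it makes a query of tolerance at least as accurate as $\tau$. *)

theory Defs
  imports "HOL-Probability.Probability"
begin

text \<open>
  The dimension \<open>d\<close> is a natural number that is quantified inside the theorem, so vectors in
  \<open>\<real>\<^sup>d\<close> are functions \<open>nat \<Rightarrow> real\<close> of which only the coordinates below \<open>d\<close> are used, and
  \<open>d \<times> d\<close> matrices are functions on the index set \<open>{..<d} \<times> {..<d}\<close>.
  A sample \<open>(A, y)\<close> lives in the product of \<open>\<real>\<^sup>d\<^sup>\<times>\<^sup>d\<close> and \<open>\<real>\<close>.
\<close>

type_synonym sample = "(nat \<times> nat \<Rightarrow> real) \<times> real"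

definition sample_space :: "nat \<Rightarrow> sample measure" where
  "sample_space d = PiM ({..<d} \<times> {..<d}) (\<lambda>_. borel) \<Otimes>\<^sub>M borel"

definition frob_inner :: "nat \<Rightarrow> (nat \<times> nat \<Rightarrow> real) \<Rightarrow> (nat \<times> nat \<Rightarrow> real) \<Rightarrow> real" where
  "frob_inner d A B = (\<Sum>ij\<in>{..<d} \<times> {..<d}. A ij * B ij)"

definition outer :: "(nat \<Rightarrow> real) \<Rightarrow> nat \<times> nat \<Rightarrow> real" where
  "outer u = (\<lambda>(i, j). u i * u j)"

text \<open>The parameter \<open>\<sigma>\<close> is the standard deviation of the noise, as in \<^const>\<open>normal_density\<close>.\<close>

definition clean_law :: "nat \<Rightarrow> real \<Rightarrow> (nat \<Rightarrow> real) \<Rightarrow> sample measure" where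
  "clean_law d \<sigma> u =
     distr
       (PiM ({..<d} \<times> {..<d}) (\<lambda>_. density lborel std_normal_density)
          \<Otimes>\<^sub>M density lborel (normal_density 0 \<sigma>))
       (sample_space d)
       (\<lambda>(A, \<zeta>). (A, frob_inner d A (outer u) + \<zeta>))"

definition huber :: "real \<Rightarrow> 'a measure \<Rightarrow> 'a measure \<Rightarrow> 'a measure" where
  "huber \<epsilon> Q N =
     measure_of (space Q) (sets Q)
       (\<lambda>X. ennreal (1 - \<epsilon>) * emeasure Q X + ennreal \<epsilon> * emeasure N X)"

lemma emeasure_huber:
  assumes "sets N = sets Q" and "X \<in> sets Q"
  shows "emeasure (huber \<epsilon> Q N) X = ennreal (1 - \<epsilon>) * emeasure Q X + ennreal \<epsilon> * emeasure N X"
  unfolding huber_def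
proof (rule emeasure_measure_of_sigma)
  show "sigma_algebra (space Q) (sets Q)" by (rule sets.sigma_algebra_axioms)
  show "positive (sets Q) (\<lambda>X. ennreal (1 - \<epsilon>) * emeasure Q X + ennreal \<epsilon> * emeasure N X)"
    by (simp add: positive_def)
  show "countably_additive (sets Q)
      (\<lambda>X. ennreal (1 - \<epsilon>) * emeasure Q X + ennreal \<epsilon> * emeasure N X)"
    using assms(1)
    by (auto simp: countably_additive_def suminf_add[symmetric] suminf_emeasure image_subset_iff)
qed (use assms in auto)

text \<open>
  An SQ algorithm either stops with an output or asks a query \<open>q\<close> at tolerance \<open>\<tau>\<close> and
  continues depending on the answer. The type is a codatatype, so an algorithm need not
  halt against arbitrary answers; halting is only demanded below against valid oracles.
\<close>

codatatype ('a, 'o) sq_alg =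
    Output 'o
  | Query "'a \<Rightarrow> real" real "real \<Rightarrow> ('a, 'o) sq_alg"

coinductive sq_legal :: "'a measure \<Rightarrow> ('a, 'o) sq_alg \<Rightarrow> bool" for M where
  "sq_legal M (Output out)"
| "\<lbrakk>q \<in> borel_measurable M; \<forall>x\<in>space M. q x \<in> {-1..1}; \<tau> > 0; \<forall>v. sq_legal M (k v)\<rbrakk>
    \<Longrightarrow> sq_legal M (Query q \<tau> k)"

definition stat_oracle :: "'a measure \<Rightarrow> (('a \<Rightarrow> real) \<Rightarrow> real \<Rightarrow> real) \<Rightarrow> bool" where
  "stat_oracle P orc \<longleftrightarrow>
     (\<forall>q \<tau>. q \<in> borel_measurable P \<longrightarrow> (\<forall>x\<in>space P. q x \<in> {-1..1}) \<longrightarrow> \<tau> > 0 \<longrightarrow>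
        \<bar>orc q \<tau> - (\<integral>x. q x \<partial>P)\<bar> \<le> \<tau>)"

text \<open>
  \<open>sq_run orc alg \<tau>s out\<close>: against the oracle \<open>orc\<close>, the algorithm halts with output \<open>out\<close>
  after queries whose tolerances are, in order, \<open>\<tau>s\<close>.
\<close>

inductive sq_run ::
  "(('a \<Rightarrow> real) \<Rightarrow> real \<Rightarrow> real) \<Rightarrow> ('a, 'o) sq_alg \<Rightarrow> real list \<Rightarrow> 'o \<Rightarrow> bool" for orc where
  "sq_run orc (Output out) [] out"
| "sq_run orc (k (orc q \<tau>)) \<tau>s out \<Longrightarrow> sq_run orc (Query q \<tau> k) (\<tau> # \<tau>s) out"

text \<open>
  The vectors \<open>u\<close> and \<open>-u\<close> have the same matrix \<open>u u\<^sup>T\<close> and hence the same sample law, so \<open>u\<close>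
  is only determined up to sign. Measuring the error without the sign ambiguity would make
  the accuracy requirement unsatisfiable.
\<close>

definition sign_err :: "nat \<Rightarrow> (nat \<Rightarrow> real) \<Rightarrow> (nat \<Rightarrow> real) \<Rightarrow> real" where
  "sign_err d w u = min (L2_set (\<lambda>i. w i - u i) {..<d}) (L2_set (\<lambda>i. w i + u i) {..<d})"

text \<open>
  An instance consists of a ground truth \<open>u\<close>, a contaminating distribution, and an oracle for
  the resulting mixture. The bound \<open>R\<close> on the norm of \<open>u\<close> is a promise to the algorithm;
  \<open>R = \<infinity>\<close> admits all \<open>u\<close>. For \<open>R = \<infinity>\<close> the number of queries is unbounded already because
  finitely many answers of bounded precision cannot locate \<open>u\<close> in an unbounded set, so the
  content of the lower bound is in finite \<open>R\<close>.
\<close>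

definition sensing_instance ::
  "nat \<Rightarrow> real \<Rightarrow> real \<Rightarrow> ereal \<Rightarrow> (nat \<Rightarrow> real) \<Rightarrow> ((sample \<Rightarrow> real) \<Rightarrow> real \<Rightarrow> real) \<Rightarrow> bool"
where
  "sensing_instance d \<epsilon> \<sigma> R u orc \<longleftrightarrow>
     ereal (L2_set u {..<d}) \<le> R \<and>
     (\<exists>N. prob_space N \<and> sets N = sets (sample_space d) \<and>
          stat_oracle (huber \<epsilon> (clean_law d \<sigma> u) N) orc)"

definition solves_sensing ::
  "nat \<Rightarrow> real \<Rightarrow> real \<Rightarrow> ereal \<Rightarrow> real \<Rightarrow> (sample, nat \<Rightarrow> real) sq_alg \<Rightarrow> bool"
where
  "solves_sensing d \<epsilon> \<sigma> R r alg \<longleftrightarrow>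
     sq_legal (sample_space d) alg \<and>
     (\<forall>u orc. sensing_instance d \<epsilon> \<sigma> R u orc \<longrightarrow>
        (\<exists>\<tau>s w. sq_run orc alg \<tau>s w \<and> sign_err d w u \<le> r))"

end

theory Submission
  imports Defs "HOL-Real_Asymp.Real_Asymp"
begin

text \<open>Take \<open>u = \<rho> v\<close> with \<open>v\<close> a unit vector and write \<open>a = \<langle>A, v v\<^sup>T\<rangle>\<close>. The adversary's density,
  relative to standard Gaussian \<open>A\<close> and rescaled Gaussian \<open>y\<close>, depends on \<open>A\<close> only
  through \<open>a\<close> and cancels the correlation between \<open>a\<close> and \<open>y\<close>. Hence, with \<open>\<delta> = \<langle>v, v'\<rangle>\<^sup>2\<close>, the
  correlation of two corrupted likelihood ratios exceeds its value at \<open>\<delta> = 0\<close> by only \<open>O(\<delta>\<^sup>2)\<close>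
  (up to the factor \<open>1 / (1 - t\<^sup>2 \<delta>)\<close>, which matters when \<open>\<delta>\<close> is close to \<open>1\<close> and the noise is small).
  In a large family of nearly orthogonal \<open>v\<close>, a second moment bound then shows that one query
  distinguishes few members from a common null distribution. An algorithm that receives null
  answers whenever these are valid must spend many queries, since its output on the null
  answers is accurate for at most half of the family.\<close>

section \<open>Two linear forms of a Gaussian vector\<close>

text \<open>The features \<open>a\<close> of two members have correlation \<delta>, and the part of
  a likelihood of Hermite degree \<open>k\<close> in \<open>a\<close> contributes in proportion to
  \<open>\<delta> ^ k\<close>, so the clean law alone would leave a term linear in \<delta>. Given
  \<open>g\<close>, the clean part has first moment \<open>t * g\<close> in \<open>a\<close>. The
  weights \<open>(1 + g)\<^sup>2 / 4\<close> and \<open>(1 - g)\<^sup>2 / 4\<close> are nonnegative,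
  have total mass 1 and differ by exactly \<open>g\<close>; attached to tilts of mean
  \<open>- l\<close> and \<open>l\<close> they give first moment \<open>- l * g\<close>. Hence
  \<open>\<epsilon> * l = (1 - \<epsilon>) * t\<close> cancels degree one for every
  \<open>g\<close>. The price is a constant exponential in \<open>1 / \<epsilon>\<^sup>2\<close>,
  harmless because \<open>d\<close> is taken large after \<epsilon>. The noise level is quantified
  after \<open>d\<close>, so \<open>t\<close> can be arbitrarily close to 1 and the clean
  self-correlation \<open>1 / (1 - t\<^sup>2)\<close> is unbounded in a fixed dimension. Sign
  vectors alone, a family of fixed size, would not survive this in the second moment bound: the
  family has to grow with \<open>t\<close> while its members stay separated on average.\<close>

definition gauss :: "real measure" where
  "gauss = density lborel std_normal_density"

lemma prob_space_gauss: "prob_space gauss"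
  unfolding gauss_def using prob_space_normal_density[of 1 0] by simp

lemma sets_gauss [simp, measurable_cong]: "sets gauss = sets borel"
  and space_gauss [simp]: "space gauss = UNIV"
  by (simp_all add: gauss_def)

interpretation gauss: prob_space gauss
  by (rule prob_space_gauss)

interpretation gauss2: pair_prob_space gauss gauss ..

lemma nn_integral_gauss:
  assumes "f \<in> borel_measurable borel"
  shows "(\<integral>\<^sup>+x. f x \<partial>gauss) = (\<integral>\<^sup>+x. ennreal (std_normal_density x) * f x \<partial>lborel)"
  using assms by (simp add: gauss_def nn_integral_density)

lemma std_normal_density_mult:
  "std_normal_density x * std_normal_density y = exp (- (x\<^sup>2 + y\<^sup>2) / 2) / (2 * pi)"
  by (simp add: std_normal_density_def exp_add[symmetric] diff_divide_distrib)

lemma nn_integral_gauss_pair: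
  assumes [measurable]: "F \<in> borel_measurable (borel \<Otimes>\<^sub>M borel)"
  shows "(\<integral>\<^sup>+x. \<integral>\<^sup>+y. F (x, y) \<partial>gauss \<partial>gauss) =
    (\<integral>\<^sup>+x. \<integral>\<^sup>+y. ennreal (exp (- (x\<^sup>2 + y\<^sup>2) / 2) / (2 * pi)) * F (x, y) \<partial>lborel \<partial>lborel)"
  by (simp add: nn_integral_gauss nn_integral_cmult[symmetric] mult.assoc[symmetric]
      ennreal_mult'[symmetric] std_normal_density_mult)

text \<open>The rotation is a composition of two shears along the axes and a rescaling, each of
  which is a one-dimensional substitution.\<close>

lemma nn_integral_lborel_rotate:
  fixes c s :: real
  assumes [measurable]: "F \<in> borel_measurable (borel \<Otimes>\<^sub>M borel)"
    and cs: "c\<^sup>2 + s\<^sup>2 = 1" and c: "c \<noteq> 0"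
  shows "(\<integral>\<^sup>+x. \<integral>\<^sup>+y. F (c * x - s * y, s * x + c * y) \<partial>lborel \<partial>lborel) =
    (\<integral>\<^sup>+x. \<integral>\<^sup>+y. F (x, y) \<partial>lborel \<partial>lborel)"
proof -
  have "(\<integral>\<^sup>+x. \<integral>\<^sup>+y. F (c * x - s * y, s * x + c * y) \<partial>lborel \<partial>lborel) =
    (\<integral>\<^sup>+x. ennreal (\<bar>1 / c\<bar>) * (\<integral>\<^sup>+y. F ((x - s * y) / c, y) \<partial>lborel) \<partial>lborel)"
  proof (rule nn_integral_cong)
    fix x :: real
    have e: "c * x - s * (- (s * x / c) + 1 / c * y) = (x - s * y) / c"
      "s * x + c * (- (s * x / c) + 1 / c * y) = y" for y
    proof -
      have "c * x - s * (- (s * x / c) + 1 / c * y) = ((c\<^sup>2 + s\<^sup>2) * x - s * y) / c"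
        using c by (simp add: field_simps power2_eq_square)
      then show "c * x - s * (- (s * x / c) + 1 / c * y) = (x - s * y) / c"
        by (simp add: cs)
      show "s * x + c * (- (s * x / c) + 1 / c * y) = y"
        using c by (simp add: field_simps)
    qed
    show "(\<integral>\<^sup>+y. F (c * x - s * y, s * x + c * y) \<partial>lborel) =
        ennreal (\<bar>1 / c\<bar>) * (\<integral>\<^sup>+y. F ((x - s * y) / c, y) \<partial>lborel)"
      by (subst nn_integral_real_affine[where c = "1 / c" and t = "- (s * x / c)"])
        (simp_all only: e, simp_all add: c)
  qed
  also have "\<dots> = ennreal (\<bar>1 / c\<bar>) * (\<integral>\<^sup>+y. \<integral>\<^sup>+x. F ((x - s * y) / c, y) \<partial>lborel \<partial>lborel)"
    by (subst nn_integral_cmult) (simp, subst lborel_pair.Fubini', simp_all)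
  also have "(\<integral>\<^sup>+y. \<integral>\<^sup>+x. F ((x - s * y) / c, y) \<partial>lborel \<partial>lborel) =
      (\<integral>\<^sup>+y. ennreal \<bar>c\<bar> * (\<integral>\<^sup>+x. F (x, y) \<partial>lborel) \<partial>lborel)"
  proof (rule nn_integral_cong)
    fix y :: real
    have e: "(s * y + c * x - s * y) / c = x" for x
      using c by simp
    show "(\<integral>\<^sup>+x. F ((x - s * y) / c, y) \<partial>lborel) = ennreal \<bar>c\<bar> * (\<integral>\<^sup>+x. F (x, y) \<partial>lborel)"
      by (subst nn_integral_real_affine[where c = c and t = "s * y"]) (simp_all only: e c, simp_all add: c)
  qed
  also have "\<dots> = ennreal \<bar>c\<bar> * (\<integral>\<^sup>+y. \<integral>\<^sup>+x. F (x, y) \<partial>lborel \<partial>lborel)"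
    by (rule nn_integral_cmult) simp
  also have "(\<integral>\<^sup>+y. \<integral>\<^sup>+x. F (x, y) \<partial>lborel \<partial>lborel) = (\<integral>\<^sup>+x. \<integral>\<^sup>+y. F (x, y) \<partial>lborel \<partial>lborel)"
    by (rule lborel_pair.Fubini') simp
  finally show ?thesis
    using c by (simp add: mult.assoc[symmetric] ennreal_mult'[symmetric])
qed

text \<open>The joint density depends on \<open>x\<^sup>2 + y\<^sup>2\<close> only, which a rotation
  preserves, so the Lebesgue version applies to density times \<open>F\<close>. That version divides
  by the cosine, hence the case distinction.\<close>

lemma nn_integral_gauss_rotate:
  fixes c s :: real
  assumes F: "F \<in> borel_measurable (borel \<Otimes>\<^sub>M borel)" and cs: "c\<^sup>2 + s\<^sup>2 = 1"
  shows "(\<integral>\<^sup>+x. \<integral>\<^sup>+y. F (c * x - s * y, s * x + c * y) \<partial>gauss \<partial>gauss) =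
    (\<integral>\<^sup>+x. \<integral>\<^sup>+y. F (x, y) \<partial>gauss \<partial>gauss)"
proof -
  have nz: "(\<integral>\<^sup>+x. \<integral>\<^sup>+y. F (c * x - s * y, s * x + c * y) \<partial>gauss \<partial>gauss) =
      (\<integral>\<^sup>+x. \<integral>\<^sup>+y. F (x, y) \<partial>gauss \<partial>gauss)"
    if cs: "c\<^sup>2 + s\<^sup>2 = 1" and c: "c \<noteq> 0" and F: "F \<in> borel_measurable (borel \<Otimes>\<^sub>M borel)"
    for c s :: real and F :: "real \<times> real \<Rightarrow> ennreal"
  proof -
    note F [measurable]
    have e: "(c * x - s * y)\<^sup>2 + (s * x + c * y)\<^sup>2 = x\<^sup>2 + y\<^sup>2" for x y
    proof -
      have "(c * x - s * y)\<^sup>2 + (s * x + c * y)\<^sup>2 = (c\<^sup>2 + s\<^sup>2) * (x\<^sup>2 + y\<^sup>2)"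
        by (simp add: power2_eq_square algebra_simps)
      then show ?thesis by (simp add: cs)
    qed
    show ?thesis
      using nn_integral_lborel_rotate[OF _ cs c,
          of "\<lambda>p. ennreal (exp (- ((fst p)\<^sup>2 + (snd p)\<^sup>2) / 2) / (2 * pi)) * F p"]
        nn_integral_gauss_pair[of "\<lambda>p. F (c * fst p - s * snd p, s * fst p + c * snd p)"]
        nn_integral_gauss_pair[of F]
      by (simp add: e)
  qed
  show ?thesis
  proof (cases "c = 0")
    case False
    then show ?thesis using nz[OF cs _ F] by simp
  next
    case True
    \<comment> \<open>a quarter turn is the square of a rotation with nonzero cosine\<close>
    define k where "k = (1 / sqrt 2 :: real)"
    have k: "k \<noteq> 0" "k * k = 1 / 2" by (simp_all add: k_def)
    have s2: "s * s = 1" using cs True by (simp add: power2_eq_square)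
    have ks: "k\<^sup>2 + (s * k)\<^sup>2 = 1"
      by (simp add: power_mult_distrib) (simp add: power2_eq_square k s2)
    note F [measurable]
    have e1: "k * (k * x - (s * k) * y) - (s * k) * ((s * k) * x + k * y) = - (s * y)"
      and e2: "(s * k) * (k * x - (s * k) * y) + k * ((s * k) * x + k * y) = s * x" for x y
    proof -
      have "k * (k * x - (s * k) * y) - (s * k) * ((s * k) * x + k * y) =
          (k * k) * (x - (s * s) * x - 2 * s * y)" by (simp add: algebra_simps)
      then show "k * (k * x - (s * k) * y) - (s * k) * ((s * k) * x + k * y) = - (s * y)"
        by (simp add: k s2)
      have "(s * k) * (k * x - (s * k) * y) + k * ((s * k) * x + k * y) =
          (k * k) * (2 * s * x + y - (s * s) * y)" by (simp add: algebra_simps)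
      then show "(s * k) * (k * x - (s * k) * y) + k * ((s * k) * x + k * y) = s * x"
        by (simp add: k s2)
    qed
    show ?thesis
      using nz[OF ks k(1), of "\<lambda>p. F (k * fst p - (s * k) * snd p, (s * k) * fst p + k * snd p)"]
        nz[OF ks k(1) F] True
      by (simp add: e1 e2)
  qed
qed

text \<open>Rotating the plane so that the first form lies along one axis makes the pair triangular.
  The new coefficients are described by the Gram matrix of the two forms, which is the shape that an
  induction over coordinates can carry along.\<close>

lemma nn_integral_gauss_two_forms_2:
  fixes p q a b :: real
  shows "\<exists>a' b' m. a' \<ge> 0 \<and> a'\<^sup>2 = p\<^sup>2 + a\<^sup>2 \<and> a' * b' = p * q + a * b \<and> b'\<^sup>2 + m\<^sup>2 = q\<^sup>2 + b\<^sup>2 \<and>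
    (\<forall>F \<in> borel_measurable (borel \<Otimes>\<^sub>M borel).
      (\<integral>\<^sup>+x. \<integral>\<^sup>+z. F (p * z + a * x, q * z + b * x) \<partial>gauss \<partial>gauss) =
      (\<integral>\<^sup>+x. \<integral>\<^sup>+z. F (a' * x, b' * x + m * z) \<partial>gauss \<partial>gauss))"
proof (cases "p\<^sup>2 + a\<^sup>2 = 0")
  case True
  then have "p = 0" "a = 0" by (simp_all add: sum_power2_eq_zero_iff)
  then show ?thesis
    by - (rule exI[of _ 0], rule exI[of _ b], rule exI[of _ q], simp add: add.commute)
next
  case False
  define h where "h = sqrt (p\<^sup>2 + a\<^sup>2)"
  have h: "h > 0" using False unfolding h_def
    by (metis add_nonneg_nonneg less_le real_sqrt_gt_zero zero_le_power2)
  have h2: "h\<^sup>2 = p\<^sup>2 + a\<^sup>2" by (simp add: h_def)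
  define b' where "b' = (p * q + a * b) / h"
  \<comment> \<open>\<open>b'\<close> and \<open>m\<close> are the components of the second form
    along the first one and orthogonal to it; that their squares add up correctly is Lagrange's
    identity.\<close>
  define m where "m = (a * q - p * b) / h"
  have cs: "(a / h)\<^sup>2 + (- p / h)\<^sup>2 = 1"
    using h by (simp add: power_divide add_divide_distrib[symmetric] h2[symmetric])
      (metis add.commute h2 divide_self power_not_zero less_irrefl)
  have "b'\<^sup>2 + m\<^sup>2 = ((p * q + a * b)\<^sup>2 + (a * q - p * b)\<^sup>2) / h\<^sup>2"
    by (simp only: b'_def m_def power_divide add_divide_distrib[symmetric])
  also have "(p * q + a * b)\<^sup>2 + (a * q - p * b)\<^sup>2 = (q\<^sup>2 + b\<^sup>2) * h\<^sup>2"
    unfolding h2 by (simp add: power2_eq_square algebra_simps)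
  finally have 1: "b'\<^sup>2 + m\<^sup>2 = q\<^sup>2 + b\<^sup>2" using h by simp
  have e1: "h * (a / h * x - (- p / h) * z) = p * z + a * x" for x z
    using h by (simp add: field_simps)
  have e2: "b' * (a / h * x - (- p / h) * z) + m * (- p / h * x + a / h * z) = q * z + b * x" for x z
  proof -
    have "b' * (a / h * x - (- p / h) * z) + m * (- p / h * x + a / h * z) =
        ((p * q + a * b) * (a * x + p * z) + (a * q - p * b) * (a * z - p * x)) / h\<^sup>2"
      by (simp add: b'_def m_def power2_eq_square add_divide_distrib[symmetric] right_diff_distrib
          distrib_left)
        (simp add: divide_simps algebra_simps)
    also have "(p * q + a * b) * (a * x + p * z) + (a * q - p * b) * (a * z - p * x) =
        (q * z + b * x) * h\<^sup>2"
      unfolding h2 by (simp add: power2_eq_square algebra_simps)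
    finally show ?thesis using h by simp
  qed
  show ?thesis
  proof (rule exI[of _ h], rule exI[of _ b'], rule exI[of _ m], intro conjI ballI)
    fix F :: "real \<times> real \<Rightarrow> ennreal"
    assume [measurable]: "F \<in> borel_measurable (borel \<Otimes>\<^sub>M borel)"
    show "(\<integral>\<^sup>+x. \<integral>\<^sup>+z. F (p * z + a * x, q * z + b * x) \<partial>gauss \<partial>gauss) =
      (\<integral>\<^sup>+x. \<integral>\<^sup>+z. F (h * x, b' * x + m * z) \<partial>gauss \<partial>gauss)"
      using nn_integral_gauss_rotate[OF _ cs, of "\<lambda>w. F (h * fst w, b' * fst w + m * snd w)"]
      by (simp only: fst_conv snd_conv e1 e2) simp_all
  qed (use h h2 1 in \<open>simp_all add: b'_def\<close>)
qed

text \<open>The two-form lemma with second form zero. It merges the two independent remainders that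
  appear when a coordinate is added below.\<close>

lemma nn_integral_gauss_sum:
  fixes m k :: real
  shows "\<exists>k'. k'\<^sup>2 = m\<^sup>2 + k\<^sup>2 \<and> (\<forall>G \<in> borel_measurable borel.
    (\<integral>\<^sup>+z. \<integral>\<^sup>+y. G (m * z + k * y) \<partial>gauss \<partial>gauss) = (\<integral>\<^sup>+y. G (k' * y) \<partial>gauss))"
proof -
  obtain a' b' n where a: "a'\<^sup>2 = k\<^sup>2 + m\<^sup>2" and
    F: "\<forall>F \<in> borel_measurable (borel \<Otimes>\<^sub>M borel).
      (\<integral>\<^sup>+x. \<integral>\<^sup>+z. F (k * z + m * x, 0 * z + 0 * x) \<partial>gauss \<partial>gauss) =
      (\<integral>\<^sup>+x. \<integral>\<^sup>+z. F (a' * x, b' * x + n * z) \<partial>gauss \<partial>gauss)"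
    using nn_integral_gauss_two_forms_2[of k m 0 0] by blast
  show ?thesis
  proof (intro exI[of _ a'] conjI ballI)
    fix G :: "real \<Rightarrow> ennreal" assume [measurable]: "G \<in> borel_measurable borel"
    show "(\<integral>\<^sup>+z. \<integral>\<^sup>+y. G (m * z + k * y) \<partial>gauss \<partial>gauss) = (\<integral>\<^sup>+y. G (a' * y) \<partial>gauss)"
      using bspec[OF F, of "\<lambda>w. G (fst w)"]
      by (simp add: add.commute gauss.emeasure_space_1[simplified])
  qed (simp add: a)
qed

text \<open>The coefficients \<open>a\<close>, \<open>b\<close>, \<open>k\<close> form the Cholesky
  factor of the Gram matrix of \<open>f\<close> and \<open>g\<close>. For a new coordinate
  \<open>z\<close>, rotating the pair of \<open>z\<close> and \<open>x\<close> restores the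
  triangular shape for the first form, and the leftover multiple of \<open>z\<close> joins
  \<open>k * y\<close> in a single Gaussian variable.\<close>

lemma nn_integral_PiM_gauss_two_forms:
  fixes f g :: "'i \<Rightarrow> real"
  assumes "finite I"
  shows "\<exists>a b k. a \<ge> 0 \<and> a\<^sup>2 = (\<Sum>i\<in>I. (f i)\<^sup>2) \<and> a * b = (\<Sum>i\<in>I. f i * g i) \<and>
    b\<^sup>2 + k\<^sup>2 = (\<Sum>i\<in>I. (g i)\<^sup>2) \<and>
    (\<forall>F \<in> borel_measurable (borel \<Otimes>\<^sub>M borel).
      (\<integral>\<^sup>+A. F (\<Sum>i\<in>I. A i * f i, \<Sum>i\<in>I. A i * g i) \<partial>PiM I (\<lambda>_. gauss)) =
      (\<integral>\<^sup>+x. \<integral>\<^sup>+y. F (a * x, b * x + k * y) \<partial>gauss \<partial>gauss))"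
  using assms
proof (induction I)
  case empty
  show ?case
    by (intro exI[of _ 0]) (simp add: PiM_empty nn_integral_count_space_finite gauss.emeasure_space_1[simplified])
next
  case (insert i I)
  interpret product_sigma_finite "\<lambda>_ :: 'i. gauss"
    by standard
  obtain a b k where a: "a \<ge> 0" "a\<^sup>2 = (\<Sum>i\<in>I. (f i)\<^sup>2)" and ab: "a * b = (\<Sum>i\<in>I. f i * g i)"
    and bk: "b\<^sup>2 + k\<^sup>2 = (\<Sum>i\<in>I. (g i)\<^sup>2)"
    and IH: "\<And>F. F \<in> borel_measurable (borel \<Otimes>\<^sub>M borel) \<Longrightarrow>
      (\<integral>\<^sup>+A. F (\<Sum>i\<in>I. A i * f i, \<Sum>i\<in>I. A i * g i) \<partial>PiM I (\<lambda>_. gauss)) =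
      (\<integral>\<^sup>+x. \<integral>\<^sup>+y. F (a * x, b * x + k * y) \<partial>gauss \<partial>gauss)"
    using insert.IH by blast
  obtain a' b' m where a': "a' \<ge> 0" "a'\<^sup>2 = (f i)\<^sup>2 + a\<^sup>2" and ab': "a' * b' = f i * g i + a * b"
    and bm: "b'\<^sup>2 + m\<^sup>2 = (g i)\<^sup>2 + b\<^sup>2"
    and two: "\<And>F. F \<in> borel_measurable (borel \<Otimes>\<^sub>M borel) \<Longrightarrow>
      (\<integral>\<^sup>+x. \<integral>\<^sup>+z. F (f i * z + a * x, g i * z + b * x) \<partial>gauss \<partial>gauss) =
      (\<integral>\<^sup>+x. \<integral>\<^sup>+z. F (a' * x, b' * x + m * z) \<partial>gauss \<partial>gauss)"
    using nn_integral_gauss_two_forms_2[of "f i" a "g i" b] by blast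
  obtain k' where k': "k'\<^sup>2 = m\<^sup>2 + k\<^sup>2" and
    sum: "\<And>G. G \<in> borel_measurable borel \<Longrightarrow>
      (\<integral>\<^sup>+z. \<integral>\<^sup>+y. G (m * z + k * y) \<partial>gauss \<partial>gauss) = (\<integral>\<^sup>+y. G (k' * y) \<partial>gauss)"
    using nn_integral_gauss_sum[of m k] by blast
  show ?case
  proof (rule exI[of _ a'], rule exI[of _ b'], rule exI[of _ k'], intro conjI ballI)
    fix F :: "real \<times> real \<Rightarrow> ennreal"
    assume [measurable]: "F \<in> borel_measurable (borel \<Otimes>\<^sub>M borel)"
    have upd: "(\<Sum>j\<in>I. (A(i := z)) j * h j) = (\<Sum>j\<in>I. A j * h j)" for A z and h :: "'i \<Rightarrow> real"
      using insert.hyps by (intro sum.cong) auto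
    have "(\<integral>\<^sup>+A. F (\<Sum>j\<in>insert i I. A j * f j, \<Sum>j\<in>insert i I. A j * g j)
          \<partial>PiM (insert i I) (\<lambda>_. gauss)) =
        (\<integral>\<^sup>+z. \<integral>\<^sup>+A. F (z * f i + (\<Sum>j\<in>I. A j * f j), z * g i + (\<Sum>j\<in>I. A j * g j))
          \<partial>PiM I (\<lambda>_. gauss) \<partial>gauss)"
      using insert.hyps
      by (subst product_nn_integral_insert_rev) (simp_all add: upd del: fun_upd_apply, simp)
    also have "\<dots> = (\<integral>\<^sup>+z. \<integral>\<^sup>+x. \<integral>\<^sup>+y. F (z * f i + a * x, z * g i + (b * x + k * y)) \<partial>gauss \<partial>gauss \<partial>gauss)"
      using IH[of "\<lambda>w. F (z * f i + fst w, z * g i + snd w)" for z] by simp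
    also have "\<dots> = (\<integral>\<^sup>+x. \<integral>\<^sup>+z. \<integral>\<^sup>+y. F (z * f i + a * x, z * g i + (b * x + k * y)) \<partial>gauss \<partial>gauss \<partial>gauss)"
      by (rule gauss2.Fubini') simp
    also have "\<dots> = (\<integral>\<^sup>+x. \<integral>\<^sup>+z. \<integral>\<^sup>+y. F (a' * x, b' * x + m * z + k * y) \<partial>gauss \<partial>gauss \<partial>gauss)"
      using two[of "\<lambda>w. \<integral>\<^sup>+y. F (fst w, snd w + k * y) \<partial>gauss"]
      by (simp add: mult.commute add.assoc)
    also have "\<dots> = (\<integral>\<^sup>+x. \<integral>\<^sup>+y. F (a' * x, b' * x + k' * y) \<partial>gauss \<partial>gauss)"
      using sum[of "\<lambda>w. F (a' * x, b' * x + w)" for x] by (simp add: add.assoc)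
    finally show "(\<integral>\<^sup>+A. F (\<Sum>j\<in>insert i I. A j * f j, \<Sum>j\<in>insert i I. A j * g j)
          \<partial>PiM (insert i I) (\<lambda>_. gauss)) =
        (\<integral>\<^sup>+x. \<integral>\<^sup>+y. F (a' * x, b' * x + k' * y) \<partial>gauss \<partial>gauss)" .
  qed (use insert.hyps a a' ab ab' bk bm k' in \<open>simp_all add: algebra_simps\<close>)
qed

section \<open>Gaussian integrals\<close>

lemma nn_integral_exp_quadratic:
  fixes A B C :: real
  assumes A: "A > 0"
  shows "(\<integral>\<^sup>+y. ennreal (exp (- (A / 2) * y\<^sup>2 + B * y + C)) \<partial>lborel) =
    ennreal (sqrt (2 * pi / A) * exp (B\<^sup>2 / (2 * A) + C))"
proof -
  have sA: "(1 / sqrt A) > 0" using A by simp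
  have e: "exp (- (A / 2) * y\<^sup>2 + B * y + C) =
      sqrt (2 * pi / A) * exp (B\<^sup>2 / (2 * A) + C) * normal_density (B / A) (1 / sqrt A) y" for y
  proof -
    have "- (A / 2) * y\<^sup>2 + B * y + C = B\<^sup>2 / (2 * A) + C + (- (A * (y - B / A)\<^sup>2) / 2)"
      using A by (simp add: field_simps power2_eq_square)
    moreover have "normal_density (B / A) (1 / sqrt A) y =
        1 / sqrt (2 * pi / A) * exp (- (A * (y - B / A)\<^sup>2) / 2)"
      using A by (simp add: normal_density_def power_divide)
    ultimately show ?thesis
      using A by (simp only: exp_add) simp
  qed
  have "(\<integral>\<^sup>+y. ennreal (exp (- (A / 2) * y\<^sup>2 + B * y + C)) \<partial>lborel) =
      ennreal (sqrt (2 * pi / A) * exp (B\<^sup>2 / (2 * A) + C)) *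
      (\<integral>\<^sup>+y. ennreal (normal_density (B / A) (1 / sqrt A) y) \<partial>lborel)"
    using A by (subst nn_integral_cmult[symmetric]) (simp_all only: e, simp_all add: ennreal_mult)
  also have "(\<integral>\<^sup>+y. ennreal (normal_density (B / A) (1 / sqrt A) y) \<partial>lborel) = 1"
    using sA by (subst nn_integral_eq_integral) simp_all
  finally show ?thesis by simp
qed

text \<open>The Gaussian weight raises the quadratic coefficient by 1, so \<open>A\<close> may be
  negative as long as \<open>1 + A > 0\<close>; the diagonal of the Mehler kernel is such a
  case.\<close>

lemma nn_integral_gauss_exp_quadratic:
  fixes A B C D :: real
  assumes A: "1 + A > 0" and D: "D \<ge> 0"
  shows "(\<integral>\<^sup>+y. ennreal (D * exp (- (A / 2) * y\<^sup>2 + B * y + C)) \<partial>gauss) =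
    ennreal (D * (exp (B\<^sup>2 / (2 * (1 + A)) + C) / sqrt (1 + A)))"
proof -
  have e: "std_normal_density y * (D * exp (- (A / 2) * y\<^sup>2 + B * y + C)) =
      (D / sqrt (2 * pi)) * exp (- ((1 + A) / 2) * y\<^sup>2 + B * y + C)" for y
  proof -
    have "- ((1 + A) / 2) * y\<^sup>2 + B * y + C = - y\<^sup>2 / 2 + (- (A / 2) * y\<^sup>2 + B * y + C)"
      by (simp add: field_simps)
    then show ?thesis
      by (simp only: exp_add) (simp add: std_normal_density_def)
  qed
  have "(\<integral>\<^sup>+y. ennreal (D * exp (- (A / 2) * y\<^sup>2 + B * y + C)) \<partial>gauss) =
      (\<integral>\<^sup>+y. ennreal ((D / sqrt (2 * pi)) * exp (- ((1 + A) / 2) * y\<^sup>2 + B * y + C)) \<partial>lborel)"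
    by (subst nn_integral_gauss) (simp_all only: e[symmetric], simp_all add: ennreal_mult' D)
  also have "\<dots> = ennreal (D / sqrt (2 * pi)) *
      (\<integral>\<^sup>+y. ennreal (exp (- ((1 + A) / 2) * y\<^sup>2 + B * y + C)) \<partial>lborel)"
    by (subst nn_integral_cmult[symmetric]) (simp, simp only: ennreal_mult''[symmetric] exp_ge_zero)
  also have "\<dots> = ennreal (D / sqrt (2 * pi) * (sqrt (2 * pi / (1 + A)) * exp (B\<^sup>2 / (2 * (1 + A)) + C)))"
    using A D by (simp only: nn_integral_exp_quadratic) (simp add: ennreal_mult'[symmetric])
  also have "D / sqrt (2 * pi) * (sqrt (2 * pi / (1 + A)) * exp (B\<^sup>2 / (2 * (1 + A)) + C)) =
      D * (exp (B\<^sup>2 / (2 * (1 + A)) + C) / sqrt (1 + A))"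
    by (simp add: real_sqrt_divide)
  finally show ?thesis .
qed

subsection \<open>The Mehler kernel\<close>

text \<open>The density of the conditional law of a standard Gaussian \<open>y\<close> given \<open>x\<close> relative to the
  standard Gaussian law, when \<open>x\<close> and \<open>y\<close> are jointly standard Gaussian with correlation \<open>t\<close>.\<close>

definition mehler :: "real \<Rightarrow> real \<Rightarrow> real \<Rightarrow> real" where
  "mehler t x y = exp (- (t\<^sup>2 * x\<^sup>2 - 2 * t * x * y + t\<^sup>2 * y\<^sup>2) / (2 * (1 - t\<^sup>2))) / sqrt (1 - t\<^sup>2)"

text \<open>The density of the unit-variance Gaussian law with mean \<open>- m\<close> relative to
  the standard one, and also the generating function of the Hermite polynomials at
  \<open>- m\<close>.\<close>

definition tilt :: "real \<Rightarrow> real \<Rightarrow> real" where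
  "tilt m x = exp (- m * x - m\<^sup>2 / 2)"

lemma mehler_nonneg: "\<bar>t\<bar> < 1 \<Longrightarrow> mehler t x y \<ge> 0"
  by (simp add: mehler_def abs_square_less_1 less_imp_le)

lemma tilt_nonneg: "tilt m x \<ge> 0"
  by (simp add: tilt_def)

lemma measurable_mehler [measurable (raw)]:
  assumes [measurable]: "f \<in> borel_measurable N" "g \<in> borel_measurable N"
  shows "(\<lambda>x. mehler t (f x) (g x)) \<in> borel_measurable N"
  unfolding mehler_def by measurable

lemma measurable_tilt [measurable (raw)]:
  assumes [measurable]: "f \<in> borel_measurable N"
  shows "(\<lambda>x. tilt m (f x)) \<in> borel_measurable N"
  unfolding tilt_def by measurable

lemma mehler_eq_normal_density:
  assumes t: "\<bar>t\<bar> < 1"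
  shows "std_normal_density y * mehler t x y = normal_density (t * x) (sqrt (1 - t\<^sup>2)) y"
proof -
  define q where "q = 1 - t\<^sup>2"
  have q: "q > 0" using t by (simp add: q_def abs_square_less_1)
  have y: "- y\<^sup>2 / 2 = - y\<^sup>2 * q / (2 * q)"
    using q by simp
  have "- y\<^sup>2 / 2 + - (t\<^sup>2 * x\<^sup>2 - 2 * t * x * y + t\<^sup>2 * y\<^sup>2) / (2 * q) =
      (- y\<^sup>2 * q - (t\<^sup>2 * x\<^sup>2 - 2 * t * x * y + t\<^sup>2 * y\<^sup>2)) / (2 * q)"
    unfolding y by (simp only: add_divide_distrib[symmetric]) simp
  also have "- y\<^sup>2 * q - (t\<^sup>2 * x\<^sup>2 - 2 * t * x * y + t\<^sup>2 * y\<^sup>2) = - (y - t * x)\<^sup>2"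
    by (simp add: q_def power2_eq_square algebra_simps)
  finally have e: "exp (- y\<^sup>2 / 2) * exp (- (t\<^sup>2 * x\<^sup>2 - 2 * t * x * y + t\<^sup>2 * y\<^sup>2) / (2 * q)) =
      exp (- (y - t * x)\<^sup>2 / (2 * q))"
    by (simp only: exp_add[symmetric])
  have "std_normal_density y * mehler t x y = 1 / sqrt (2 * pi) / sqrt q *
      (exp (- y\<^sup>2 / 2) * exp (- (t\<^sup>2 * x\<^sup>2 - 2 * t * x * y + t\<^sup>2 * y\<^sup>2) / (2 * q)))"
    by (simp add: std_normal_density_def mehler_def q_def[symmetric])
  also have "\<dots> = normal_density (t * x) (sqrt q) y"
    unfolding e using q by (simp add: normal_density_def real_sqrt_mult)
  finally show ?thesis by (simp add: q_def)
qed

text \<open>If \<open>g\<close> has correlation \<open>t\<close> with \<open>r * x + k * y\<close>,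
  which has correlation \<open>r\<close> with \<open>x\<close>, then averaging out the independent
  part \<open>y\<close> leaves correlation \<open>t * r\<close> between \<open>g\<close> and
  \<open>x\<close>.\<close>

lemma nn_integral_mehler_corr:
  fixes t r k :: real
  assumes t: "\<bar>t\<bar> < 1" and rk: "r\<^sup>2 + k\<^sup>2 = 1"
  shows "(\<integral>\<^sup>+y. ennreal (mehler t (r * x + k * y) g) \<partial>gauss) = ennreal (mehler (t * r) x g)"
proof -
  define q where "q = 1 - t\<^sup>2"
  define s where "s = t * r"
  define p where "p = 1 - s\<^sup>2"
  have q: "q > 0" using t by (simp add: q_def abs_square_less_1)
  have k2: "t\<^sup>2 * k\<^sup>2 = p - q"
  proof -
    have "t\<^sup>2 * (r\<^sup>2 + k\<^sup>2) = t\<^sup>2" by (simp add: rk)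
    then show ?thesis by (simp add: p_def q_def s_def power_mult_distrib algebra_simps)
  qed
  have p: "p > 0"
  proof -
    have "0 \<le> t\<^sup>2 * k\<^sup>2" by simp
    then show ?thesis using q k2 by linarith
  qed
  define A where "A = t\<^sup>2 * k\<^sup>2 / q"
  define B where "B = t * k * (g - s * x) / q"
  define C where "C = - (s\<^sup>2 * x\<^sup>2 - 2 * s * x * g + t\<^sup>2 * g\<^sup>2) / (2 * q)"
  have A1: "1 + A = p / q" using q by (simp add: A_def k2 diff_divide_distrib)
  have e: "mehler t (r * x + k * y) g = 1 / sqrt q * exp (- (A / 2) * y\<^sup>2 + B * y + C)" for y
  proof -
    have "- (t\<^sup>2 * (r * x + k * y)\<^sup>2 - 2 * t * (r * x + k * y) * g + t\<^sup>2 * g\<^sup>2) =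
        - (t\<^sup>2 * k\<^sup>2 * y\<^sup>2) + 2 * (t * k * (g - s * x) * y) +
        - (s\<^sup>2 * x\<^sup>2 - 2 * s * x * g + t\<^sup>2 * g\<^sup>2)"
      by (simp add: s_def power2_eq_square algebra_simps)
    then have "- (t\<^sup>2 * (r * x + k * y)\<^sup>2 - 2 * t * (r * x + k * y) * g + t\<^sup>2 * g\<^sup>2) / (2 * q) =
        - (A / 2) * y\<^sup>2 + B * y + C"
      by (simp only: A_def B_def C_def add_divide_distrib) simp
    then show ?thesis by (simp add: mehler_def q_def[symmetric])
  qed
  have x1: "B\<^sup>2 / (2 * (p / q)) + C = - (s\<^sup>2 * x\<^sup>2 - 2 * s * x * g + s\<^sup>2 * g\<^sup>2) / (2 * p)"
  proof -
    have B2: "B\<^sup>2 = (p - q) * (g - s * x)\<^sup>2 / q\<^sup>2"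
      by (simp add: B_def k2[symmetric] power_mult_distrib power_divide)
    have "B\<^sup>2 / (2 * (p / q)) + C =
        ((p - q) * (g - s * x)\<^sup>2 - p * (s\<^sup>2 * x\<^sup>2 - 2 * s * x * g + (1 - q) * g\<^sup>2)) / (2 * p * q)"
    proof -
      have "B\<^sup>2 / (2 * (p / q)) = ((p - q) * (g - s * x)\<^sup>2) / (2 * p * q)"
        unfolding B2 using p q by (simp add: power2_eq_square[of q])
      moreover have "C = - (p * (s\<^sup>2 * x\<^sup>2 - 2 * s * x * g + (1 - q) * g\<^sup>2)) / (2 * p * q)"
      proof -
        have "1 - q = t\<^sup>2" by (simp add: q_def)
        then show ?thesis using p q by (simp add: C_def) (simp add: minus_divide_left)
      qed
      ultimately show ?thesis
        by (simp only: add_divide_distrib[symmetric]) simp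
    qed
    also have "(p - q) * (g - s * x)\<^sup>2 - p * (s\<^sup>2 * x\<^sup>2 - 2 * s * x * g + (1 - q) * g\<^sup>2) =
        q * (- (s\<^sup>2 * x\<^sup>2 - 2 * s * x * g + s\<^sup>2 * g\<^sup>2))"
      by (simp add: p_def power2_eq_square algebra_simps)
    finally show ?thesis using p q by simp
  qed
  have "(\<integral>\<^sup>+y. ennreal (mehler t (r * x + k * y) g) \<partial>gauss) =
      ennreal (1 / sqrt q * (exp (B\<^sup>2 / (2 * (p / q)) + C) / sqrt (p / q)))"
    unfolding e using p q A1 by (subst nn_integral_gauss_exp_quadratic) simp_all
  also have "1 / sqrt q * (exp (B\<^sup>2 / (2 * (p / q)) + C) / sqrt (p / q)) = mehler s x g"
    unfolding x1 using q by (simp add: mehler_def p_def[symmetric] real_sqrt_divide)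
  finally show ?thesis by (simp add: s_def)
qed

text \<open>The Mehler kernel multiplies Hermite polynomials of degree \<open>j\<close> by
  \<open>t ^ j\<close>; on their generating function this is the substitution of
  \<open>m * t\<close> for \<open>m\<close>.\<close>

lemma nn_integral_mehler_tilt:
  fixes t m :: real
  assumes t: "\<bar>t\<bar> < 1"
  shows "(\<integral>\<^sup>+x. ennreal (mehler t x g * tilt m x) \<partial>gauss) = ennreal (tilt (m * t) g)"
proof -
  define q where "q = 1 - t\<^sup>2"
  have q: "q > 0" using t by (simp add: q_def abs_square_less_1)
  define A where "A = t\<^sup>2 / q"
  define B where "B = t * g / q - m"
  define C where "C = - (t\<^sup>2 * g\<^sup>2) / (2 * q) - m\<^sup>2 / 2"
  have A1: "1 + A = 1 / q" using q by (simp add: A_def q_def field_simps)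
  have e: "mehler t x g * tilt m x = 1 / sqrt q * exp (- (A / 2) * x\<^sup>2 + B * x + C)" for x
  proof -
    have "- (t\<^sup>2 * x\<^sup>2 - 2 * t * x * g + t\<^sup>2 * g\<^sup>2) / (2 * q) + (- m * x - m\<^sup>2 / 2) =
        - (A / 2) * x\<^sup>2 + B * x + C"
      by (simp add: A_def B_def C_def diff_divide_distrib add_divide_distrib algebra_simps)
    then show ?thesis by (simp add: mehler_def tilt_def q_def[symmetric] exp_add[symmetric])
  qed
  have x1: "B\<^sup>2 / (2 * (1 / q)) + C = - (m * t) * g - (m * t)\<^sup>2 / 2"
  proof -
    have "B = (t * g - m * q) / q"
      using q by (simp add: B_def diff_divide_distrib)
    then have "B\<^sup>2 = (t * g - m * q)\<^sup>2 / q\<^sup>2"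
      by (simp add: power_divide)
    then have "B\<^sup>2 / (2 * (1 / q)) + C = ((t * g - m * q)\<^sup>2 - t\<^sup>2 * g\<^sup>2 - m\<^sup>2 * q) / (2 * q)"
      using q by (simp add: C_def diff_divide_distrib power2_eq_square[of q])
    also have "(t * g - m * q)\<^sup>2 - t\<^sup>2 * g\<^sup>2 - m\<^sup>2 * q = q * (- 2 * (m * t) * g - (m * t)\<^sup>2)"
      by (simp add: q_def power2_eq_square algebra_simps)
    also have "\<dots> / (2 * q) = (- 2 * (m * t) * g - (m * t)\<^sup>2) / 2"
      using q by simp
    finally show ?thesis by (simp add: diff_divide_distrib)
  qed
  have "(\<integral>\<^sup>+x. ennreal (mehler t x g * tilt m x) \<partial>gauss) =
      ennreal (1 / sqrt q * (exp (B\<^sup>2 / (2 * (1 / q)) + C) / sqrt (1 / q)))"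
    unfolding e using q A1 by (subst nn_integral_gauss_exp_quadratic) simp_all
  also have "1 / sqrt q * (exp (B\<^sup>2 / (2 * (1 / q)) + C) / sqrt (1 / q)) = tilt (m * t) g"
    unfolding x1 using q by (simp add: tilt_def real_sqrt_divide)
  finally show ?thesis .
qed

text \<open>This is the semigroup property of the Ornstein-Uhlenbeck kernel.\<close>

lemma nn_integral_mehler_mehler:
  fixes t s :: real
  assumes t: "\<bar>t\<bar> < 1" and s: "\<bar>s\<bar> < 1"
  shows "(\<integral>\<^sup>+g. ennreal (mehler t x g * mehler s z g) \<partial>gauss) = ennreal (mehler (t * s) x z)"
proof -
  define q where "q = 1 - t\<^sup>2"
  define p where "p = 1 - s\<^sup>2"
  define w where "w = 1 - (t * s)\<^sup>2"
  have q: "q > 0" using t by (simp add: q_def abs_square_less_1)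
  have p: "p > 0" using s by (simp add: p_def abs_square_less_1)
  have w_eq: "w = p + q - p * q"
    by (simp add: w_def p_def q_def power_mult_distrib algebra_simps)
  have "t\<^sup>2 * p \<ge> 0" using p by simp
  then have w: "w > 0" using q unfolding w_eq by (simp add: q_def algebra_simps)
  define A where "A = t\<^sup>2 / q + s\<^sup>2 / p"
  define B where "B = t * x / q + s * z / p"
  define C where "C = - (t\<^sup>2 * x\<^sup>2) / (2 * q) - (s\<^sup>2 * z\<^sup>2) / (2 * p)"
  have A1: "1 + A = w / (p * q)"
  proof -
    have ts: "t\<^sup>2 = 1 - q" "s\<^sup>2 = 1 - p" by (simp_all add: p_def q_def)
    have "A = ((1 - q) * p + (1 - p) * q) / (p * q)"
      using p q by (simp add: A_def ts add_divide_distrib)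
    then have "1 + A = (p * q + ((1 - q) * p + (1 - p) * q)) / (p * q)"
      using p q by (simp add: add_divide_distrib)
    also have "p * q + ((1 - q) * p + (1 - p) * q) = w"
      by (simp add: w_eq algebra_simps)
    finally show ?thesis .
  qed
  have e: "mehler t x g * mehler s z g = 1 / sqrt (p * q) * exp (- (A / 2) * g\<^sup>2 + B * g + C)" for g
  proof -
    have "- (t\<^sup>2 * x\<^sup>2 - 2 * t * x * g + t\<^sup>2 * g\<^sup>2) / (2 * q) +
        - (s\<^sup>2 * z\<^sup>2 - 2 * s * z * g + s\<^sup>2 * g\<^sup>2) / (2 * p) = - (A / 2) * g\<^sup>2 + B * g + C"
      by (simp add: A_def B_def C_def diff_divide_distrib add_divide_distrib algebra_simps)
    then show ?thesis
      by (simp add: mehler_def p_def[symmetric] q_def[symmetric] exp_add[symmetric] real_sqrt_mult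
          mult.commute)
  qed
  have x1: "B\<^sup>2 / (2 * (w / (p * q))) + C =
      - ((t * s)\<^sup>2 * x\<^sup>2 - 2 * (t * s) * x * z + (t * s)\<^sup>2 * z\<^sup>2) / (2 * w)"
  proof -
    have "B = (t * x * p + s * z * q) / (p * q)"
      using p q by (simp add: B_def field_simps)
    then have "B\<^sup>2 / (2 * (w / (p * q))) + C =
        ((t * x * p + s * z * q)\<^sup>2 - w * p * t\<^sup>2 * x\<^sup>2 - w * q * s\<^sup>2 * z\<^sup>2) / (2 * w * (p * q))"
      using p q w
      by (simp add: C_def diff_divide_distrib power_divide power2_eq_square[of "p * q"])
    also have "(t * x * p + s * z * q)\<^sup>2 - w * p * t\<^sup>2 * x\<^sup>2 - w * q * s\<^sup>2 * z\<^sup>2 =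
        (p * q) * (- ((t * s)\<^sup>2 * x\<^sup>2 - 2 * (t * s) * x * z + (t * s)\<^sup>2 * z\<^sup>2))"
      by (simp add: w_def p_def q_def power2_eq_square algebra_simps)
    finally show ?thesis using p q w by simp
  qed
  have "(\<integral>\<^sup>+g. ennreal (mehler t x g * mehler s z g) \<partial>gauss) =
      ennreal (1 / sqrt (p * q) * (exp (B\<^sup>2 / (2 * (w / (p * q))) + C) / sqrt (w / (p * q))))"
    unfolding e using p q w A1 by (subst nn_integral_gauss_exp_quadratic) simp_all
  also have "1 / sqrt (p * q) * (exp (B\<^sup>2 / (2 * (w / (p * q))) + C) / sqrt (w / (p * q))) =
      mehler (t * s) x z"
    unfolding x1 using p q by (simp add: mehler_def w_def[symmetric] real_sqrt_divide real_sqrt_mult)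
  finally show ?thesis .
qed

text \<open>This is the trace of the operator with eigenvalues \<open>r ^ j\<close>, a geometric
  series.\<close>

lemma nn_integral_mehler_diagonal:
  assumes r: "\<bar>r\<bar> < 1"
  shows "(\<integral>\<^sup>+x. ennreal (mehler r x x) \<partial>gauss) = ennreal (1 / (1 - r))"
proof -
  have r1: "1 - r > 0" "1 + r > 0" using r by simp_all
  define A where "A = - (2 * r / (1 + r))"
  have A1: "1 + A = (1 - r) / (1 + r)" using r1 by (simp add: A_def field_simps)
  have f: "1 - r\<^sup>2 = (1 - r) * (1 + r)" by (simp add: power2_eq_square algebra_simps)
  have e: "mehler r x x = 1 / sqrt (1 - r\<^sup>2) * exp (- (A / 2) * x\<^sup>2 + 0 * x + 0)" for x
  proof -
    have "r\<^sup>2 * x\<^sup>2 - 2 * r * x * x + r\<^sup>2 * x\<^sup>2 = (1 - r) * (- 2 * r * x\<^sup>2)"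
      by (simp add: power2_eq_square algebra_simps)
    then have "- (r\<^sup>2 * x\<^sup>2 - 2 * r * x * x + r\<^sup>2 * x\<^sup>2) / (2 * (1 - r\<^sup>2)) =
        ((1 - r) * (2 * r * x\<^sup>2)) / ((1 - r) * (2 * (1 + r)))"
      unfolding f by (simp only:) (simp add: ac_simps)
    also have "\<dots> = - (A / 2) * x\<^sup>2 + 0 * x + 0"
      using r1 by (simp add: A_def)
    finally have "- (r\<^sup>2 * x\<^sup>2 - 2 * r * x * x + r\<^sup>2 * x\<^sup>2) / (2 * (1 - r\<^sup>2)) = - (A / 2) * x\<^sup>2 + 0 * x + 0" .
    then show ?thesis by (simp add: mehler_def)
  qed
  have "(\<integral>\<^sup>+x. ennreal (mehler r x x) \<partial>gauss) =
      ennreal (1 / sqrt (1 - r\<^sup>2) * (exp (0\<^sup>2 / (2 * (1 + A)) + 0) / sqrt (1 + A)))"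
    unfolding e using r1 A1 f by (subst nn_integral_gauss_exp_quadratic) simp_all
  also have "1 / sqrt (1 - r\<^sup>2) * (exp (0\<^sup>2 / (2 * (1 + A)) + 0) / sqrt (1 + A)) = 1 / (1 - r)"
    using r1 unfolding A1 f by (simp add: real_sqrt_mult real_sqrt_divide)
  finally show ?thesis .
qed

section \<open>Exponential tilts and polynomial moments\<close>

lemma nn_integral_tilt_corr:
  fixes r k :: real
  assumes rk: "r\<^sup>2 + k\<^sup>2 = 1"
  shows "(\<integral>\<^sup>+y. ennreal (tilt m (r * x + k * y)) \<partial>gauss) = ennreal (tilt (m * r) x)"
proof -
  have e: "tilt m (r * x + k * y) =
      1 * exp (- (0 / 2) * y\<^sup>2 + (- (m * k)) * y + (- m * r * x - m\<^sup>2 / 2))" for y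
    by (simp add: tilt_def algebra_simps)
  have "(m * k)\<^sup>2 = m\<^sup>2 - (m * r)\<^sup>2"
  proof -
    have "m\<^sup>2 * (r\<^sup>2 + k\<^sup>2) = m\<^sup>2" by (simp add: rk)
    then show ?thesis by (simp add: power_mult_distrib distrib_left)
  qed
  then show ?thesis
    unfolding e
    by (subst nn_integral_gauss_exp_quadratic) (simp_all add: tilt_def diff_divide_distrib)
qed

lemma nn_integral_tilt_tilt:
  "(\<integral>\<^sup>+x. ennreal (tilt m x * tilt m' x) \<partial>gauss) = ennreal (exp (m * m'))"
proof -
  have e: "tilt m x * tilt m' x =
      1 * exp (- (0 / 2) * x\<^sup>2 + (- (m + m')) * x + (- (m\<^sup>2 + m'\<^sup>2) / 2))" for x
    by (simp add: tilt_def exp_add[symmetric] algebra_simps add_divide_distrib)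
  show ?thesis
    unfolding e
    by (subst nn_integral_gauss_exp_quadratic)
      (simp_all add: power2_eq_square algebra_simps diff_divide_distrib add_divide_distrib)
qed

text \<open>The one-dimensional Cameron-Martin formula: weighting by a tilt is a
  translation.\<close>

lemma nn_integral_gauss_tilt:
  assumes [measurable]: "f \<in> borel_measurable borel"
  shows "(\<integral>\<^sup>+g. f g * ennreal (tilt b g) \<partial>gauss) = (\<integral>\<^sup>+g. f (g - b) \<partial>gauss)"
proof -
  have e: "std_normal_density (- b + 1 * g) * tilt b (- b + 1 * g) = std_normal_density g" for g
    by (simp add: std_normal_density_def tilt_def exp_add[symmetric] power2_eq_square field_simps)
  have "(\<integral>\<^sup>+g. f g * ennreal (tilt b g) \<partial>gauss) =
      (\<integral>\<^sup>+g. f g * ennreal (std_normal_density g * tilt b g) \<partial>lborel)"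
    by (simp add: nn_integral_gauss ennreal_mult tilt_nonneg ac_simps)
  also have "\<dots> = (\<integral>\<^sup>+g. f (- b + 1 * g) * ennreal (std_normal_density g) \<partial>lborel)"
    by (subst nn_integral_real_affine[where c = 1 and t = "- b"]) (simp_all only: e, simp_all)
  finally show ?thesis
    by (simp add: nn_integral_gauss mult.commute)
qed

lemma gauss_moments:
  "has_bochner_integral gauss (\<lambda>x. x) 0"
  "has_bochner_integral gauss (\<lambda>x. x ^ 2) 1"
  "has_bochner_integral gauss (\<lambda>x. x ^ 3) 0"
  "has_bochner_integral gauss (\<lambda>x. x ^ 4) 3"
proof -
  have *: "has_bochner_integral gauss f c"
    if "has_bochner_integral lborel (\<lambda>x. std_normal_density x * f x) c"
      and "f \<in> borel_measurable borel" for f :: "real \<Rightarrow> real" and c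
    unfolding gauss_def using that by (intro has_bochner_integral_density) simp_all
  show "has_bochner_integral gauss (\<lambda>x. x) 0"
    using std_normal_moment_odd[of 0] by (intro *) simp_all
  show "has_bochner_integral gauss (\<lambda>x. x ^ 2) 1"
    using std_normal_moment_even[of 1] by (intro *) simp_all
  show "has_bochner_integral gauss (\<lambda>x. x ^ 3) 0"
    using std_normal_moment_odd[of 1] by (intro *) (simp_all add: numeral_3_eq_3)
  show "has_bochner_integral gauss (\<lambda>x. x ^ 4) 3"
    using std_normal_moment_even[of 2] by (intro *) (simp_all add: fact_numeral)
qed

lemma nn_integral_gauss_quartic:
  assumes "\<And>x. c0 + c1 * x + c2 * x ^ 2 + c3 * x ^ 3 + c4 * x ^ 4 \<ge> 0"
  shows "(\<integral>\<^sup>+x. ennreal (c0 + c1 * x + c2 * x ^ 2 + c3 * x ^ 3 + c4 * x ^ 4) \<partial>gauss) =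
    ennreal (c0 + c2 + 3 * c4)"
proof -
  have 0: "has_bochner_integral gauss (\<lambda>x. c0) c0"
    by (simp add: has_bochner_integral_iff gauss.prob_space[simplified])
  have "has_bochner_integral gauss (\<lambda>x. c0 + c1 * x + c2 * x ^ 2 + c3 * x ^ 3 + c4 * x ^ 4)
      (c0 + c1 * 0 + c2 * 1 + c3 * 0 + c4 * 3)"
    by (intro has_bochner_integral_add has_bochner_integral_mult_right gauss_moments 0)
  then show ?thesis
    using assms by (subst nn_integral_eq_integral)
      (auto simp: has_bochner_integral_iff algebra_simps)
qed

section \<open>The corrupted density\<close>

text \<open>The law of a corrupted sample has a density relative to the standard Gaussian law
  in \<open>g\<close>, the normalised \<open>y\<close>, and \<open>a = \<langle>A, v v\<^sup>T\<rangle>\<close>, the only feature of \<open>A\<close> on which \<open>y\<close>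
  depends. The contamination is a quadratic weight in \<open>g\<close> times an exponential tilt of \<open>a\<close>;
  the tilt is chosen below so that the mixture has no linear term in \<open>a\<close>.\<close>

definition contam :: "real \<Rightarrow> real \<Rightarrow> real \<Rightarrow> real" where
  "contam l a g = (1 + g)\<^sup>2 / 4 * tilt l a + (1 - g)\<^sup>2 / 4 * tilt (- l) a"

definition corrupt :: "real \<Rightarrow> real \<Rightarrow> real \<Rightarrow> real \<Rightarrow> real \<Rightarrow> real" where
  "corrupt \<epsilon> t l a g = (1 - \<epsilon>) * mehler t a g + \<epsilon> * contam l a g"

definition null_corrupt :: "real \<Rightarrow> real \<Rightarrow> real" where
  "null_corrupt \<epsilon> g = (1 - \<epsilon>) + \<epsilon> * (1 + g\<^sup>2) / 2"

lemma contam_nonneg: "contam l a g \<ge> 0"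
  by (simp add: contam_def tilt_nonneg)

lemma corrupt_nonneg: "0 \<le> \<epsilon> \<Longrightarrow> \<epsilon> \<le> 1 \<Longrightarrow> \<bar>t\<bar> < 1 \<Longrightarrow> corrupt \<epsilon> t l a g \<ge> 0"
  by (simp add: corrupt_def contam_nonneg mehler_nonneg)

lemma null_corrupt_nonneg: "0 \<le> \<epsilon> \<Longrightarrow> \<epsilon> \<le> 1 \<Longrightarrow> null_corrupt \<epsilon> g \<ge> 0"
  by (simp add: null_corrupt_def)

lemma measurable_contam [measurable (raw)]:
  assumes [measurable]: "f \<in> borel_measurable N" "g \<in> borel_measurable N"
  shows "(\<lambda>x. contam l (f x) (g x)) \<in> borel_measurable N"
  unfolding contam_def by measurable

lemma measurable_corrupt [measurable (raw)]:
  assumes [measurable]: "f \<in> borel_measurable N" "g \<in> borel_measurable N"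
  shows "(\<lambda>x. corrupt \<epsilon> t l (f x) (g x)) \<in> borel_measurable N"
  unfolding corrupt_def by measurable

lemma measurable_null_corrupt [measurable (raw)]:
  assumes [measurable]: "g \<in> borel_measurable N"
  shows "(\<lambda>x. null_corrupt \<epsilon> (g x)) \<in> borel_measurable N"
  unfolding null_corrupt_def by measurable

lemma nn_integral_lincomb:
  assumes [measurable]: "f \<in> borel_measurable M" "g \<in> borel_measurable M"
    and "\<And>x. f x \<ge> 0" "\<And>x. g x \<ge> 0" "a \<ge> 0" "b \<ge> 0"
    and "F \<ge> 0" "G \<ge> 0"
    and "(\<integral>\<^sup>+x. ennreal (f x) \<partial>M) = ennreal F" "(\<integral>\<^sup>+x. ennreal (g x) \<partial>M) = ennreal G"
  shows "(\<integral>\<^sup>+x. ennreal (a * f x + b * g x) \<partial>M) = ennreal (a * F + b * G)"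
proof -
  have "(\<integral>\<^sup>+x. ennreal (a * f x + b * g x) \<partial>M) =
      (\<integral>\<^sup>+x. ennreal a * ennreal (f x) + ennreal b * ennreal (g x) \<partial>M)"
    using assms by (intro nn_integral_cong) (simp add: ennreal_mult)
  also have "\<dots> = ennreal a * ennreal F + ennreal b * ennreal G"
    by (subst nn_integral_add) (simp_all add: nn_integral_cmult assms)
  finally show ?thesis using assms by (simp add: ennreal_mult)
qed

section \<open>Inner products of the mixture densities\<close>

lemma nn_integral_corrupt_corr:
  assumes e: "0 \<le> \<epsilon>" "\<epsilon> \<le> 1" and t: "\<bar>t\<bar> < 1" and rk: "r\<^sup>2 + k\<^sup>2 = 1"
  shows "(\<integral>\<^sup>+y. ennreal (corrupt \<epsilon> t l (r * x + k * y) g) \<partial>gauss) =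
    ennreal (corrupt \<epsilon> (t * r) (l * r) x g)"
proof -
  have r: "\<bar>r\<bar> \<le> 1"
    using rk by (metis abs_square_le_1 add_0 add_le_cancel_left add.commute le_add_same_cancel1
        zero_le_power2)
  have tr: "\<bar>t * r\<bar> < 1"
    using t r by (metis abs_mult abs_ge_zero le_less_trans mult_left_le)
  show ?thesis
    unfolding corrupt_def contam_def minus_mult_left
    by (intro nn_integral_lincomb nn_integral_mehler_corr nn_integral_tilt_corr)
      (use e t tr rk in \<open>simp_all add: mehler_nonneg tilt_nonneg\<close>)
qed

text \<open>At correlation 0 the feature drops out and the kernel and both tilts become 1. The
  result depends on neither \<open>t\<close> nor \<open>l\<close>, so it can serve as the common
  null density.\<close>

lemma nn_integral_corrupt:
  assumes e: "0 \<le> \<epsilon>" "\<epsilon> \<le> 1" and t: "\<bar>t\<bar> < 1"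
  shows "(\<integral>\<^sup>+x. ennreal (corrupt \<epsilon> t l x g) \<partial>gauss) = ennreal (null_corrupt \<epsilon> g)"
proof -
  have "corrupt \<epsilon> (t * 0) (l * 0) x g = null_corrupt \<epsilon> g" for x
    by (simp add: corrupt_def contam_def mehler_def tilt_def null_corrupt_def power2_eq_square
        field_simps)
  then show ?thesis
    using nn_integral_corrupt_corr[OF e t, of 0 1 l 0 g] by simp
qed

lemma nn_integral_null_corrupt:
  assumes e: "0 \<le> \<epsilon>" "\<epsilon> \<le> 1"
  shows "(\<integral>\<^sup>+g. ennreal (null_corrupt \<epsilon> g) \<partial>gauss) = 1"
proof -
  have eq: "null_corrupt \<epsilon> g = (1 - \<epsilon> / 2) + 0 * g + (\<epsilon> / 2) * g ^ 2 + 0 * g ^ 3 + 0 * g ^ 4" for g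
    by (simp add: null_corrupt_def field_simps)
  have "(\<integral>\<^sup>+g. ennreal (null_corrupt \<epsilon> g) \<partial>gauss) = ennreal ((1 - \<epsilon> / 2) + \<epsilon> / 2 + 3 * 0)"
    unfolding eq by (rule nn_integral_gauss_quartic) (use e in simp)
  then show ?thesis by simp
qed

lemma nn_integral_contam_diagonal:
  "(\<integral>\<^sup>+g. ennreal (contam b g g) \<partial>gauss) = ennreal ((1 + (1 - b)\<^sup>2) / 2)"
proof -
  have 1: "(\<integral>\<^sup>+g. ennreal ((1 + g)\<^sup>2 * tilt b g) \<partial>gauss) = ennreal (1 + (1 - b)\<^sup>2)"
  proof -
    have eq: "(1 + (g - b))\<^sup>2 = (1 - b)\<^sup>2 + (2 * (1 - b)) * g + 1 * g ^ 2 + 0 * g ^ 3 + 0 * g ^ 4"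
      for g :: real by (simp add: power2_eq_square algebra_simps)
    have "(\<integral>\<^sup>+g. ennreal ((1 + g)\<^sup>2 * tilt b g) \<partial>gauss) = (\<integral>\<^sup>+g. ennreal ((1 + (g - b))\<^sup>2) \<partial>gauss)"
      using nn_integral_gauss_tilt[of "\<lambda>g. ennreal ((1 + g)\<^sup>2)" b] by (simp add: ennreal_mult tilt_nonneg)
    also have "\<dots> = ennreal ((1 - b)\<^sup>2 + 1 + 3 * 0)"
      unfolding eq by (rule nn_integral_gauss_quartic) (simp only: eq[symmetric] zero_le_power2)
    finally show ?thesis by (simp add: add.commute)
  qed
  have 2: "(\<integral>\<^sup>+g. ennreal ((1 - g)\<^sup>2 * tilt (- b) g) \<partial>gauss) = ennreal (1 + (1 - b)\<^sup>2)"
  proof -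
    have eq: "(1 - (g - - b))\<^sup>2 = (1 - b)\<^sup>2 + (- 2 * (1 - b)) * g + 1 * g ^ 2 + 0 * g ^ 3 + 0 * g ^ 4"
      for g :: real by (simp add: power2_eq_square algebra_simps)
    have "(\<integral>\<^sup>+g. ennreal ((1 - g)\<^sup>2 * tilt (- b) g) \<partial>gauss) =
        (\<integral>\<^sup>+g. ennreal ((1 - (g - - b))\<^sup>2) \<partial>gauss)"
      using nn_integral_gauss_tilt[of "\<lambda>g. ennreal ((1 - g)\<^sup>2)" "- b"]
      by (simp add: ennreal_mult tilt_nonneg)
    also have "\<dots> = ennreal ((1 - b)\<^sup>2 + 1 + 3 * 0)"
      unfolding eq by (rule nn_integral_gauss_quartic) (simp only: eq[symmetric] zero_le_power2)
    finally show ?thesis by (simp add: add.commute)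
  qed
  have "contam b g g = 1 / 4 * ((1 + g)\<^sup>2 * tilt b g) + 1 / 4 * ((1 - g)\<^sup>2 * tilt (- b) g)" for g
    by (simp add: contam_def)
  then have "(\<integral>\<^sup>+g. ennreal (contam b g g) \<partial>gauss) =
      ennreal (1 / 4 * (1 + (1 - b)\<^sup>2) + 1 / 4 * (1 + (1 - b)\<^sup>2))"
    by (simp only:) (rule nn_integral_lincomb, simp_all only: 1 2, simp_all add: tilt_nonneg)
  then show ?thesis by (simp add: field_simps)
qed

text \<open>Integrating over \<open>x\<close> first carries each tilt through the kernel, so that
  tilt and weight are both functions of \<open>g\<close>, with parameter \<open>l * t\<close>. What
  remains is the diagonal integral above.\<close>

lemma nn_integral_mehler_contam:
  assumes t: "\<bar>t\<bar> < 1"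
  shows "(\<integral>\<^sup>+g. \<integral>\<^sup>+x. ennreal (mehler t x g * contam l x g) \<partial>gauss \<partial>gauss) =
    ennreal ((1 + (1 - l * t)\<^sup>2) / 2)"
proof -
  have "(\<integral>\<^sup>+x. ennreal (mehler t x g * contam l x g) \<partial>gauss) = ennreal (contam (l * t) g g)" for g
  proof -
    have "mehler t x g * contam l x g = (1 + g)\<^sup>2 / 4 * (mehler t x g * tilt l x) +
        (1 - g)\<^sup>2 / 4 * (mehler t x g * tilt (- l) x)" for x
      by (simp add: contam_def algebra_simps)
    then show ?thesis
      unfolding contam_def[of "l * t"] minus_mult_left
      by (simp only:) (intro nn_integral_lincomb nn_integral_mehler_tilt t,
          use t in \<open>simp_all add: mehler_nonneg tilt_nonneg\<close>)
  qed
  then show ?thesis by (simp add: nn_integral_contam_diagonal)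
qed

lemma nn_integral_contam_contam:
  "(\<integral>\<^sup>+g. \<integral>\<^sup>+x. ennreal (contam l x g * contam m x g) \<partial>gauss \<partial>gauss) =
    ennreal (5 / 4 * exp (l * m) + 1 / 4 * exp (- (l * m)))"
proof -
  \<comment> \<open>\<open>P\<close> collects the products of tilts of equal sign, which integrate
    to \<open>exp (l * m)\<close>, and \<open>R\<close> those of opposite sign, which give
    \<open>exp (- (l * m))\<close>. Their means \<open>5 / 4\<close> and \<open>1 / 4\<close> come
    from the Gaussian moments up to degree four.\<close>
  define P where "P = (\<lambda>g :: real. ((1 + g) ^ 4 + (1 - g) ^ 4) / 16)"
  define R where "R = (\<lambda>g :: real. (1 - g\<^sup>2)\<^sup>2 / 8)"
  have pos: "P g \<ge> 0" "R g \<ge> 0" for g by (simp_all add: P_def R_def)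
  have [measurable]: "P \<in> borel_measurable borel" "R \<in> borel_measurable borel"
    by (simp_all add: P_def R_def)
  have inner: "(\<integral>\<^sup>+x. ennreal (contam l x g * contam m x g) \<partial>gauss) =
      ennreal (exp (l * m) * P g + exp (- (l * m)) * R g)" for g
  proof -
    define a where "a = (1 + g)\<^sup>2 / 4"
    define b where "b = (1 - g)\<^sup>2 / 4"
    have ab: "a \<ge> 0" "b \<ge> 0" by (simp_all add: a_def b_def)
    have aa: "a * a + b * b = P g" "2 * (a * b) = R g"
      by (simp_all add: a_def b_def P_def R_def power2_eq_square power4_eq_xxxx algebra_simps
          add_divide_distrib diff_divide_distrib)
    have eq: "contam l x g * contam m x g =
        1 * ((a * a) * (tilt l x * tilt m x) + (b * b) * (tilt (- l) x * tilt (- m) x)) +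
        (a * b) * (1 * (tilt l x * tilt (- m) x) + 1 * (tilt (- l) x * tilt m x))" for x
      by (simp add: contam_def a_def[symmetric] b_def[symmetric] algebra_simps)
    have "(\<integral>\<^sup>+x. ennreal (contam l x g * contam m x g) \<partial>gauss) =
        ennreal (1 * ((a * a) * exp (l * m) + (b * b) * exp ((- l) * (- m))) +
          (a * b) * (1 * exp (l * (- m)) + 1 * exp ((- l) * m)))"
      unfolding eq by (intro nn_integral_lincomb nn_integral_tilt_tilt)
        (simp_all add: tilt_nonneg ab)
    also have "1 * ((a * a) * exp (l * m) + (b * b) * exp ((- l) * (- m))) +
          (a * b) * (1 * exp (l * (- m)) + 1 * exp ((- l) * m)) =
        exp (l * m) * P g + exp (- (l * m)) * R g"
      by (simp add: aa[symmetric] algebra_simps)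
    finally show ?thesis .
  qed
  have P: "(\<integral>\<^sup>+g. ennreal (P g) \<partial>gauss) = ennreal (5 / 4)"
  proof -
    have eq: "P g = 1 / 8 + 0 * g + 3 / 4 * g ^ 2 + 0 * g ^ 3 + 1 / 8 * g ^ 4" for g
      by (simp add: P_def power2_eq_square power3_eq_cube power4_eq_xxxx algebra_simps
          add_divide_distrib diff_divide_distrib)
    have "(\<integral>\<^sup>+g. ennreal (P g) \<partial>gauss) = ennreal (1 / 8 + 3 / 4 + 3 * (1 / 8))"
      unfolding eq by (rule nn_integral_gauss_quartic) (simp only: eq[symmetric] pos)
    then show ?thesis by simp
  qed
  have R: "(\<integral>\<^sup>+g. ennreal (R g) \<partial>gauss) = ennreal (1 / 4)"
  proof -
    have eq: "R g = 1 / 8 + 0 * g + (- 1 / 4) * g ^ 2 + 0 * g ^ 3 + 1 / 8 * g ^ 4" for g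
      by (simp add: R_def power2_eq_square power3_eq_cube power4_eq_xxxx algebra_simps
          add_divide_distrib diff_divide_distrib)
    have "(\<integral>\<^sup>+g. ennreal (R g) \<partial>gauss) = ennreal (1 / 8 + (- 1 / 4) + 3 * (1 / 8))"
      unfolding eq by (rule nn_integral_gauss_quartic) (simp only: eq[symmetric] pos)
    then show ?thesis by simp
  qed
  have "(\<integral>\<^sup>+g. ennreal (exp (l * m) * P g + exp (- (l * m)) * R g) \<partial>gauss) =
      ennreal (exp (l * m) * (5 / 4) + exp (- (l * m)) * (1 / 4))"
    by (intro nn_integral_lincomb P R) (simp_all add: pos)
  then show ?thesis by (simp add: inner mult.commute)
qed

text \<open>The inner product of two corrupted likelihoods whose features have correlation
  \<open>r\<close>: clean against clean, the two equal cross terms, and contamination against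
  contamination.\<close>

definition overlap :: "real \<Rightarrow> real \<Rightarrow> real \<Rightarrow> real \<Rightarrow> real" where
  "overlap \<epsilon> t l r = (1 - \<epsilon>)\<^sup>2 / (1 - t\<^sup>2 * r) + \<epsilon> * (1 - \<epsilon>) * (1 + (1 - l * r * t)\<^sup>2) +
    \<epsilon>\<^sup>2 * (5 / 4 * exp (l\<^sup>2 * r) + 1 / 4 * exp (- (l\<^sup>2 * r)))"

text \<open>Averaging over \<open>y\<close> turns the second factor into a corrupted density at the
  same \<open>x\<close> with both parameters multiplied by \<open>r\<close>. Then only
  \<open>x\<close> and \<open>g\<close> remain, and the product splits into the four pairings
  computed above.\<close>

lemma nn_integral_corrupt_corrupt:
  assumes e: "0 \<le> \<epsilon>" "\<epsilon> \<le> 1" and t: "\<bar>t\<bar> < 1" and rk: "r\<^sup>2 + k\<^sup>2 = 1"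
  shows "(\<integral>\<^sup>+x. \<integral>\<^sup>+y. \<integral>\<^sup>+g. ennreal (corrupt \<epsilon> t l x g * corrupt \<epsilon> t l (r * x + k * y) g)
      \<partial>gauss \<partial>gauss \<partial>gauss) = ennreal (overlap \<epsilon> t l r)"
proof -
  have r: "\<bar>r\<bar> \<le> 1"
    using rk by (metis abs_square_le_1 add_0 add_le_cancel_left add.commute le_add_same_cancel1
        zero_le_power2)
  have tr: "\<bar>t * r\<bar> < 1"
    using t r by (metis abs_mult abs_ge_zero le_less_trans mult_left_le)
  have ttr: "\<bar>t * (t * r)\<bar> < 1"
    using t tr by (metis abs_mult abs_ge_zero le_less_trans mult_left_le less_imp_le)
  note nn = corrupt_nonneg[OF e t] corrupt_nonneg[OF e tr] mehler_nonneg[OF t] mehler_nonneg[OF tr]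
    contam_nonneg
  have 1: "(\<integral>\<^sup>+y. ennreal (corrupt \<epsilon> t l x g * corrupt \<epsilon> t l (r * x + k * y) g) \<partial>gauss) =
      ennreal (corrupt \<epsilon> t l x g * corrupt \<epsilon> (t * r) (l * r) x g)" for x g
    by (simp add: ennreal_mult nn nn_integral_cmult nn_integral_corrupt_corr[OF e t rk])
  have A: "(\<integral>\<^sup>+g. \<integral>\<^sup>+x. ennreal (mehler t x g * mehler (t * r) x g) \<partial>gauss \<partial>gauss) =
      ennreal (1 / (1 - t\<^sup>2 * r))"
  proof -
    have "(\<integral>\<^sup>+g. \<integral>\<^sup>+x. ennreal (mehler t x g * mehler (t * r) x g) \<partial>gauss \<partial>gauss) =
        (\<integral>\<^sup>+x. \<integral>\<^sup>+g. ennreal (mehler t x g * mehler (t * r) x g) \<partial>gauss \<partial>gauss)"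
      by (rule gauss2.Fubini') simp
    also have "\<dots> = ennreal (1 / (1 - t * (t * r)))"
      using t tr ttr by (simp add: nn_integral_mehler_mehler nn_integral_mehler_diagonal)
    finally show ?thesis by (simp add: power2_eq_square mult.assoc)
  qed
  have eq: "corrupt \<epsilon> t l x g * corrupt \<epsilon> (t * r) (l * r) x g =
      (1 - \<epsilon>) * ((1 - \<epsilon>) * (mehler t x g * mehler (t * r) x g) + \<epsilon> * (mehler t x g * contam (l * r) x g)) +
      \<epsilon> * ((1 - \<epsilon>) * (mehler (t * r) x g * contam l x g) + \<epsilon> * (contam l x g * contam (l * r) x g))"
    for x g by (simp add: corrupt_def algebra_simps)
  have pos: "0 \<le> 1 / (1 - t\<^sup>2 * r)"
    using ttr by (simp add: power2_eq_square mult.assoc)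
  have split: "(\<integral>\<^sup>+g. \<integral>\<^sup>+x. ennreal (a * f x g + b * h x g) \<partial>gauss \<partial>gauss) = ennreal (a * F + b * H)"
    if [measurable]: "case_prod f \<in> borel_measurable (borel \<Otimes>\<^sub>M borel)"
        "case_prod h \<in> borel_measurable (borel \<Otimes>\<^sub>M borel)"
      and "\<And>x g. f x g \<ge> 0" "\<And>x g. h x g \<ge> 0" "a \<ge> 0" "b \<ge> 0" "F \<ge> 0" "H \<ge> 0"
        "(\<integral>\<^sup>+g. \<integral>\<^sup>+x. ennreal (f x g) \<partial>gauss \<partial>gauss) = ennreal F"
        "(\<integral>\<^sup>+g. \<integral>\<^sup>+x. ennreal (h x g) \<partial>gauss \<partial>gauss) = ennreal H"
    for f h :: "real \<Rightarrow> real \<Rightarrow> real" and a b F H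
  proof -
    have "(\<integral>\<^sup>+g. \<integral>\<^sup>+x. ennreal (a * f x g + b * h x g) \<partial>gauss \<partial>gauss) =
        (\<integral>\<^sup>+g. ennreal a * (\<integral>\<^sup>+x. ennreal (f x g) \<partial>gauss) + ennreal b * (\<integral>\<^sup>+x. ennreal (h x g) \<partial>gauss) \<partial>gauss)"
      using that(3-8) by (simp add: ennreal_mult nn_integral_add nn_integral_cmult)
    also have "\<dots> = ennreal a * ennreal F + ennreal b * ennreal H"
      using that(9,10) by (simp add: nn_integral_add nn_integral_cmult)
    finally show ?thesis using that(3-8) by (simp add: ennreal_mult)
  qed
  have "(\<integral>\<^sup>+x. \<integral>\<^sup>+y. \<integral>\<^sup>+g. ennreal (corrupt \<epsilon> t l x g * corrupt \<epsilon> t l (r * x + k * y) g)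
      \<partial>gauss \<partial>gauss \<partial>gauss) =
    (\<integral>\<^sup>+x. \<integral>\<^sup>+g. \<integral>\<^sup>+y. ennreal (corrupt \<epsilon> t l x g * corrupt \<epsilon> t l (r * x + k * y) g)
      \<partial>gauss \<partial>gauss \<partial>gauss)"
    by (intro nn_integral_cong gauss2.Fubini') simp
  also have "\<dots> = (\<integral>\<^sup>+g. \<integral>\<^sup>+x. ennreal (corrupt \<epsilon> t l x g * corrupt \<epsilon> (t * r) (l * r) x g) \<partial>gauss \<partial>gauss)"
    unfolding 1 by (rule gauss2.Fubini') simp
  also have "\<dots> = ennreal ((1 - \<epsilon>) * ((1 - \<epsilon>) * (1 / (1 - t\<^sup>2 * r)) + \<epsilon> * ((1 + (1 - (l * r) * t)\<^sup>2) / 2)) +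
      \<epsilon> * ((1 - \<epsilon>) * ((1 + (1 - l * (t * r))\<^sup>2) / 2) +
        \<epsilon> * (5 / 4 * exp (l * (l * r)) + 1 / 4 * exp (- (l * (l * r))))))"
    unfolding eq
    by (intro split A nn_integral_mehler_contam nn_integral_contam_contam t tr)
      (use e pos in \<open>simp_all add: nn\<close>)
  also have "\<dots> = ennreal (overlap \<epsilon> t l r)"
    by (simp add: overlap_def power2_eq_square algebra_simps add_divide_distrib diff_divide_distrib)
  finally show ?thesis .
qed

section \<open>Growth of the overlap away from correlation zero\<close>

definition gap_const :: "real \<Rightarrow> real" where
  "gap_const \<epsilon> = 1 + 1 / \<epsilon> + exp (1 / \<epsilon>\<^sup>2) / \<epsilon>\<^sup>2"

lemma exp_le_quadratic:
  fixes w :: real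
  assumes "0 \<le> w" "w \<le> W"
  shows "exp w \<le> 1 + w + w\<^sup>2 / 2 * exp W"
proof -
  obtain s where s: "\<bar>s\<bar> \<le> \<bar>w\<bar>" and e: "exp w = (\<Sum>m<2. w ^ m / fact m) + exp s / fact 2 * w ^ 2"
    using Maclaurin_exp_le[of w 2] by blast
  have "exp s \<le> exp W" using s assms by simp
  then have "exp s / 2 * w\<^sup>2 \<le> exp W / 2 * w\<^sup>2"
    by (intro mult_right_mono divide_right_mono) simp_all
  then show ?thesis unfolding e by (simp add: numeral_2_eq_2 mult.commute)
qed

text \<open>The upper bound for \<open>exp (- w)\<close> follows from the Taylor lower bound for
  \<open>exp w\<close>, because the product of the two quadratics is \<open>1 + w ^ 4 / 4\<close>,
  hence at least 1.\<close>

lemma exp_minus_le_quadratic: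
  fixes w :: real
  assumes "0 \<le> w"
  shows "exp (- w) \<le> 1 - w + w\<^sup>2 / 2"
proof -
  have "1 + w + w\<^sup>2 / 2 \<le> exp w"
    using exp_lower_Taylor_quadratic[OF assms] by simp
  moreover have "(1 - w + w\<^sup>2 / 2) * (1 + w + w\<^sup>2 / 2) = 1 + (w\<^sup>2)\<^sup>2 / 4"
    by (simp add: power2_eq_square algebra_simps)
  moreover have "1 - w + w\<^sup>2 / 2 \<ge> 0"
    using sum_power2_ge_zero[of "w - 1" 1] by (simp add: power2_eq_square algebra_simps)
  ultimately have "1 \<le> (1 - w + w\<^sup>2 / 2) * exp w"
    by (smt (verit, best) mult_left_mono zero_le_power2 divide_nonneg_nonneg)
  then show ?thesis
    by (simp add: exp_minus divide_inverse[symmetric] field_simps)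
qed

text \<open>The terms of the gap that are linear in \<open>r\<close> add up to \<open>((1 - \<epsilon>) * t - \<epsilon> * l)\<^sup>2 * r\<close>,
  which vanishes by the choice of the tilt \<open>l\<close>.\<close>

lemma overlap_gap:
  assumes e: "0 < \<epsilon>" "\<epsilon> < 1" and t: "0 \<le> t" "t < 1" and r: "0 \<le> r" "r \<le> 1"
    and l: "l = (1 - \<epsilon>) * t / \<epsilon>"
  shows "overlap \<epsilon> t l r - overlap \<epsilon> t l 0 \<le> gap_const \<epsilon> * (r\<^sup>2 / (1 - t\<^sup>2 * r))"
proof -
  define z where "z = t\<^sup>2 * r"
  have t2: "0 \<le> t\<^sup>2" "t\<^sup>2 < 1" "t\<^sup>2 \<le> 1" using t by (simp_all add: power_less_one_iff abs_square_less_1 power_le_one)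
  have z: "0 \<le> z" "z < 1"
    using t2 r by (auto simp: z_def intro: le_less_trans[OF mult_left_le])
  have l0: "0 \<le> l" using e t l by simp
  have el: "\<epsilon> * l = (1 - \<epsilon>) * t" using e l by simp
  have el1: "\<epsilon> * l \<le> 1" unfolding el using e t by (simp add: mult_le_one)
  have l1: "l \<le> 1 / \<epsilon>" using el1 e by (simp add: field_simps)
  have l2: "l\<^sup>2 \<le> 1 / \<epsilon>\<^sup>2" using power_mono[OF l1 l0, of 2] by (simp add: power_divide)
  define w where "w = l\<^sup>2 * r"
  have w: "0 \<le> w" "w \<le> 1 / \<epsilon>\<^sup>2"
    using r l2 by (auto simp: w_def intro: order_trans[OF mult_left_le])
  define E where "E = exp (1 / \<epsilon>\<^sup>2)"
  have E1: "E \<ge> 1" by (simp add: E_def)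
  have x1: "exp w - 1 \<le> w + w\<^sup>2 / 2 * E" using exp_le_quadratic[OF w] by (simp add: E_def)
  have x2: "exp (- w) - 1 \<le> - w + w\<^sup>2 / 2" using exp_minus_le_quadratic[OF w(1)] by simp
  \<comment> \<open>Since \<open>5 / 4 - 1 / 4 = 1\<close>, the linear part is exactly
    \<open>w\<close>. It has to be exact here, as it takes part in the cancellation below; the
    quadratic part may be wasteful.\<close>
  have x3: "5 / 4 * (exp w - 1) + 1 / 4 * (exp (- w) - 1) \<le> w + w\<^sup>2 * E"
  proof -
    define y where "y = w\<^sup>2 * E"
    have "w\<^sup>2 \<le> y" using E1 mult_left_mono[of 1 E "w\<^sup>2"] by (simp add: y_def)
    moreover have "0 \<le> y" using E1 by (simp add: y_def)
    moreover have "exp w - 1 \<le> w + y / 2" using x1 by (simp add: y_def)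
    moreover have "5 / 4 * a + 1 / 4 * b \<le> w + y"
      if "w\<^sup>2 \<le> y" "0 \<le> y" "a \<le> w + y / 2" "b \<le> - w + w\<^sup>2 / 2" for a b
      using that by (simp add: field_simps)
    ultimately show ?thesis unfolding y_def[symmetric] using x2 by blast
  qed
  have geo: "1 / (1 - z) - 1 = z + z\<^sup>2 / (1 - z)"
    using z by (simp add: field_simps power2_eq_square)
  have "overlap \<epsilon> t l r - overlap \<epsilon> t l 0 =
      (1 - \<epsilon>)\<^sup>2 * (1 / (1 - z) - 1) + \<epsilon> * (1 - \<epsilon>) * ((1 - l * r * t)\<^sup>2 - 1) +
      \<epsilon>\<^sup>2 * (5 / 4 * (exp w - 1) + 1 / 4 * (exp (- w) - 1))"
    by (simp add: overlap_def z_def w_def algebra_simps)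
  also have "\<dots> \<le> (1 - \<epsilon>)\<^sup>2 * (z + z\<^sup>2 / (1 - z)) + \<epsilon> * (1 - \<epsilon>) * ((1 - l * r * t)\<^sup>2 - 1) +
      \<epsilon>\<^sup>2 * (w + w\<^sup>2 * E)"
    unfolding geo by (intro add_left_mono mult_left_mono[OF x3]) simp
  also have "\<dots> = ((1 - \<epsilon>) * t - \<epsilon> * l)\<^sup>2 * r +
      ((1 - \<epsilon>)\<^sup>2 * (z\<^sup>2 / (1 - z)) + \<epsilon> * (1 - \<epsilon>) * (l * r * t)\<^sup>2 + \<epsilon>\<^sup>2 * (w\<^sup>2 * E))"
    by (simp add: z_def w_def power2_eq_square algebra_simps)
  also have "\<dots> = (1 - \<epsilon>)\<^sup>2 * (z\<^sup>2 / (1 - z)) + \<epsilon> * (1 - \<epsilon>) * (l * r * t)\<^sup>2 + \<epsilon>\<^sup>2 * (w\<^sup>2 * E)"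
    by (simp add: el)
  \<comment> \<open>The three summands of \<open>gap_const\<close> bound the three remaining terms,
    using \<open>l \<le> 1 / \<epsilon>\<close> and \<open>\<epsilon> * l \<le> 1\<close>. Only the
    clean term really has the denominator \<open>1 - z\<close>; the others are weakened to share
    it.\<close>
  also have "\<dots> \<le> 1 * (r\<^sup>2 / (1 - z)) + 1 / \<epsilon> * (r\<^sup>2 / (1 - z)) + E / \<epsilon>\<^sup>2 * (r\<^sup>2 / (1 - z))"
  proof (intro add_mono)
    have zr: "z \<le> r" using t2 r by (simp add: z_def mult_left_le_one_le)
    have r2: "r\<^sup>2 \<le> r\<^sup>2 / (1 - z)" using z by (simp add: pos_le_divide_eq mult_left_le)
    show "(1 - \<epsilon>)\<^sup>2 * (z\<^sup>2 / (1 - z)) \<le> 1 * (r\<^sup>2 / (1 - z))"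
      using z e zr by (intro mult_mono divide_right_mono power_mono) (simp_all add: power_le_one)
    have "\<epsilon> * (1 - \<epsilon>) * (l * r * t)\<^sup>2 = ((\<epsilon> * l) * l) * ((1 - \<epsilon>) * t\<^sup>2) * r\<^sup>2"
      by (simp add: power2_eq_square ac_simps)
    also have "\<dots> \<le> (1 * (1 / \<epsilon>)) * (1 * 1) * (r\<^sup>2 / (1 - z))"
      using e el1 l0 l1 t2 z r2 by (intro mult_mono) simp_all
    finally show "\<epsilon> * (1 - \<epsilon>) * (l * r * t)\<^sup>2 \<le> 1 / \<epsilon> * (r\<^sup>2 / (1 - z))" by simp
    have "\<epsilon>\<^sup>2 * (w\<^sup>2 * E) = (((\<epsilon> * l)\<^sup>2 * l\<^sup>2) * E) * r\<^sup>2"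
      by (simp add: w_def power2_eq_square ac_simps)
    also have "\<dots> \<le> ((1 * (1 / \<epsilon>\<^sup>2)) * E) * (r\<^sup>2 / (1 - z))"
      using e el1 l0 l2 E1 r2 by (intro mult_mono) (simp_all add: power_le_one)
    finally show "\<epsilon>\<^sup>2 * (w\<^sup>2 * E) \<le> E / \<epsilon>\<^sup>2 * (r\<^sup>2 / (1 - z))" by simp
  qed
  also have "\<dots> = gap_const \<epsilon> * (r\<^sup>2 / (1 - t\<^sup>2 * r))"
    by (simp only: gap_const_def z_def E_def distrib_right)
  finally show ?thesis .
qed

section \<open>Second moments of the distinguishing advantages\<close>

definition gauss_samples :: "nat \<Rightarrow> sample measure" where
  "gauss_samples d = PiM ({..<d} \<times> {..<d}) (\<lambda>_. gauss) \<Otimes>\<^sub>M gauss"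

definition dot :: "nat \<Rightarrow> (nat \<Rightarrow> real) \<Rightarrow> (nat \<Rightarrow> real) \<Rightarrow> real" where
  "dot d u v = (\<Sum>i<d. u i * v i)"

lemma frob_inner_outer: "frob_inner d (outer u) (outer v) = (dot d u v)\<^sup>2"
  by (simp add: frob_inner_def outer_def dot_def power2_eq_square sum_product sum.cartesian_product
      split_def ac_simps)

lemma sets_PiM_gauss [measurable_cong]:
  "sets (PiM I (\<lambda>_. gauss)) = sets (PiM I (\<lambda>_. borel))"
  by (rule sets_PiM_cong) simp_all

lemma sets_gauss_samples [measurable_cong]: "sets (gauss_samples d) = sets (sample_space d)"
  unfolding gauss_samples_def sample_space_def by (intro sets_pair_measure_cong sets_PiM_gauss sets_gauss)

lemma measurable_frob_inner [measurable]:
  "(\<lambda>A. frob_inner d A B) \<in> borel_measurable (PiM ({..<d} \<times> {..<d}) (\<lambda>_. borel))"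
  unfolding frob_inner_def by measurable

lemma prob_space_PiM_gauss: "prob_space (PiM I (\<lambda>_. gauss))"
  by (rule prob_space_PiM) (rule prob_space_gauss)

lemma prob_space_gauss_samples: "prob_space (gauss_samples d)"
  unfolding gauss_samples_def
  by (rule prob_space_pair[OF prob_space_PiM_gauss prob_space_gauss])

lemma nn_integral_gauss_samples:
  assumes "f \<in> borel_measurable (gauss_samples d)"
  shows "(\<integral>\<^sup>+x. f x \<partial>gauss_samples d) =
    (\<integral>\<^sup>+A. \<integral>\<^sup>+g. f (A, g) \<partial>gauss \<partial>PiM ({..<d} \<times> {..<d}) (\<lambda>_. gauss))"
  using assms unfolding gauss_samples_def by (rule gauss.nn_integral_fst[symmetric])

definition likelihood :: "nat \<Rightarrow> real \<Rightarrow> real \<Rightarrow> real \<Rightarrow> (nat \<Rightarrow> real) \<Rightarrow> sample \<Rightarrow> real" where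
  "likelihood d \<epsilon> t l v = (\<lambda>(A, g). corrupt \<epsilon> t l (frob_inner d A (outer v)) g)"

definition null_likelihood :: "real \<Rightarrow> sample \<Rightarrow> real" where
  "null_likelihood \<epsilon> = (\<lambda>(A, g). null_corrupt \<epsilon> g)"

lemma measurable_likelihood [measurable]:
  "likelihood d \<epsilon> t l v \<in> borel_measurable (gauss_samples d)"
  "null_likelihood \<epsilon> \<in> borel_measurable (gauss_samples d)"
  unfolding likelihood_def null_likelihood_def gauss_samples_def by measurable

text \<open>For unit \<open>v\<close> and \<open>w\<close> the matrices \<open>outer v\<close> and
  \<open>outer w\<close> are unit vectors in the Frobenius inner product, with inner product
  \<open>(dot d v w)\<^sup>2\<close>. The two features are therefore standard Gaussian with this
  correlation, and the dimension disappears from the integrals.\<close>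

lemma nn_integral_two_features:
  assumes v: "dot d v v = 1" and w: "dot d w w = 1"
  shows "\<exists>k. ((dot d v w)\<^sup>2)\<^sup>2 + k\<^sup>2 = 1 \<and> (\<forall>F \<in> borel_measurable (borel \<Otimes>\<^sub>M borel).
    (\<integral>\<^sup>+A. F (frob_inner d A (outer v), frob_inner d A (outer w))
      \<partial>PiM ({..<d} \<times> {..<d}) (\<lambda>_. gauss)) =
    (\<integral>\<^sup>+x. \<integral>\<^sup>+y. F (x, (dot d v w)\<^sup>2 * x + k * y) \<partial>gauss \<partial>gauss))"
proof -
  obtain a b k where a: "a \<ge> 0" "a\<^sup>2 = (\<Sum>i\<in>{..<d} \<times> {..<d}. (outer v i)\<^sup>2)"
    and ab: "a * b = (\<Sum>i\<in>{..<d} \<times> {..<d}. outer v i * outer w i)"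
    and bk: "b\<^sup>2 + k\<^sup>2 = (\<Sum>i\<in>{..<d} \<times> {..<d}. (outer w i)\<^sup>2)"
    and F: "\<forall>F \<in> borel_measurable (borel \<Otimes>\<^sub>M borel).
      (\<integral>\<^sup>+A. F (\<Sum>i\<in>{..<d} \<times> {..<d}. A i * outer v i, \<Sum>i\<in>{..<d} \<times> {..<d}. A i * outer w i)
        \<partial>PiM ({..<d} \<times> {..<d}) (\<lambda>_. gauss)) =
      (\<integral>\<^sup>+x. \<integral>\<^sup>+y. F (a * x, b * x + k * y) \<partial>gauss \<partial>gauss)"
    using nn_integral_PiM_gauss_two_forms[of "{..<d} \<times> {..<d}" "outer v" "outer w"] by auto
  note fo = frob_inner_outer[where d = d, unfolded frob_inner_def]
  have "a\<^sup>2 = 1" using a(2) fo[of v v] v by (simp add: power2_eq_square)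
  then have a1: "a = 1" using a(1) by (simp add: power2_eq_1_iff)
  have b1: "b = (dot d v w)\<^sup>2" using ab a1 fo[of v w] by simp
  have "b\<^sup>2 + k\<^sup>2 = 1" using bk fo[of w w] w by (simp add: power2_eq_square)
  then show ?thesis using F a1 b1 by (auto simp: frob_inner_def)
qed

context
  fixes d :: nat and \<epsilon> t l :: real
  assumes e: "0 \<le> \<epsilon>" "\<epsilon> \<le> 1" and t: "\<bar>t\<bar> < 1"
begin

lemma likelihood_nonneg: "likelihood d \<epsilon> t l v x \<ge> 0" "null_likelihood \<epsilon> x \<ge> 0"
  using e t by (simp_all add: likelihood_def null_likelihood_def corrupt_nonneg null_corrupt_nonneg
      split_beta)

lemma nn_integral_likelihood_likelihood:
  assumes v: "dot d v v = 1" and w: "dot d w w = 1"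
  shows "(\<integral>\<^sup>+x. ennreal (likelihood d \<epsilon> t l v x * likelihood d \<epsilon> t l w x) \<partial>gauss_samples d) =
    ennreal (overlap \<epsilon> t l ((dot d v w)\<^sup>2))"
proof -
  obtain k where k: "((dot d v w)\<^sup>2)\<^sup>2 + k\<^sup>2 = 1" and
    F: "\<And>F. F \<in> borel_measurable (borel \<Otimes>\<^sub>M borel) \<Longrightarrow>
    (\<integral>\<^sup>+A. F (frob_inner d A (outer v), frob_inner d A (outer w))
      \<partial>PiM ({..<d} \<times> {..<d}) (\<lambda>_. gauss)) =
    (\<integral>\<^sup>+x. \<integral>\<^sup>+y. F (x, (dot d v w)\<^sup>2 * x + k * y) \<partial>gauss \<partial>gauss)"
    using nn_integral_two_features[OF v w] by blast
  show ?thesis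
    using F[of "\<lambda>p. \<integral>\<^sup>+g. ennreal (corrupt \<epsilon> t l (fst p) g * corrupt \<epsilon> t l (snd p) g) \<partial>gauss"]
    by (subst nn_integral_gauss_samples)
      (measurable, simp add: likelihood_def nn_integral_corrupt_corrupt[OF e t k])
qed

lemma nn_integral_corrupt_feature:
  assumes v: "dot d v v = 1"
  shows "(\<integral>\<^sup>+A. ennreal (corrupt \<epsilon> t l (frob_inner d A (outer v)) g)
      \<partial>PiM ({..<d} \<times> {..<d}) (\<lambda>_. gauss)) = ennreal (null_corrupt \<epsilon> g)"
proof -
  obtain k where
    F: "\<And>F. F \<in> borel_measurable (borel \<Otimes>\<^sub>M borel) \<Longrightarrow>
    (\<integral>\<^sup>+A. F (frob_inner d A (outer v), frob_inner d A (outer v))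
      \<partial>PiM ({..<d} \<times> {..<d}) (\<lambda>_. gauss)) =
    (\<integral>\<^sup>+x. \<integral>\<^sup>+y. F (x, (dot d v v)\<^sup>2 * x + k * y) \<partial>gauss \<partial>gauss)"
    using nn_integral_two_features[OF v v] by blast
  show ?thesis
    using F[of "\<lambda>p. ennreal (corrupt \<epsilon> t l (fst p) g)"]
    by (simp add: nn_integral_corrupt[OF e t] gauss.emeasure_space_1[simplified])
qed

text \<open>The null density is the average of \<open>corrupt\<close> over its feature, so a product
  of two null densities is the overlap of two independent features.\<close>

lemma nn_integral_null_null:
  "(\<integral>\<^sup>+g. ennreal (null_corrupt \<epsilon> g * null_corrupt \<epsilon> g) \<partial>gauss) = ennreal (overlap \<epsilon> t l 0)"
proof -
  have "(\<integral>\<^sup>+g. ennreal (null_corrupt \<epsilon> g * null_corrupt \<epsilon> g) \<partial>gauss) =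
      (\<integral>\<^sup>+g. \<integral>\<^sup>+x. \<integral>\<^sup>+y. ennreal (corrupt \<epsilon> t l x g * corrupt \<epsilon> t l y g) \<partial>gauss \<partial>gauss \<partial>gauss)"
    using corrupt_nonneg[OF e t] null_corrupt_nonneg[OF e]
    by (simp add: ennreal_mult nn_integral_cmult nn_integral_multc nn_integral_corrupt[OF e t])
  also have "\<dots> = (\<integral>\<^sup>+x. \<integral>\<^sup>+g. \<integral>\<^sup>+y. ennreal (corrupt \<epsilon> t l x g * corrupt \<epsilon> t l y g) \<partial>gauss \<partial>gauss \<partial>gauss)"
    by (rule gauss2.Fubini') simp
  also have "\<dots> = (\<integral>\<^sup>+x. \<integral>\<^sup>+y. \<integral>\<^sup>+g. ennreal (corrupt \<epsilon> t l x g * corrupt \<epsilon> t l y g) \<partial>gauss \<partial>gauss \<partial>gauss)"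
    by (intro nn_integral_cong gauss2.Fubini') simp
  also have "\<dots> = ennreal (overlap \<epsilon> t l 0)"
    using nn_integral_corrupt_corrupt[OF e t, of 0 1 l] by simp
  finally show ?thesis .
qed

text \<open>Integrating over \<open>A\<close> first replaces the likelihood by the null density.
  Together with the previous lemma this makes each difference of likelihood and null orthogonal to
  the null, so centring merely subtracts \<open>overlap \<epsilon> t l 0\<close> from the
  correlations.\<close>

lemma nn_integral_likelihood_null:
  assumes v: "dot d v v = 1"
  shows "(\<integral>\<^sup>+x. ennreal (likelihood d \<epsilon> t l v x * null_likelihood \<epsilon> x) \<partial>gauss_samples d) =
    ennreal (overlap \<epsilon> t l 0)"
proof -
  interpret P: prob_space "PiM ({..<d} \<times> {..<d}) (\<lambda>_. gauss)" by (rule prob_space_PiM_gauss)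
  interpret PP: pair_prob_space "PiM ({..<d} \<times> {..<d}) (\<lambda>_. gauss)" gauss ..
  have "(\<integral>\<^sup>+x. ennreal (likelihood d \<epsilon> t l v x * null_likelihood \<epsilon> x) \<partial>gauss_samples d) =
      (\<integral>\<^sup>+A. \<integral>\<^sup>+g. ennreal (corrupt \<epsilon> t l (frob_inner d A (outer v)) g) * ennreal (null_corrupt \<epsilon> g)
        \<partial>gauss \<partial>PiM ({..<d} \<times> {..<d}) (\<lambda>_. gauss))"
    using corrupt_nonneg[OF e t] null_corrupt_nonneg[OF e]
    by (subst nn_integral_gauss_samples)
      (measurable, simp add: likelihood_def null_likelihood_def ennreal_mult)
  also have "\<dots> = (\<integral>\<^sup>+g. \<integral>\<^sup>+A. ennreal (corrupt \<epsilon> t l (frob_inner d A (outer v)) g) * ennreal (null_corrupt \<epsilon> g)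
        \<partial>PiM ({..<d} \<times> {..<d}) (\<lambda>_. gauss) \<partial>gauss)"
    by (rule PP.Fubini'[symmetric]) measurable
  also have "\<dots> = (\<integral>\<^sup>+g. ennreal (null_corrupt \<epsilon> g * null_corrupt \<epsilon> g) \<partial>gauss)"
    using null_corrupt_nonneg[OF e]
    by (simp add: nn_integral_multc nn_integral_corrupt_feature[OF v] ennreal_mult)
  finally show ?thesis by (simp add: nn_integral_null_null)
qed

lemma nn_integral_null_likelihood_sq:
  "(\<integral>\<^sup>+x. ennreal (null_likelihood \<epsilon> x * null_likelihood \<epsilon> x) \<partial>gauss_samples d) =
    ennreal (overlap \<epsilon> t l 0)"
proof -
  interpret P: prob_space "PiM ({..<d} \<times> {..<d}) (\<lambda>_. gauss)" by (rule prob_space_PiM_gauss)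
  show ?thesis
    by (subst nn_integral_gauss_samples)
      (measurable, simp add: null_likelihood_def nn_integral_null_null P.emeasure_space_1)
qed

lemma nn_integral_likelihood:
  assumes v: "dot d v v = 1"
  shows "(\<integral>\<^sup>+x. ennreal (likelihood d \<epsilon> t l v x) \<partial>gauss_samples d) = 1"
proof -
  interpret P: prob_space "PiM ({..<d} \<times> {..<d}) (\<lambda>_. gauss)" by (rule prob_space_PiM_gauss)
  interpret PP: pair_prob_space "PiM ({..<d} \<times> {..<d}) (\<lambda>_. gauss)" gauss ..
  have "(\<integral>\<^sup>+x. ennreal (likelihood d \<epsilon> t l v x) \<partial>gauss_samples d) =
      (\<integral>\<^sup>+A. \<integral>\<^sup>+g. ennreal (corrupt \<epsilon> t l (frob_inner d A (outer v)) g)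
        \<partial>gauss \<partial>PiM ({..<d} \<times> {..<d}) (\<lambda>_. gauss))"
    by (subst nn_integral_gauss_samples) (measurable, simp add: likelihood_def)
  also have "\<dots> = (\<integral>\<^sup>+g. \<integral>\<^sup>+A. ennreal (corrupt \<epsilon> t l (frob_inner d A (outer v)) g)
        \<partial>PiM ({..<d} \<times> {..<d}) (\<lambda>_. gauss) \<partial>gauss)"
    by (rule PP.Fubini'[symmetric]) measurable
  finally show ?thesis
    by (simp add: nn_integral_corrupt_feature[OF v] nn_integral_null_corrupt[OF e])
qed

end

text \<open>Read off from the Gram data above: the square \<open>k\<^sup>2\<close> of the
  complementary component is nonnegative.\<close>

lemma dot_sq_le_1:
  assumes v: "dot d v v = 1" and w: "dot d w w = 1"
  shows "(dot d v w)\<^sup>2 \<le> 1"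
proof -
  have "((dot d v w)\<^sup>2)\<^sup>2 \<le> 1"
    using nn_integral_two_features[OF v w] by (metis add_le_same_cancel1 add.commute
        le_add_same_cancel1 zero_le_power2)
  then show ?thesis using power2_le_imp_le[of "(dot d v w)\<^sup>2" 1] by simp
qed

lemma overlap_nonneg:
  assumes "0 \<le> \<epsilon>" "\<epsilon> \<le> 1" "\<bar>t\<bar> < 1" "0 \<le> r" "r \<le> 1"
  shows "overlap \<epsilon> t l r \<ge> 0"
proof -
  have "t\<^sup>2 * r \<le> 1 * 1"
    using assms by (intro mult_mono) (simp_all add: abs_square_le_1)
  then show ?thesis
    using assms unfolding overlap_def
    by (intro add_nonneg_nonneg mult_nonneg_nonneg divide_nonneg_nonneg) simp_all
qed

lemma (in prob_space) square_integral_le: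
  fixes X :: "'a \<Rightarrow> real"
  assumes [measurable]: "X \<in> borel_measurable M" and X2: "integrable M (\<lambda>x. (X x)\<^sup>2)"
  shows "(expectation X)\<^sup>2 \<le> expectation (\<lambda>x. (X x)\<^sup>2)"
proof -
  have "integrable M X" using square_integrable_imp_integrable[OF _ X2] by simp
  then show ?thesis using variance_eq[OF _ X2] variance_positive[of X] by simp
qed

text \<open>The sum of the advantages is the mean of \<open>q * S\<close>, where \<open>S\<close> is
  the sum of the centred likelihoods. Its square is at most the mean of \<open>S\<^sup>2\<close>, as
  \<open>q\<close> is bounded by 1, and expanding \<open>S\<^sup>2\<close> gives the pairwise
  correlations. The reference measure is the Gaussian product rather than the null law, so no
  division by the null density occurs.\<close>

lemma query_second_moment:
  fixes V :: "'i \<Rightarrow> nat \<Rightarrow> real"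
  assumes e: "0 \<le> \<epsilon>" "\<epsilon> \<le> 1" and t: "\<bar>t\<bar> < 1"
    and B: "finite B" "\<And>i. i \<in> B \<Longrightarrow> dot d (V i) (V i) = 1"
    and q [measurable]: "q \<in> borel_measurable (gauss_samples d)"
    and q1: "\<And>x. x \<in> space (gauss_samples d) \<Longrightarrow> \<bar>q x\<bar> \<le> 1"
  shows "(\<Sum>i\<in>B. (\<integral>x. q x * likelihood d \<epsilon> t l (V i) x \<partial>gauss_samples d) -
      (\<integral>x. q x * null_likelihood \<epsilon> x \<partial>gauss_samples d))\<^sup>2 \<le>
    (\<Sum>i\<in>B. \<Sum>j\<in>B. overlap \<epsilon> t l ((dot d (V i) (V j))\<^sup>2) - overlap \<epsilon> t l 0)"
proof -
  interpret prob_space "gauss_samples d" by (rule prob_space_gauss_samples)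
  note lk = likelihood_nonneg[OF e t]
  let ?L = "\<lambda>i. likelihood d \<epsilon> t l (V i)" and ?N = "null_likelihood \<epsilon>"
  have LL: "has_bochner_integral (gauss_samples d) (\<lambda>x. ?L i x * ?L j x)
      (overlap \<epsilon> t l ((dot d (V i) (V j))\<^sup>2))" if "i \<in> B" "j \<in> B" for i j
    by (rule has_bochner_integral_nn_integral)
      (use that B lk in \<open>simp_all add: nn_integral_likelihood_likelihood[OF e t] dot_sq_le_1
        overlap_nonneg[OF e t]\<close>)
  have LN: "has_bochner_integral (gauss_samples d) (\<lambda>x. ?L i x * ?N x) (overlap \<epsilon> t l 0)"
    if "i \<in> B" for i
    by (rule has_bochner_integral_nn_integral)
      (use that B lk in \<open>simp_all add: nn_integral_likelihood_null[OF e t] overlap_nonneg[OF e t]\<close>)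
  have NN: "has_bochner_integral (gauss_samples d) (\<lambda>x. ?N x * ?N x) (overlap \<epsilon> t l 0)"
    by (rule has_bochner_integral_nn_integral)
      (use lk nn_integral_null_likelihood_sq[OF e t] in \<open>simp_all add: overlap_nonneg[OF e t]\<close>)
  let ?D = "\<lambda>i x. ?L i x - ?N x"
  have DD: "has_bochner_integral (gauss_samples d) (\<lambda>x. ?D i x * ?D j x)
      (overlap \<epsilon> t l ((dot d (V i) (V j))\<^sup>2) - overlap \<epsilon> t l 0)" if "i \<in> B" "j \<in> B" for i j
  proof -
    have "has_bochner_integral (gauss_samples d)
      (\<lambda>x. ?L i x * ?L j x - ?L i x * ?N x - (?L j x * ?N x - ?N x * ?N x))
      (overlap \<epsilon> t l ((dot d (V i) (V j))\<^sup>2) - overlap \<epsilon> t l 0 - (overlap \<epsilon> t l 0 - overlap \<epsilon> t l 0))"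
      by (intro has_bochner_integral_diff LL LN NN that)
    then show ?thesis by (simp add: algebra_simps)
  qed
  define S where "S = (\<lambda>x. \<Sum>i\<in>B. ?D i x)"
  have [measurable]: "S \<in> borel_measurable (gauss_samples d)"
    unfolding S_def by measurable
  have S2: "has_bochner_integral (gauss_samples d) (\<lambda>x. (S x)\<^sup>2)
      (\<Sum>i\<in>B. \<Sum>j\<in>B. overlap \<epsilon> t l ((dot d (V i) (V j))\<^sup>2) - overlap \<epsilon> t l 0)"
  proof -
    have "(S x)\<^sup>2 = (\<Sum>i\<in>B. \<Sum>j\<in>B. ?D i x * ?D j x)" for x
      by (simp add: S_def power2_eq_square sum_product)
    then show ?thesis
      by (simp only:) (intro has_bochner_integral_sum DD)
  qed
  have L1: "integrable (gauss_samples d) (?L i)" if "i \<in> B" for i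
    using LL[OF that that] by - (rule square_integrable_imp_integrable,
      simp_all add: has_bochner_integral_iff power2_eq_square)
  have N1: "integrable (gauss_samples d) ?N"
    using NN by - (rule square_integrable_imp_integrable,
      simp_all add: has_bochner_integral_iff power2_eq_square)
  have qi: "integrable (gauss_samples d) (\<lambda>x. q x * f x)" if "integrable (gauss_samples d) f" for f
  proof (rule Bochner_Integration.integrable_bound[OF that])
    show "AE x in gauss_samples d. norm (q x * f x) \<le> norm (f x)"
      using q1 by (intro AE_I2) (simp add: abs_mult mult_left_le_one_le)
  qed (use that in measurable)
  have eq: "(\<Sum>i\<in>B. (\<integral>x. q x * ?L i x \<partial>gauss_samples d) - (\<integral>x. q x * ?N x \<partial>gauss_samples d)) =
      (\<integral>x. q x * S x \<partial>gauss_samples d)"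
  proof -
    have "(\<integral>x. q x * S x \<partial>gauss_samples d) = (\<integral>x. (\<Sum>i\<in>B. q x * ?L i x - q x * ?N x) \<partial>gauss_samples d)"
      by (simp add: S_def sum_distrib_left right_diff_distrib)
    also have "\<dots> = (\<Sum>i\<in>B. \<integral>x. q x * ?L i x - q x * ?N x \<partial>gauss_samples d)"
      by (rule Bochner_Integration.integral_sum) (intro Bochner_Integration.integrable_diff qi L1 N1)
    also have "\<dots> = (\<Sum>i\<in>B. (\<integral>x. q x * ?L i x \<partial>gauss_samples d) - (\<integral>x. q x * ?N x \<partial>gauss_samples d))"
      by (intro sum.cong refl Bochner_Integration.integral_diff qi L1 N1)
    finally show ?thesis by simp
  qed
  have le: "(q x * S x)\<^sup>2 \<le> (S x)\<^sup>2" if "x \<in> space (gauss_samples d)" for x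
    using q1[OF that] by (simp add: power_mult_distrib mult_left_le_one_le abs_square_le_1)
  have i2: "integrable (gauss_samples d) (\<lambda>x. (q x * S x)\<^sup>2)"
    by (rule Bochner_Integration.integrable_bound[OF integrable.intros[OF S2]])
      (measurable, use le in simp)
  have "(\<integral>x. q x * S x \<partial>gauss_samples d)\<^sup>2 \<le> (\<integral>x. (q x * S x)\<^sup>2 \<partial>gauss_samples d)"
    by (rule square_integral_le) (measurable, rule i2)
  also have "\<dots> \<le> (\<integral>x. (S x)\<^sup>2 \<partial>gauss_samples d)"
    using i2 S2 le by (intro integral_mono) (simp_all add: has_bochner_integral_iff)
  also have "\<dots> = (\<Sum>i\<in>B. \<Sum>j\<in>B. overlap \<epsilon> t l ((dot d (V i) (V j))\<^sup>2) - overlap \<epsilon> t l 0)"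
    using S2 by (simp add: has_bochner_integral_iff)
  finally show ?thesis unfolding eq .
qed

section \<open>The corrupted law\<close>

text \<open>Undoes the normalisation of the response; \<open>s\<close> will be the standard
  deviation \<open>sqrt (\<rho> ^ 4 + \<sigma>\<^sup>2)\<close> of \<open>y\<close>.\<close>

definition rescale :: "real \<Rightarrow> sample \<Rightarrow> sample" where
  "rescale s = (\<lambda>(A, g). (A, s * g))"

lemma measurable_rescale [measurable]: "rescale s \<in> gauss_samples d \<rightarrow>\<^sub>M sample_space d"
  unfolding rescale_def gauss_samples_def sample_space_def by measurable

definition corrupt_law :: "nat \<Rightarrow> real \<Rightarrow> real \<Rightarrow> real \<Rightarrow> real \<Rightarrow> (nat \<Rightarrow> real) \<Rightarrow> sample measure" where
  "corrupt_law d s \<epsilon> t l v =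
    distr (density (gauss_samples d) (likelihood d \<epsilon> t l v)) (sample_space d) (rescale s)"

lemma sets_corrupt_law [simp]: "sets (corrupt_law d s \<epsilon> t l v) = sets (sample_space d)"
  and space_corrupt_law [simp]: "space (corrupt_law d s \<epsilon> t l v) = space (sample_space d)"
  by (simp_all add: corrupt_law_def)

lemma emeasure_corrupt_law:
  assumes [measurable]: "X \<in> sets (sample_space d)"
  shows "emeasure (corrupt_law d s \<epsilon> t l v) X =
    (\<integral>\<^sup>+x. ennreal (likelihood d \<epsilon> t l v x) * indicator X (rescale s x) \<partial>gauss_samples d)"
proof -
  have "emeasure (corrupt_law d s \<epsilon> t l v) X = (\<integral>\<^sup>+x. indicator X x \<partial>corrupt_law d s \<epsilon> t l v)"
    by simp
  also have "\<dots> = (\<integral>\<^sup>+x. ennreal (likelihood d \<epsilon> t l v x) * indicator X (rescale s x) \<partial>gauss_samples d)"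
    unfolding corrupt_law_def by (subst nn_integral_distr) (simp_all add: nn_integral_density)
  finally show ?thesis .
qed

lemma prob_space_corrupt_law:
  assumes "0 \<le> \<epsilon>" "\<epsilon> \<le> 1" "\<bar>t\<bar> < 1" "dot d v v = 1"
  shows "prob_space (corrupt_law d s \<epsilon> t l v)"
proof
  have "(\<integral>\<^sup>+x. ennreal (likelihood d \<epsilon> t l v x) * indicator (space (sample_space d)) (rescale s x)
      \<partial>gauss_samples d) = (\<integral>\<^sup>+x. ennreal (likelihood d \<epsilon> t l v x) \<partial>gauss_samples d)"
    by (intro nn_integral_cong) (use measurable_space[OF measurable_rescale] in simp)
  then show "emeasure (corrupt_law d s \<epsilon> t l v) (space (corrupt_law d s \<epsilon> t l v)) = 1"
    using nn_integral_likelihood[OF assms] by (simp add: emeasure_corrupt_law)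
qed

lemma integral_corrupt_law:
  assumes e: "0 \<le> \<epsilon>" "\<epsilon> \<le> 1" and t: "\<bar>t\<bar> < 1"
    and [measurable]: "q \<in> borel_measurable (sample_space d)"
  shows "(\<integral>x. q x \<partial>corrupt_law d s \<epsilon> t l v) =
    (\<integral>x. q (rescale s x) * likelihood d \<epsilon> t l v x \<partial>gauss_samples d)"
  unfolding corrupt_law_def
  by (subst integral_distr, measurable, subst integral_density)
    (simp_all add: likelihood_nonneg[OF e t] mult.commute)

text \<open>Given \<open>A\<close>, the response is Gaussian with mean
  \<open>\<rho>\<^sup>2 * a\<close> and variance \<open>\<sigma>\<^sup>2\<close>. After division by
  \<open>s\<close> the mean is \<open>t * a\<close> and the variance \<open>1 - t\<^sup>2\<close>,
  so its density relative to the standard Gaussian law is the Mehler kernel, which is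
  \<open>corrupt\<close> at contamination level 0.\<close>

lemma clean_law_eq_corrupt_law:
  assumes \<rho>: "\<rho> > 0" and \<sigma>: "\<sigma> > 0"
    and s: "s = sqrt (\<rho> ^ 4 + \<sigma>\<^sup>2)" and t: "t = \<rho>\<^sup>2 / s"
  shows "clean_law d \<sigma> (\<lambda>i. \<rho> * v i) = corrupt_law d s 0 t l v"
proof (rule measure_eqI)
  show "sets (clean_law d \<sigma> (\<lambda>i. \<rho> * v i)) = sets (corrupt_law d s 0 t l v)"
    by (simp add: clean_law_def)
  define P where "P = PiM ({..<d} \<times> {..<d}) (\<lambda>_. gauss)"
  have [measurable_cong]: "sets P = sets (PiM ({..<d} \<times> {..<d}) (\<lambda>_. borel))"
    unfolding P_def by (rule sets_PiM_gauss)
  define Z where "Z = density lborel (normal_density 0 \<sigma>)"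
  have [measurable_cong, simp]: "sets Z = sets borel" by (simp add: Z_def)
  interpret Z: prob_space Z
    unfolding Z_def using \<sigma> by (rule prob_space_normal_density)
  have s0: "s > 0" using \<rho> \<sigma> by (simp add: s add_pos_pos)
  have s2: "s\<^sup>2 = (\<rho>\<^sup>2)\<^sup>2 + \<sigma>\<^sup>2" by (simp add: s)
  have t2: "sqrt (1 - t\<^sup>2) = \<sigma> / s"
  proof -
    have "1 - t\<^sup>2 = (\<sigma> / s)\<^sup>2"
    proof -
      have "1 - t\<^sup>2 = (s\<^sup>2 - (\<rho>\<^sup>2)\<^sup>2) / s\<^sup>2"
        using s0 by (simp add: t power_divide diff_divide_distrib)
      also have "s\<^sup>2 - (\<rho>\<^sup>2)\<^sup>2 = \<sigma>\<^sup>2" by (simp add: s2)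
      finally show ?thesis by (simp add: power_divide)
    qed
    then show ?thesis using s0 \<sigma> by (simp add: real_sqrt_unique)
  qed
  have t1: "\<bar>t\<bar> < 1"
  proof -
    have "(\<rho>\<^sup>2)\<^sup>2 < s\<^sup>2" using \<sigma> by (simp add: s2)
    then have "t\<^sup>2 < 1" using s0 by (simp add: t power_divide)
    then show ?thesis by (simp add: abs_square_less_1)
  qed
  fix X assume "X \<in> sets (clean_law d \<sigma> (\<lambda>i. \<rho> * v i))"
  then have X [measurable]: "X \<in> sets (sample_space d)" by (simp add: clean_law_def)
  then have X' [measurable]: "X \<in> sets (PiM ({..<d} \<times> {..<d}) (\<lambda>_. borel) \<Otimes>\<^sub>M borel)"
    by (simp add: sample_space_def)
  have fr: "frob_inner d A (outer (\<lambda>i. \<rho> * v i)) = \<rho>\<^sup>2 * frob_inner d A (outer v)" for A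
    by (simp add: frob_inner_def outer_def sum_distrib_left split_def power2_eq_square ac_simps)
  \<comment> \<open>The noise is \<open>s * g - \<rho>\<^sup>2 * a\<close>; the factor
    \<open>s\<close> is the Jacobian of passing from noise to normalised response.\<close>
  have dens: "s * normal_density 0 \<sigma> (- (\<rho>\<^sup>2 * a) + s * g) = std_normal_density g * mehler t a g" for a g
  proof -
    have "(g - t * a)\<^sup>2 = (- (\<rho>\<^sup>2 * a) + s * g)\<^sup>2 / s\<^sup>2"
    proof -
      have "g - t * a = (- (\<rho>\<^sup>2 * a) + s * g) / s"
        using s0 by (simp add: t field_simps)
      then show ?thesis by (simp only: power_divide)
    qed
    then show ?thesis
      using s0 \<sigma> unfolding mehler_eq_normal_density[OF t1] t2
      by (simp add: normal_density_def power_divide real_sqrt_mult real_sqrt_divide)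
  qed
  have inner: "(\<integral>\<^sup>+z. indicator X (A, frob_inner d A (outer (\<lambda>i. \<rho> * v i)) + z) \<partial>Z) =
      (\<integral>\<^sup>+g. ennreal (mehler t (frob_inner d A (outer v)) g) * indicator X (A, s * g) \<partial>gauss)"
    if A: "A \<in> space P" for A
  proof -
    have [measurable]: "(\<lambda>z. (A, z)) \<in> borel \<rightarrow>\<^sub>M sample_space d"
      using A unfolding sample_space_def P_def by (simp add: space_PiM)
    have [measurable]: "(\<lambda>z. indicator X (A, z) :: ennreal) \<in> borel_measurable borel"
      by measurable
    define a where "a = frob_inner d A (outer v)"
    have "(\<integral>\<^sup>+z. indicator X (A, \<rho>\<^sup>2 * a + z) \<partial>Z) =
        (\<integral>\<^sup>+z. ennreal (normal_density 0 \<sigma> z) * indicator X (A, \<rho>\<^sup>2 * a + z) \<partial>lborel)"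
      unfolding Z_def by (subst nn_integral_density) simp_all
    also have "\<dots> = ennreal \<bar>s\<bar> * (\<integral>\<^sup>+g. ennreal (normal_density 0 \<sigma> (- (\<rho>\<^sup>2 * a) + s * g)) *
        indicator X (A, \<rho>\<^sup>2 * a + (- (\<rho>\<^sup>2 * a) + s * g)) \<partial>lborel)"
      using s0 by (subst nn_integral_real_affine[where c = s and t = "- (\<rho>\<^sup>2 * a)"]) simp_all
    also have "\<dots> = (\<integral>\<^sup>+g. ennreal (s * normal_density 0 \<sigma> (- (\<rho>\<^sup>2 * a) + s * g)) *
        indicator X (A, s * g) \<partial>lborel)"
      using s0 by (subst nn_integral_cmult[symmetric]) (simp_all add: ennreal_mult mult.assoc)
    also have "\<dots> = (\<integral>\<^sup>+g. ennreal (mehler t a g) * indicator X (A, s * g) \<partial>gauss)"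
      unfolding dens using t1
      by (subst nn_integral_gauss) (simp_all add: ennreal_mult mehler_nonneg mult.assoc)
    finally show ?thesis by (simp add: fr a_def)
  qed
  have "emeasure (clean_law d \<sigma> (\<lambda>i. \<rho> * v i)) X = (\<integral>\<^sup>+x. indicator X x \<partial>clean_law d \<sigma> (\<lambda>i. \<rho> * v i))"
    using X by (subst nn_integral_indicator) (simp_all add: clean_law_def)
  also have "\<dots> = (\<integral>\<^sup>+x. indicator X (case x of (A, z) \<Rightarrow>
      (A, frob_inner d A (outer (\<lambda>i. \<rho> * v i)) + z)) \<partial>(P \<Otimes>\<^sub>M Z))"
    unfolding clean_law_def P_def Z_def gauss_def
    by (subst nn_integral_distr) (simp_all add: sample_space_def split_def)
  also have "\<dots> = (\<integral>\<^sup>+A. \<integral>\<^sup>+z. indicator X (A, frob_inner d A (outer (\<lambda>i. \<rho> * v i)) + z) \<partial>Z \<partial>P)"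
    by (subst Z.nn_integral_fst[symmetric]) simp_all
  also have "\<dots> = (\<integral>\<^sup>+A. \<integral>\<^sup>+g. ennreal (mehler t (frob_inner d A (outer v)) g) *
      indicator X (A, s * g) \<partial>gauss \<partial>P)"
    by (intro nn_integral_cong inner)
  also have "\<dots> = emeasure (corrupt_law d s 0 t l v) X"
    unfolding P_def emeasure_corrupt_law[OF X]
    by (subst nn_integral_gauss_samples) (measurable, simp add: likelihood_def rescale_def corrupt_def)
  finally show "emeasure (clean_law d \<sigma> (\<lambda>i. \<rho> * v i)) X = emeasure (corrupt_law d s 0 t l v) X" .
qed

text \<open>The density \<open>corrupt\<close> is affine in its first parameter, so the values 0 and
  1 give the clean law and the contaminating law.\<close>

lemma huber_eq_corrupt_law:
  assumes e: "0 \<le> \<epsilon>" "\<epsilon> \<le> 1" and t: "\<bar>t\<bar> < 1"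
  shows "huber \<epsilon> (corrupt_law d s 0 t l v) (corrupt_law d s 1 t l v) = corrupt_law d s \<epsilon> t l v"
proof (rule measure_eqI)
  show sets: "sets (huber \<epsilon> (corrupt_law d s 0 t l v) (corrupt_law d s 1 t l v)) =
      sets (corrupt_law d s \<epsilon> t l v)"
    by (simp add: huber_def)
  fix X assume "X \<in> sets (huber \<epsilon> (corrupt_law d s 0 t l v) (corrupt_law d s 1 t l v))"
  then have X [measurable]: "X \<in> sets (sample_space d)" unfolding sets by simp
  have mix: "ennreal (likelihood d \<epsilon> t l v x) =
      ennreal (1 - \<epsilon>) * ennreal (likelihood d 0 t l v x) + ennreal \<epsilon> * ennreal (likelihood d 1 t l v x)"
    for x
    using e t mehler_nonneg[OF t]
    by (simp add: likelihood_def corrupt_def split_beta contam_nonneg ennreal_mult''[symmetric])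
  show "emeasure (huber \<epsilon> (corrupt_law d s 0 t l v) (corrupt_law d s 1 t l v)) X =
      emeasure (corrupt_law d s \<epsilon> t l v) X"
    by (simp add: emeasure_huber emeasure_corrupt_law mix distrib_right nn_integral_add
        nn_integral_cmult mult.assoc)
qed

section \<open>The hard family\<close>

definition signs :: "nat \<Rightarrow> (nat \<Rightarrow> real) set" where
  "signs n = PiE {..<n} (\<lambda>_. {- 1, 1})"

definition grid :: "nat \<Rightarrow> (nat \<Rightarrow> nat) set" where
  "grid L = PiE {..<4} (\<lambda>_. {..<L})"

text \<open>On the grid the angles lie in \<open>[0, 1)\<close>, where the sine of a difference is
  comparable to the difference itself.\<close>

definition angle :: "nat \<Rightarrow> (nat \<Rightarrow> nat) \<Rightarrow> nat \<Rightarrow> real" where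
  "angle L x i = (if i < 4 then real (x i) / real L else 0)"

text \<open>The first four coordinates of a sign vector are split by rotations into pairs of
  coordinates. The rotations make the family arbitrarily large in a fixed dimension, so that
  its diagonal pairs do not matter even when the noise is tiny and their correlation
  is close to \<open>1\<close>. Four angles are enough for the reciprocal of one minus the squared inner
  product to have bounded mean.\<close>

definition fam :: "nat \<Rightarrow> nat \<Rightarrow> (nat \<Rightarrow> real) \<times> (nat \<Rightarrow> nat) \<Rightarrow> nat \<Rightarrow> real" where
  "fam n L = (\<lambda>(s, x) i. (if i < n then s i * cos (angle L x i)
     else s (i - n) * sin (angle L x (i - n))) / sqrt (real n))"

lemma finite_signs [simp]: "finite (signs n)"
  by (simp add: signs_def finite_PiE)

lemma finite_grid [simp]: "finite (grid L)"
  by (simp add: grid_def finite_PiE)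

lemma card_signs: "card (signs n) = 2 ^ n"
  by (simp add: signs_def card_PiE numeral_2_eq_2)

lemma card_grid: "card (grid L) = L ^ 4"
  by (simp add: grid_def card_PiE)

lemma abs_signs: "s \<in> signs n \<Longrightarrow> i < n \<Longrightarrow> \<bar>s i\<bar> = 1"
  by (auto simp: signs_def dest!: PiE_mem[where x = i])

section \<open>Concentration of sign sums\<close>

lemma exp_add_exp_minus_le:
  fixes x :: real
  assumes "\<bar>x\<bar> \<le> 1"
  shows "exp (- x) + exp x \<le> 2 * exp (x\<^sup>2)"
proof -
  have pos: "exp (- y) + exp y \<le> 2 * exp (y\<^sup>2)" if y: "0 \<le> y" "y \<le> 1" for y :: real
  proof -
    \<comment> \<open>With \<open>exp 1 \<le> 3\<close> the quadratic terms of the two Taylor bounds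
      are \<open>3 / 2\<close> and \<open>1 / 2\<close>, and they add up to the required
      \<open>2 * y\<^sup>2\<close>.\<close>
    have "y\<^sup>2 / 2 * exp 1 \<le> y\<^sup>2 / 2 * 3"
      by (rule mult_left_mono[OF exp_le]) simp
    then have "exp y \<le> 1 + y + y\<^sup>2 / 2 * 3"
      using exp_le_quadratic[OF y] by linarith
    then have "exp (- y) + exp y \<le> 2 * (1 + y\<^sup>2)"
      using exp_minus_le_quadratic[OF y(1)] by (simp add: field_simps)
    also have "1 + y\<^sup>2 \<le> exp (y\<^sup>2)" by (rule exp_ge_add_one_self)
    finally show ?thesis by simp
  qed
  show ?thesis
    using pos[of x] pos[of "- x"] assms by (cases "x \<ge> 0") simp_all
qed

lemma sum_signs_exp:
  "(\<Sum>s\<in>signs n. exp (\<Sum>i<n. s i * a i)) = (\<Prod>i<n. exp (- a i) + exp (a i))"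
proof -
  have "(\<Prod>i<n. exp (- a i) + exp (a i)) = (\<Prod>i<n. \<Sum>y\<in>{- 1, 1}. exp (y * a i))"
    by simp
  also have "\<dots> = (\<Sum>s\<in>signs n. \<Prod>i<n. exp (s i * a i))"
    unfolding signs_def by (rule prod_sum_PiE) simp_all
  finally show ?thesis by (simp add: exp_sum)
qed

text \<open>Markov's inequality for the exponential moment, which factorises over the coordinates.
  The range of \<open>l * a i\<close> is the one in which the elementary bound on the hyperbolic
  cosine holds.\<close>

lemma chernoff_signs:
  fixes a :: "nat \<Rightarrow> real"
  assumes l: "l \<ge> 0" and a: "\<And>i. i < n \<Longrightarrow> \<bar>l * a i\<bar> \<le> 1"
  shows "real (card {s \<in> signs n. \<tau> \<le> (\<Sum>i<n. s i * a i)}) \<le>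
    2 ^ n * exp (l\<^sup>2 * (\<Sum>i<n. (a i)\<^sup>2) - l * \<tau>)"
proof -
  let ?C = "{s \<in> signs n. \<tau> \<le> (\<Sum>i<n. s i * a i)}"
  have "real (card ?C) * exp (l * \<tau>) = (\<Sum>s\<in>?C. exp (l * \<tau>))" by simp
  also have "\<dots> \<le> (\<Sum>s\<in>?C. exp (\<Sum>i<n. s i * (l * a i)))"
  proof (rule sum_mono)
    fix s assume "s \<in> ?C"
    then have "l * \<tau> \<le> l * (\<Sum>i<n. s i * a i)" using l by (intro mult_left_mono) simp_all
    then show "exp (l * \<tau>) \<le> exp (\<Sum>i<n. s i * (l * a i))"
      by (simp add: sum_distrib_left ac_simps)
  qed
  also have "\<dots> \<le> (\<Sum>s\<in>signs n. exp (\<Sum>i<n. s i * (l * a i)))"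
    by (rule sum_mono2) auto
  also have "\<dots> = (\<Prod>i<n. exp (- (l * a i)) + exp (l * a i))" by (rule sum_signs_exp)
  also have "\<dots> \<le> (\<Prod>i<n. 2 * exp ((l * a i)\<^sup>2))"
    using a by (intro prod_mono conjI exp_add_exp_minus_le) (simp_all add: add_nonneg_nonneg)
  also have "\<dots> = 2 ^ n * exp (l\<^sup>2 * (\<Sum>i<n. (a i)\<^sup>2))"
    by (simp add: prod.distrib exp_sum[symmetric] power_mult_distrib sum_distrib_left)
  finally show ?thesis by (simp add: exp_diff pos_le_divide_eq)
qed

lemma chernoff_signs_abs:
  fixes a :: "nat \<Rightarrow> real"
  assumes l: "l \<ge> 0" and a: "\<And>i. i < n \<Longrightarrow> \<bar>l * a i\<bar> \<le> 1"
  shows "real (card {s \<in> signs n. \<tau> \<le> \<bar>\<Sum>i<n. s i * a i\<bar>}) \<le>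
    2 * (2 ^ n * exp (l\<^sup>2 * (\<Sum>i<n. (a i)\<^sup>2) - l * \<tau>))"
proof -
  have "card {s \<in> signs n. \<tau> \<le> \<bar>\<Sum>i<n. s i * a i\<bar>} \<le>
      card ({s \<in> signs n. \<tau> \<le> (\<Sum>i<n. s i * a i)} \<union> {s \<in> signs n. \<tau> \<le> (\<Sum>i<n. s i * - a i)})"
    by (intro card_mono) (auto simp: sum_negf abs_real_def)
  also have "\<dots> \<le> card {s \<in> signs n. \<tau> \<le> (\<Sum>i<n. s i * a i)} +
      card {s \<in> signs n. \<tau> \<le> (\<Sum>i<n. s i * - a i)}"
    by (rule card_Un_le)
  finally show ?thesis
    using chernoff_signs[of l n a \<tau>] chernoff_signs[of l n "\<lambda>i. - a i" \<tau>] l a by simp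
qed

section \<open>Inner products with members of the family\<close>

lemma sum_lessThan_add:
  fixes f :: "nat \<Rightarrow> 'a :: comm_monoid_add"
  shows "(\<Sum>i<n + k. f i) = (\<Sum>i<n. f i) + (\<Sum>i<k. f (n + i))"
  by (induction k) (simp_all add: add.assoc)

lemma sum_restrict_4:
  fixes f :: "nat \<Rightarrow> real"
  assumes "n \<ge> 4" and "\<And>i. i \<ge> 4 \<Longrightarrow> f i = 0"
  shows "(\<Sum>i<n. f i) = (\<Sum>i<4. f i)"
  using assms by (intro sum.mono_neutral_right) auto

lemma angle_ge_4 [simp]: "i \<ge> 4 \<Longrightarrow> angle L x i = 0"
  by (simp add: angle_def)

text \<open>The coefficient of the sign \<open>s i\<close> in the inner product with
  \<open>w\<close>: for fixed angles this inner product is a linear form in the signs, so the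
  Chernoff bound applies. Beyond the first four coordinates the sine vanishes and
  \<open>w (n + i)\<close> has no effect.\<close>

definition fam_coeff :: "nat \<Rightarrow> nat \<Rightarrow> (nat \<Rightarrow> nat) \<Rightarrow> (nat \<Rightarrow> real) \<Rightarrow> nat \<Rightarrow> real" where
  "fam_coeff n L x w i = (w i * cos (angle L x i) + w (n + i) * sin (angle L x i)) / sqrt (real n)"

lemma dot_fam:
  assumes n: "n \<ge> 4"
  shows "dot (n + 4) w (fam n L (s, x)) = (\<Sum>i<n. s i * fam_coeff n L x w i)"
proof -
  have "dot (n + 4) w (fam n L (s, x)) = (\<Sum>i<n. w i * (s i * cos (angle L x i) / sqrt (real n))) +
      (\<Sum>i<4. w (n + i) * (s i * sin (angle L x i) / sqrt (real n)))"
    by (simp add: dot_def sum_lessThan_add fam_def)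
  also have "(\<Sum>i<4. w (n + i) * (s i * sin (angle L x i) / sqrt (real n))) =
      (\<Sum>i<n. w (n + i) * (s i * sin (angle L x i) / sqrt (real n)))"
    using n by (intro sum_restrict_4[symmetric]) simp_all
  finally show ?thesis
    by (simp add: sum.distrib[symmetric] fam_coeff_def add_divide_distrib algebra_simps)
qed

lemma fam_coeff_fam:
  assumes n: "n \<ge> 4" and "i < n"
  shows "fam_coeff n L x (fam n L (s', x')) i = s' i * cos (angle L x i - angle L x' i) / real n"
  using assms by (simp add: fam_coeff_def fam_def cos_diff add_divide_distrib algebra_simps)

text \<open>Up to the factor \<open>1 / sqrt n\<close>, each coefficient projects the pair
  \<open>(w i, w (n + i))\<close> to a unit vector, so its square is at most the squared norm of
  that pair.\<close>

lemma sum_fam_coeff_sq: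
  assumes n: "n \<ge> 4"
  shows "(\<Sum>i<n. (fam_coeff n L x w i)\<^sup>2) \<le> dot (n + 4) w w / real n"
proof -
  have cs: "(a * c + b * s)\<^sup>2 \<le> a\<^sup>2 + b\<^sup>2" if "s\<^sup>2 + c\<^sup>2 = 1" for a b c s :: real
  proof -
    have "(a * c + b * s)\<^sup>2 + (a * s - b * c)\<^sup>2 = (a\<^sup>2 + b\<^sup>2) * (s\<^sup>2 + c\<^sup>2)"
      by (simp add: power2_eq_square algebra_simps)
    then show ?thesis
      using zero_le_power2[of "a * s - b * c"] unfolding that mult_1_right by linarith
  qed
  have "(\<Sum>i<n. (fam_coeff n L x w i)\<^sup>2) \<le>
      (\<Sum>i<n. ((w i)\<^sup>2 + (if i < 4 then (w (n + i))\<^sup>2 else 0)) / real n)"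
  proof (rule sum_mono)
    fix i assume "i \<in> {..<n}"
    have "(w i * cos (angle L x i) + w (n + i) * sin (angle L x i))\<^sup>2 \<le>
        (w i)\<^sup>2 + (if i < 4 then (w (n + i))\<^sup>2 else 0)"
      using cs[OF sin_cos_squared_add, of "w i" "angle L x i" "w (n + i)"] by simp
    then show "(fam_coeff n L x w i)\<^sup>2 \<le> ((w i)\<^sup>2 + (if i < 4 then (w (n + i))\<^sup>2 else 0)) / real n"
      by (simp add: fam_coeff_def power_divide divide_right_mono)
  qed
  also have "\<dots> = ((\<Sum>i<n. (w i)\<^sup>2) + (\<Sum>i<4. (w (n + i))\<^sup>2)) / real n"
    using sum_restrict_4[OF n, of "\<lambda>i. if i < 4 then (w (n + i))\<^sup>2 else 0"]
    by (simp add: sum_divide_distrib[symmetric] sum.distrib)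
  also have "\<dots> = dot (n + 4) w w / real n"
    by (simp add: dot_def sum_lessThan_add power2_eq_square)
  finally show ?thesis .
qed

lemma dot_fam_fam:
  assumes n: "n \<ge> 4"
  shows "dot (n + 4) (fam n L (s', x')) (fam n L (s, x)) =
    (\<Sum>i<n. s i * (s' i * cos (angle L x i - angle L x' i))) / real n"
  unfolding dot_fam[OF n] sum_divide_distrib
  by (intro sum.cong) (simp_all add: fam_coeff_fam[OF n])

lemma dot_fam_self:
  assumes n: "n \<ge> 4" and s: "s \<in> signs n"
  shows "dot (n + 4) (fam n L (s, x)) (fam n L (s, x)) = 1"
proof -
  have "s i * s i = 1" if "i < n" for i
    using abs_signs[OF s that] by (metis abs_mult_self_eq mult.right_neutral)
  then have "(\<Sum>i<n. s i * (s i * cos (angle L x i - angle L x i))) = (\<Sum>i<n. 1)"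
    by (intro sum.cong) simp_all
  then show ?thesis using n unfolding dot_fam_fam[OF n] by simp
qed

lemma card_correlated_signs:
  assumes n: "n \<ge> 4" and s': "s' \<in> signs n" and T: "0 < T" "T \<le> 1"
  shows "real (card {s \<in> signs n. T < (dot (n + 4) (fam n L (s', x')) (fam n L (s, x)))\<^sup>2}) \<le>
    2 * (2 ^ n * exp (- (real n * T / 4)))"
proof -
  define a where "a i = s' i * cos (angle L x i - angle L x' i)" for i
  have a1: "\<bar>a i\<bar> \<le> 1" if "i < n" for i
    using abs_signs[OF s' that] by (simp add: a_def abs_mult)
  \<comment> \<open>The minimiser of \<open>l\<^sup>2 * n - l * n * sqrt T\<close>, with minimum
    \<open>- n * T / 4\<close>.\<close>
  define l where "l = sqrt T / 2"
  have l: "l \<ge> 0" "l \<le> 1" using T real_sqrt_le_1_iff[of T] by (simp_all add: l_def del: real_sqrt_le_1_iff)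
  have sub: "{s \<in> signs n. T < (dot (n + 4) (fam n L (s', x')) (fam n L (s, x)))\<^sup>2} \<subseteq>
      {s \<in> signs n. real n * sqrt T \<le> \<bar>\<Sum>i<n. s i * a i\<bar>}"
  proof (intro subsetI CollectI; elim CollectE conjE; intro conjI)
    fix s assume "T < (dot (n + 4) (fam n L (s', x')) (fam n L (s, x)))\<^sup>2"
    then have "sqrt T < \<bar>dot (n + 4) (fam n L (s', x')) (fam n L (s, x))\<bar>"
      by (metis real_sqrt_abs real_sqrt_less_iff)
    then show "real n * sqrt T \<le> \<bar>\<Sum>i<n. s i * a i\<bar>"
      using n unfolding dot_fam_fam[OF n] a_def by (simp add: pos_less_divide_eq mult.commute)
  qed
  have "real (card {s \<in> signs n. T < (dot (n + 4) (fam n L (s', x')) (fam n L (s, x)))\<^sup>2}) \<le>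
      real (card {s \<in> signs n. real n * sqrt T \<le> \<bar>\<Sum>i<n. s i * a i\<bar>})"
    using card_mono[OF _ sub] by simp
  also have "\<dots> \<le> 2 * (2 ^ n * exp (l\<^sup>2 * (\<Sum>i<n. (a i)\<^sup>2) - l * (real n * sqrt T)))"
    using l a1 by (intro chernoff_signs_abs) (simp_all add: abs_mult mult_le_one)
  also have "\<dots> \<le> 2 * (2 ^ n * exp (- (real n * T / 4)))"
  proof -
    have "(\<Sum>i<n. (a i)\<^sup>2) \<le> (\<Sum>i<n. 1)"
      using a1 by (intro sum_mono) (simp add: abs_square_le_1)
    then have "l\<^sup>2 * (\<Sum>i<n. (a i)\<^sup>2) \<le> T / 4 * real n"
      using T by (simp add: l_def power_divide)
    moreover have lT: "l * (real n * sqrt T) = real n * T / 2"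
      using T by (simp add: l_def)
    ultimately show ?thesis unfolding lT by (simp add: mult.commute)
  qed
  finally show ?thesis .
qed

lemma card_aligned_signs:
  assumes n: "n \<ge> 4" and w: "dot (n + 4) w w = W\<^sup>2" and W: "W > 0"
  shows "real (card {s \<in> signs n. \<kappa> * W \<le> \<bar>dot (n + 4) w (fam n L (s, x))\<bar>}) \<le>
    2 * (2 ^ n * exp (1 - \<kappa> * sqrt (real n)))"
proof -
  define b where "b = fam_coeff n L x w"
  \<comment> \<open>One coefficient can be as large as \<open>W / sqrt n\<close>, so this is the
    largest \<open>l\<close> for which the Chernoff hypothesis is guaranteed. It gives decay only in
    \<open>sqrt n\<close>, which suffices because \<kappa> stays fixed as \<open>d\<close>
    grows.\<close>
  define l where "l = sqrt (real n) / W"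
  have l: "l \<ge> 0" using W by (simp add: l_def)
  have sum: "l\<^sup>2 * (\<Sum>i<n. (b i)\<^sup>2) \<le> 1"
  proof -
    have "l\<^sup>2 * (\<Sum>i<n. (b i)\<^sup>2) \<le> l\<^sup>2 * (W\<^sup>2 / real n)"
      using sum_fam_coeff_sq[OF n, of L x w] w by (intro mult_left_mono) (simp_all add: b_def)
    also have "\<dots> = 1" using n W by (simp add: l_def power_divide)
    finally show ?thesis .
  qed
  have b1: "\<bar>l * b i\<bar> \<le> 1" if "i < n" for i
  proof -
    have "(b i)\<^sup>2 \<le> (\<Sum>i<n. (b i)\<^sup>2)" using that by (intro member_le_sum) simp_all
    then have "(l * b i)\<^sup>2 \<le> l\<^sup>2 * (\<Sum>i<n. (b i)\<^sup>2)" by (simp add: power_mult_distrib mult_left_mono)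
    then show ?thesis using sum by (simp add: abs_square_le_1[symmetric])
  qed
  have "real (card {s \<in> signs n. \<kappa> * W \<le> \<bar>dot (n + 4) w (fam n L (s, x))\<bar>}) \<le>
      2 * (2 ^ n * exp (l\<^sup>2 * (\<Sum>i<n. (b i)\<^sup>2) - l * (\<kappa> * W)))"
    unfolding dot_fam[OF n] b_def[symmetric] by (intro chernoff_signs_abs l b1)
  also have "\<dots> \<le> 2 * (2 ^ n * exp (1 - \<kappa> * sqrt (real n)))"
  proof -
    have lW: "l * (\<kappa> * W) = \<kappa> * sqrt (real n)" using W by (simp add: l_def)
    show ?thesis unfolding lW using sum by simp
  qed
  finally show ?thesis .
qed

section \<open>Averaging over the grid of angles\<close>

lemma half_le_abs_sin:
  fixes x :: real
  assumes "\<bar>x\<bar> \<le> 1"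
  shows "\<bar>x\<bar> / 2 \<le> \<bar>sin x\<bar>"
proof -
  have taylor: "(\<Sum>m<3. sin_coeff m * x ^ m) = x" "inverse (fact 3) = (1 / 6 :: real)"
    by (simp_all add: eval_nat_numeral sin_coeff_def)
  have "\<bar>sin x - x\<bar> \<le> \<bar>x\<bar> ^ 3 / 6"
    using Maclaurin_sin_bound[of x 3] unfolding taylor by simp
  also have "\<bar>x\<bar> ^ 3 \<le> \<bar>x\<bar> ^ 1"
    using assms by (intro power_decreasing) simp_all
  finally show ?thesis by (simp only: power_one_right) arith
qed

lemma sum_inverse_sqrt_le: "(\<Sum>m<L. 1 / sqrt (1 + real m)) \<le> 2 * sqrt (real L)"
proof (induction L)
  case (Suc L)
  define a where "a = sqrt (real L)"
  define b where "b = sqrt (1 + real L)"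
  have ab: "0 \<le> a" "0 < b" "a \<le> b" and "b\<^sup>2 = a\<^sup>2 + 1" by (simp_all add: a_def b_def)
  then have "(b - a) * (b + a) = 1" by (simp add: power2_eq_square algebra_simps)
  moreover have "(b - a) * (b + a) \<le> (b - a) * (2 * b)"
    using ab by (intro mult_left_mono) simp_all
  ultimately have "1 \<le> (b - a) * (2 * b)" by linarith
  then have "1 \<le> 2 * (b - a) * b" by (simp only: ac_simps)
  then have "1 / b \<le> 2 * (b - a)"
    using ab by (simp only: pos_divide_le_eq)
  with Suc.IH show ?case by (simp add: a_def b_def add.commute)
qed simp

text \<open>Every distance from \<open>y'\<close> occurs at most twice, once on each side.\<close>

lemma sum_abs_diff_le:
  fixes f :: "nat \<Rightarrow> real"
  assumes f: "\<And>m. f m \<ge> 0" and y': "y' < L"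
  shows "(\<Sum>y<L. f (nat \<bar>int y - int y'\<bar>)) \<le> 2 * (\<Sum>m<L. f m)"
proof -
  have "(\<Sum>y<L. f (nat \<bar>int y - int y'\<bar>)) =
      (\<Sum>y\<in>{..y'}. f (nat \<bar>int y - int y'\<bar>)) + (\<Sum>y\<in>{y'<..<L}. f (nat \<bar>int y - int y'\<bar>))"
    using y' by (subst sum.union_disjoint[symmetric]) (auto intro: sum.cong)
  also have "(\<Sum>y\<in>{..y'}. f (nat \<bar>int y - int y'\<bar>)) = (\<Sum>m\<in>{..y'}. f m)"
    by (rule sum.reindex_bij_witness[of _ "\<lambda>m. y' - m" "\<lambda>y. y' - y"])
      (auto simp: of_nat_diff nat_diff_distrib' abs_if)
  also have "\<dots> \<le> (\<Sum>m<L. f m)"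
    using f y' by (intro sum_mono2) auto
  also have "(\<Sum>y\<in>{y'<..<L}. f (nat \<bar>int y - int y'\<bar>)) = (\<Sum>m\<in>{0<..<L - y'}. f m)"
    by (rule sum.reindex_bij_witness[of _ "\<lambda>m. y' + m" "\<lambda>y. y - y'"])
      (auto simp: of_nat_diff nat_diff_distrib' abs_if)
  also have "\<dots> \<le> (\<Sum>m<L. f m)"
    using f by (intro sum_mono2) auto
  finally show ?thesis by simp
qed

definition grid_dist :: "(nat \<Rightarrow> nat) \<Rightarrow> (nat \<Rightarrow> nat) \<Rightarrow> nat \<Rightarrow> real" where
  "grid_dist x x' i = real (nat \<bar>int (x i) - int (x' i)\<bar>)"

text \<open>The product form lets the sum over the grid split into four sums of
  \<open>1 / sqrt (1 + m)\<close>, each of order \<open>sqrt L\<close>. Their product has order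
  \<open>L\<^sup>2\<close>, and the prefactor \<open>L\<^sup>2\<close> completes it to
  \<open>L ^ 4\<close>, the size of the grid; the mean is thus bounded independently of
  \<open>L\<close>.\<close>

definition pair_bound :: "nat \<Rightarrow> nat \<Rightarrow> (nat \<Rightarrow> nat) \<Rightarrow> (nat \<Rightarrow> nat) \<Rightarrow> real" where
  "pair_bound n L x x' = 16 * real n * (real L)\<^sup>2 * (\<Prod>i<4. 1 / sqrt (1 + grid_dist x x' i))"

lemma pair_bound_nonneg: "pair_bound n L x x' \<ge> 0"
  by (simp add: pair_bound_def prod_nonneg grid_dist_def)

lemma sum_pair_bound:
  assumes x': "x' \<in> grid L"
  shows "(\<Sum>x\<in>grid L. pair_bound n L x x') \<le> 4096 * real n * real (card (grid L))"
proof -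
  have "(\<Sum>x\<in>grid L. \<Prod>i<4. 1 / sqrt (1 + grid_dist x x' i)) =
      (\<Prod>i<4. \<Sum>y<L. 1 / sqrt (1 + real (nat \<bar>int y - int (x' i)\<bar>)))"
    unfolding grid_dist_def grid_def by (rule prod_sum_PiE[symmetric]) simp_all
  also have "\<dots> \<le> (\<Prod>i<4::nat. 4 * sqrt (real L))"
  proof (intro prod_mono conjI)
    fix i :: nat assume "i \<in> {..<4}"
    then have "x' i < L" using x' by (auto simp: grid_def dest: PiE_mem)
    then have "(\<Sum>y<L. 1 / sqrt (1 + real (nat \<bar>int y - int (x' i)\<bar>))) \<le>
        2 * (\<Sum>m<L. 1 / sqrt (1 + real m))"
      by (intro sum_abs_diff_le) simp_all
    also have "\<dots> \<le> 2 * (2 * sqrt (real L))"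
      by (intro mult_left_mono sum_inverse_sqrt_le) simp
    finally show "(\<Sum>y<L. 1 / sqrt (1 + real (nat \<bar>int y - int (x' i)\<bar>))) \<le> 4 * sqrt (real L)"
      by simp
  qed (simp add: sum_nonneg)
  also have "\<dots> = 256 * (real L)\<^sup>2"
  proof -
    have "sqrt (real L) ^ 4 = (real L)\<^sup>2"
      using power_mult[of "sqrt (real L)" 2 2] by simp
    then show ?thesis by (simp add: power_mult_distrib)
  qed
  finally have "16 * real n * (real L)\<^sup>2 * (\<Sum>x\<in>grid L. \<Prod>i<4. 1 / sqrt (1 + grid_dist x x' i)) \<le>
      16 * real n * (real L)\<^sup>2 * (256 * (real L)\<^sup>2)"
    by (intro mult_left_mono) simp_all
  then show ?thesis
    by (simp add: pair_bound_def sum_distrib_left[symmetric] card_grid power2_eq_square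
        power4_eq_xxxx ac_simps)
qed

text \<open>Both sides are compared with the square of the largest entry. This trades a sum, which
  arises from the geometry, for a product, which can be averaged one angle at a time.\<close>

lemma prod_sqrt_le_sum_sq:
  fixes b :: "nat \<Rightarrow> real"
  assumes b: "\<And>i. i < 4 \<Longrightarrow> b i \<ge> 0"
  shows "(\<Prod>i<4. sqrt (b i)) \<le> (\<Sum>i<4. (b i)\<^sup>2)"
proof -
  define m where "m = Max (b ` {..<4})"
  have le: "b i \<le> m" if "i < 4" for i using that unfolding m_def by (intro Max_ge) simp_all
  have "m \<in> b ` {..<4}" unfolding m_def by (intro Max_in) (auto simp: lessThan_empty_iff)
  then obtain j where j: "j < 4" "m = b j" by auto
  have m0: "m \<ge> 0" using b j by simp
  have "(\<Prod>i<4. sqrt (b i)) \<le> (\<Prod>i<4::nat. sqrt m)"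
    using b le by (intro prod_mono) simp_all
  also have "\<dots> = m\<^sup>2"
    using power_mult[of "sqrt m" 2 2] m0 by simp
  also have "\<dots> \<le> (\<Sum>i<4. (b i)\<^sup>2)"
    unfolding j(2) using j(1) by (intro member_le_sum) simp_all
  finally show ?thesis .
qed

text \<open>By Cauchy-Schwarz against the constant sequence, whatever the signs are. The rotations
  alone thus separate members whose sign vectors agree or are opposite.\<close>

lemma dot_fam_gap:
  assumes n: "n \<ge> 4" and s: "s \<in> signs n" and s': "s' \<in> signs n"
  shows "(dot (n + 4) (fam n L (s', x')) (fam n L (s, x)))\<^sup>2 \<le>
    1 - (\<Sum>i<4. (sin (angle L x i - angle L x' i))\<^sup>2) / real n"
proof -
  let ?D = "\<lambda>i. angle L x i - angle L x' i"
  have "(\<Sum>i<n. s i * (s' i * cos (?D i)))\<^sup>2 \<le> (\<Sum>i<n. 1\<^sup>2) * (\<Sum>i<n. (s i * (s' i * cos (?D i)))\<^sup>2)"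
    using Cauchy_Schwarz_ineq_sum[of "\<lambda>_. 1" "\<lambda>i. s i * (s' i * cos (?D i))" "{..<n}"] by simp
  also have "(\<Sum>i<n. (s i * (s' i * cos (?D i)))\<^sup>2) = (\<Sum>i<n. 1 - (sin (?D i))\<^sup>2)"
  proof (intro sum.cong refl)
    fix i assume "i \<in> {..<n}"
    then have "(s i)\<^sup>2 = 1" "(s' i)\<^sup>2 = 1"
      using abs_signs[OF s, of i] abs_signs[OF s', of i] by (metis lessThan_iff one_power2 power2_abs)+
    then show "(s i * (s' i * cos (?D i)))\<^sup>2 = 1 - (sin (?D i))\<^sup>2"
      by (simp add: power_mult_distrib cos_squared_eq)
  qed
  also have "\<dots> = real n - (\<Sum>i<n. (sin (?D i))\<^sup>2)" by (simp add: sum_subtractf)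
  also have "(\<Sum>i<n. (sin (?D i))\<^sup>2) = (\<Sum>i<4. (sin (?D i))\<^sup>2)"
    using n by (intro sum_restrict_4) simp_all
  finally have "(\<Sum>i<n. s i * (s' i * cos (?D i)))\<^sup>2 \<le> real n * (real n - (\<Sum>i<4. (sin (?D i))\<^sup>2))"
    by simp
  then have "(dot (n + 4) (fam n L (s', x')) (fam n L (s, x)))\<^sup>2 \<le>
      real n * (real n - (\<Sum>i<4. (sin (?D i))\<^sup>2)) / (real n)\<^sup>2"
    unfolding dot_fam_fam[OF n] power_divide by (intro divide_right_mono) simp_all
  also have "\<dots> = 1 - (\<Sum>i<4. (sin (?D i))\<^sup>2) / real n"
    using n by (simp add: power2_eq_square diff_divide_distrib)
  finally show ?thesis .
qed

lemma pair_bound: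
  assumes n: "n \<ge> 4" and L: "L > 0" and s: "s \<in> signs n" and s': "s' \<in> signs n"
    and x: "x \<in> grid L" and x': "x' \<in> grid L"
    and t: "0 \<le> t" and tL: "1 / (real L)\<^sup>2 \<le> 1 - t\<^sup>2"
  shows "1 / (1 - t\<^sup>2 * (dot (n + 4) (fam n L (s', x')) (fam n L (s, x)))\<^sup>2) \<le> pair_bound n L x x'"
proof -
  let ?D = "\<lambda>i. angle L x i - angle L x' i"
  let ?X2 = "(dot (n + 4) (fam n L (s', x')) (fam n L (s, x)))\<^sup>2"
  define z where "z = (\<Sum>i<4. (sin (?D i))\<^sup>2) / real n"
  have L2: "(real L)\<^sup>2 > 0" using L by simp
  have z0: "z \<ge> 0" by (simp add: z_def sum_nonneg)
  have Xz: "?X2 \<le> 1 - z" unfolding z_def by (rule dot_fam_gap[OF n s s'])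
  have z1: "z \<le> 1" using Xz zero_le_power2[of "dot (n + 4) (fam n L (s', x')) (fam n L (s, x))"] by linarith
  have eta: "0 < 1 - t\<^sup>2" using tL L2 by (meson divide_pos_pos less_le_trans zero_less_one)
  have "t\<^sup>2 * ?X2 \<le> t\<^sup>2 * (1 - z)" by (intro mult_left_mono Xz) simp
  moreover have "t\<^sup>2 * (1 - z) \<le> 1 * (1 - z)" using eta z1 by (intro mult_right_mono) simp_all
  moreover have "t\<^sup>2 * (1 - z) \<le> t\<^sup>2 * 1" using z0 by (intro mult_left_mono) simp_all
  \<comment> \<open>\<open>1 - t\<^sup>2 * ?X2\<close> is at least \<open>z\<close> and at least
    \<open>1 - t\<^sup>2\<close>, hence at least their mean. The first bound serves distinct angles,
    the second coinciding ones.\<close>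
  ultimately have low: "((1 - t\<^sup>2) + z) / 2 \<le> 1 - t\<^sup>2 * ?X2" by simp
  have tm: "(1 + grid_dist x x' i)\<^sup>2 / (8 * (real L)\<^sup>2) \<le> 1 / (real L)\<^sup>2 + (sin (?D i))\<^sup>2"
    if i: "i < 4" for i
  proof -
    define m where "m = grid_dist x x' i"
    have m0: "m \<ge> 0" by (simp add: m_def grid_dist_def)
    have D: "\<bar>?D i\<bar> = m / real L"
      using i L by (simp add: angle_def m_def grid_dist_def diff_divide_distrib[symmetric])
    have xi: "x i < L" "x' i < L" using x x' i by (auto simp: grid_def dest: PiE_mem)
    then have "m \<le> real L" by (simp add: m_def grid_dist_def)
    then have "\<bar>?D i\<bar> \<le> 1" unfolding D using L by simp
    then have "(m / real L / 2)\<^sup>2 \<le> \<bar>sin (?D i)\<bar>\<^sup>2"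
      using half_le_abs_sin[of "?D i"] m0 unfolding D by (intro power_mono) simp_all
    then have a: "m\<^sup>2 / (4 * (real L)\<^sup>2) \<le> (sin (?D i))\<^sup>2"
      by (simp add: power_divide mult.commute)
    have "(1 + m)\<^sup>2 \<le> 8 + 2 * m\<^sup>2"
      using zero_le_power2[of "1 - m"] by (simp add: power2_eq_square algebra_simps)
    \<comment> \<open>The term \<open>1 / L\<^sup>2\<close> covers the shift from \<open>m\<close>
      to \<open>1 + m\<close>, so the estimate remains meaningful at \<open>m = 0\<close>.\<close>
    then have "(1 + m)\<^sup>2 / (8 * (real L)\<^sup>2) \<le> (8 + 2 * m\<^sup>2) / (8 * (real L)\<^sup>2)"
      by (intro divide_right_mono) simp_all
    also have "\<dots> = 1 / (real L)\<^sup>2 + m\<^sup>2 / (4 * (real L)\<^sup>2)"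
      using L by (simp add: field_simps)
    finally show ?thesis using a by (simp add: m_def)
  qed
  define P where "P = (\<Prod>i<4. sqrt (1 + grid_dist x x' i))"
  have P0: "P > 0" unfolding P_def by (intro prod_pos) (simp add: grid_dist_def)
  have "P / (8 * (real L)\<^sup>2) \<le> (\<Sum>i<4. (1 + grid_dist x x' i)\<^sup>2) / (8 * (real L)\<^sup>2)"
    unfolding P_def by (intro divide_right_mono prod_sqrt_le_sum_sq) (simp_all add: grid_dist_def)
  also have "\<dots> \<le> (\<Sum>i<4. 1 / (real L)\<^sup>2 + (sin (?D i))\<^sup>2)"
    unfolding sum_divide_distrib using tm by (intro sum_mono) simp
  also have "\<dots> = 4 * (1 / (real L)\<^sup>2) + real n * z"
    using n by (simp add: sum.distrib z_def)
  \<comment> \<open>There are four copies of \<open>1 / L\<^sup>2\<close>, at most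
    \<open>1 - t\<^sup>2\<close> each, and \<open>4 \<le> n\<close>.\<close>
  also have "\<dots> \<le> real n * (1 - t\<^sup>2) + real n * z"
    using n tL by (intro add_right_mono mult_mono) simp_all
  also have "\<dots> \<le> 2 * real n * (1 - t\<^sup>2 * ?X2)"
  proof -
    have "real n * ((1 - t\<^sup>2) + z) \<le> real n * (2 * (1 - t\<^sup>2 * ?X2))"
      using low by (intro mult_left_mono) simp_all
    then show ?thesis by (simp only: distrib_left mult.assoc mult.left_commute)
  qed
  finally have upper: "P / (8 * (real L)\<^sup>2) \<le> 2 * real n * (1 - t\<^sup>2 * ?X2)" .
  define M where "M = 16 * real n * (real L)\<^sup>2"
  have M: "M > 0" using n L by (simp add: M_def)
  have "P / M = P / (8 * (real L)\<^sup>2) / (2 * real n)"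
    by (simp add: M_def)
  also have "\<dots> \<le> 1 - t\<^sup>2 * ?X2"
    using upper n by (subst pos_divide_le_eq) (simp, simp only: mult.commute[of _ "2 * real n"])
  finally have "1 / (1 - t\<^sup>2 * ?X2) \<le> 1 / (P / M)"
    using P0 M by (intro frac_le) simp_all
  also have "\<dots> = pair_bound n L x x'"
    by (simp add: pair_bound_def P_def M_def prod_dividef)
  finally show ?thesis .
qed

section \<open>Counting over the whole family\<close>

lemma real_card_fibres:
  assumes "finite S" "finite G"
  shows "real (card {p \<in> S \<times> G. Q p}) = (\<Sum>x\<in>G. real (card {s \<in> S. Q (s, x)}))"
proof -
  have "{p \<in> S \<times> G. Q p} = prod.swap ` (SIGMA x:G. {s \<in> S. Q (s, x)})"
    by (auto simp: image_iff)
  then have "card {p \<in> S \<times> G. Q p} = card (SIGMA x:G. {s \<in> S. Q (s, x)})"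
    by (simp add: card_image)
  also have "\<dots> = (\<Sum>x\<in>G. card {s \<in> S. Q (s, x)})"
    using assms by (intro card_SigmaI) simp_all
  finally show ?thesis by simp
qed

definition fam_index :: "nat \<Rightarrow> nat \<Rightarrow> ((nat \<Rightarrow> real) \<times> (nat \<Rightarrow> nat)) set" where
  "fam_index n L = signs n \<times> grid L"

lemma finite_fam_index [simp]: "finite (fam_index n L)"
  by (simp add: fam_index_def)

lemma real_card_fam_index: "real (card (fam_index n L)) = 2 ^ n * real (card (grid L))"
  by (simp add: fam_index_def card_cartesian_product card_signs)

lemma dot_fam_index:
  "n \<ge> 4 \<Longrightarrow> p \<in> fam_index n L \<Longrightarrow> dot (n + 4) (fam n L p) (fam n L p) = 1"
  by (auto simp: fam_index_def dot_fam_self)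

lemma card_aligned:
  assumes n: "n \<ge> 4" and w: "dot (n + 4) w w = W\<^sup>2" and W: "W > 0"
  shows "real (card {p \<in> fam_index n L. \<kappa> * W \<le> \<bar>dot (n + 4) w (fam n L p)\<bar>}) \<le>
    real (card (fam_index n L)) * (2 * exp (1 - \<kappa> * sqrt (real n)))"
proof -
  have "real (card {p \<in> fam_index n L. \<kappa> * W \<le> \<bar>dot (n + 4) w (fam n L p)\<bar>}) =
      (\<Sum>x\<in>grid L. real (card {s \<in> signs n. \<kappa> * W \<le> \<bar>dot (n + 4) w (fam n L (s, x))\<bar>}))"
    unfolding fam_index_def by (rule real_card_fibres) simp_all
  also have "\<dots> \<le> (\<Sum>x\<in>grid L. 2 * (2 ^ n * exp (1 - \<kappa> * sqrt (real n))))"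
    by (intro sum_mono card_aligned_signs[OF n w W])
  finally show ?thesis by (simp add: real_card_fam_index ac_simps)
qed

text \<open>The bound depends only on the angles, while for each choice of angles the correlated
  sign vectors are exponentially rare. Summing over signs first separates the two effects.\<close>

lemma sum_correlated_pair_bound:
  assumes n: "n \<ge> 4" and T: "0 < T" "T \<le> 1" and p': "p' \<in> fam_index n L"
  shows "(\<Sum>p\<in>{p \<in> fam_index n L. T < (dot (n + 4) (fam n L p') (fam n L p))\<^sup>2}.
      pair_bound n L (snd p) (snd p')) \<le>
    real (card (fam_index n L)) * (8192 * real n * exp (- (real n * T / 4)))"
proof -
  obtain s' x' where p'_eq: "p' = (s', x')" and s': "s' \<in> signs n" and x': "x' \<in> grid L"
    using p' by (auto simp: fam_index_def)
  let ?Q = "\<lambda>p. T < (dot (n + 4) (fam n L p') (fam n L p))\<^sup>2"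
  let ?b = "\<lambda>x. pair_bound n L x x'"
  have "(\<Sum>p\<in>{p \<in> fam_index n L. ?Q p}. ?b (snd p)) =
      (\<Sum>p\<in>fam_index n L. if ?Q p then ?b (snd p) else 0)"
    by (rule sum.inter_filter) simp
  also have "\<dots> = (\<Sum>s\<in>signs n. \<Sum>x\<in>grid L. if ?Q (s, x) then ?b x else 0)"
    by (simp add: fam_index_def sum.cartesian_product split_def)
  also have "\<dots> = (\<Sum>x\<in>grid L. \<Sum>s\<in>signs n. if ?Q (s, x) then ?b x else 0)"
    by (rule sum.swap)
  also have "\<dots> = (\<Sum>x\<in>grid L. ?b x * real (card {s \<in> signs n. ?Q (s, x)}))"
    by (simp add: sum.inter_filter[symmetric] mult.commute)
  also have "\<dots> \<le> (\<Sum>x\<in>grid L. ?b x * (2 * (2 ^ n * exp (- (real n * T / 4)))))"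
    unfolding p'_eq
    by (intro sum_mono mult_left_mono card_correlated_signs n s' T pair_bound_nonneg)
  also have "\<dots> = (\<Sum>x\<in>grid L. ?b x) * (2 * (2 ^ n * exp (- (real n * T / 4))))"
    by (simp only: sum_distrib_right)
  also have "\<dots> \<le> 4096 * real n * real (card (grid L)) * (2 * (2 ^ n * exp (- (real n * T / 4))))"
    by (intro mult_right_mono sum_pair_bound x') simp
  finally show ?thesis by (simp add: p'_eq real_card_fam_index ac_simps)
qed

text \<open>\<open>B\<close> is arbitrary because it will be the set of members that some query
  distinguishes. Weakly correlated pairs are counted within \<open>B\<close>, whereas for strongly
  correlated ones the second member may range over the whole family, the summands being
  nonnegative.\<close>

lemma sum_fam_pairs:
  assumes n: "n \<ge> 4" and L: "L > 0" and t: "0 \<le> t" and tL: "1 / (real L)\<^sup>2 \<le> 1 - t\<^sup>2"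
    and T: "0 < T" "T \<le> 1 / 2" and B: "B \<subseteq> fam_index n L"
  defines "\<delta> \<equiv> \<lambda>p' p. (dot (n + 4) (fam n L p') (fam n L p))\<^sup>2"
  shows "(\<Sum>p'\<in>B. \<Sum>p\<in>B. (\<delta> p' p)\<^sup>2 / (1 - t\<^sup>2 * \<delta> p' p)) \<le>
    2 * T\<^sup>2 * (real (card B))\<^sup>2 +
    real (card B) * real (card (fam_index n L)) * (8192 * real n * exp (- (real n * T / 4)))"
proof -
  have finB: "finite B" using B finite_subset finite_fam_index by blast
  have t1: "t\<^sup>2 < 1"
  proof -
    have "0 < 1 / (real L)\<^sup>2" using L by simp
    then show ?thesis using tL by linarith
  qed
  have d1: "0 \<le> \<delta> p' p" "\<delta> p' p \<le> 1" if "p \<in> B" "p' \<in> B" for p p'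
    using that B n by (auto simp: \<delta>_def intro!: dot_sq_le_1 dot_fam_index)
  have pw: "(\<delta> p' p)\<^sup>2 / (1 - t\<^sup>2 * \<delta> p' p) \<le>
      2 * T\<^sup>2 + (if T < \<delta> p' p then pair_bound n L (snd p) (snd p') else 0)"
    if p: "p \<in> B" and p': "p' \<in> B" for p p'
  proof -
    note d = d1[OF p p']
    have td: "t\<^sup>2 * \<delta> p' p \<le> \<delta> p' p" using t1 d by (simp add: mult_left_le_one_le)
    have "t\<^sup>2 * \<delta> p' p \<le> t\<^sup>2" using d by (simp add: mult_left_le)
    then have pos: "0 < 1 - t\<^sup>2 * \<delta> p' p" using t1 by linarith
    show ?thesis
    proof (cases "T < \<delta> p' p")
      case True
      have "(\<delta> p' p)\<^sup>2 / (1 - t\<^sup>2 * \<delta> p' p) \<le> 1 / (1 - t\<^sup>2 * \<delta> p' p)"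
        using d pos by (intro divide_right_mono) (simp_all add: power_le_one)
      also have "\<dots> \<le> pair_bound n L (snd p) (snd p')"
      proof -
        have "p \<in> signs n \<times> grid L" "p' \<in> signs n \<times> grid L"
          using p p' B by (auto simp: fam_index_def)
        then show ?thesis
          using pair_bound[OF n L, of "fst p" "fst p'" "snd p" "snd p'" t] t tL
          by (simp add: \<delta>_def mem_Times_iff)
      qed
      finally show ?thesis using True by (simp add: add_increasing)
    next
      case False
      \<comment> \<open>As \<open>T \<le> 1 / 2\<close>, the denominator is at least
        \<open>1 / 2\<close>, uniformly in \<open>t\<close>.\<close>
      then have "(\<delta> p' p)\<^sup>2 / (1 - t\<^sup>2 * \<delta> p' p) \<le> T\<^sup>2 / (1 / 2)"
        using d T td by (intro frac_le power_mono) simp_all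
      then show ?thesis using False by simp
    qed
  qed
  have "(\<Sum>p'\<in>B. \<Sum>p\<in>B. (\<delta> p' p)\<^sup>2 / (1 - t\<^sup>2 * \<delta> p' p)) \<le>
      (\<Sum>p'\<in>B. 2 * T\<^sup>2 * real (card B) +
        real (card (fam_index n L)) * (8192 * real n * exp (- (real n * T / 4))))"
  proof (rule sum_mono)
    fix p' assume p': "p' \<in> B"
    have "(\<Sum>p\<in>B. (\<delta> p' p)\<^sup>2 / (1 - t\<^sup>2 * \<delta> p' p)) \<le>
        (\<Sum>p\<in>B. 2 * T\<^sup>2 + (if T < \<delta> p' p then pair_bound n L (snd p) (snd p') else 0))"
      by (intro sum_mono pw p')
    also have "\<dots> = 2 * T\<^sup>2 * real (card B) +
        (\<Sum>p\<in>B. if T < \<delta> p' p then pair_bound n L (snd p) (snd p') else 0)"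
      by (simp add: sum.distrib)
    also have "(\<Sum>p\<in>B. if T < \<delta> p' p then pair_bound n L (snd p) (snd p') else 0) \<le>
        (\<Sum>p\<in>fam_index n L. if T < \<delta> p' p then pair_bound n L (snd p) (snd p') else 0)"
      using B by (intro sum_mono2) (simp_all add: pair_bound_nonneg)
    also have "\<dots> = (\<Sum>p\<in>{p \<in> fam_index n L. T < \<delta> p' p}. pair_bound n L (snd p) (snd p'))"
      by (rule sum.inter_filter[symmetric]) simp
    also have "\<dots> \<le> real (card (fam_index n L)) * (8192 * real n * exp (- (real n * T / 4)))"
      unfolding \<delta>_def using p' B T by (intro sum_correlated_pair_bound n) auto
    finally show "(\<Sum>p\<in>B. (\<delta> p' p)\<^sup>2 / (1 - t\<^sup>2 * \<delta> p' p)) \<le> 2 * T\<^sup>2 * real (card B) +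
        real (card (fam_index n L)) * (8192 * real n * exp (- (real n * T / 4)))"
      by simp
  qed
  then show ?thesis by (simp add: power2_eq_square algebra_simps)
qed

text \<open>Seen from the origin, the ball of radius \<open>r\<close> about
  \<open>\<rho> * v\<close> or its negative lies in a cone whose half-angle has sine
  \<open>r / \<rho>\<close> and cosine \<open>sqrt (\<rho>\<^sup>2 - r\<^sup>2) / \<rho>\<close>.
  Since \<open>r < \<rho>\<close>, the origin is outside the ball, so \<open>w\<close> has positive
  norm.\<close>

lemma sign_err_imp_aligned:
  assumes v: "dot d v v = 1" and r: "0 \<le> r" "r < \<rho>"
    and err: "sign_err d w (\<lambda>i. \<rho> * v i) \<le> r"
  shows "\<exists>W>0. dot d w w = W\<^sup>2 \<and> sqrt (\<rho>\<^sup>2 - r\<^sup>2) / \<rho> * W \<le> \<bar>dot d w v\<bar>"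
proof -
  have W0: "dot d w w \<ge> 0" by (simp add: dot_def sum_nonneg)
  define W where "W = sqrt (dot d w w)"
  have W: "W \<ge> 0" "dot d w w = W\<^sup>2" using W0 by (simp_all add: W_def)
  have rr: "r\<^sup>2 < \<rho>\<^sup>2" using r by (intro power_strict_mono) simp_all
  have exp: "(L2_set (\<lambda>i. w i + c * (\<rho> * v i)) {..<d})\<^sup>2 = W\<^sup>2 + 2 * c * \<rho> * dot d w v + \<rho>\<^sup>2"
    if "c\<^sup>2 = 1" for c :: real
  proof -
    have "(L2_set (\<lambda>i. w i + c * (\<rho> * v i)) {..<d})\<^sup>2 = (\<Sum>i<d. (w i + c * (\<rho> * v i))\<^sup>2)"
      by (simp add: L2_set_def sum_nonneg)
    also have "\<dots> = (\<Sum>i<d. w i * w i + 2 * c * \<rho> * (w i * v i) + c\<^sup>2 * \<rho>\<^sup>2 * (v i * v i))"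
      by (intro sum.cong) (simp_all add: power2_eq_square algebra_simps)
    also have "\<dots> = dot d w w + 2 * c * \<rho> * dot d w v + c\<^sup>2 * \<rho>\<^sup>2 * dot d v v"
      by (simp add: sum.distrib dot_def sum_distrib_left)
    finally show ?thesis using that v W by simp
  qed
  have "\<exists>c. c\<^sup>2 = 1 \<and> L2_set (\<lambda>i. w i + c * (\<rho> * v i)) {..<d} \<le> r"
    using err unfolding sign_err_def min_le_iff_disj
    by (auto intro: exI[of _ "- 1 :: real"] exI[of _ "1 :: real"])
  then obtain c where c: "c\<^sup>2 = 1" and le: "L2_set (\<lambda>i. w i + c * (\<rho> * v i)) {..<d} \<le> r" by blast
  have "(L2_set (\<lambda>i. w i + c * (\<rho> * v i)) {..<d})\<^sup>2 \<le> r\<^sup>2"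
    using le by (intro power_mono) simp_all
  then have 1: "W\<^sup>2 + (\<rho>\<^sup>2 - r\<^sup>2) \<le> 2 * \<rho> * (- c * dot d w v)" unfolding exp[OF c] by (simp add: algebra_simps)
  have "- c * dot d w v \<le> \<bar>- c * dot d w v\<bar>" by simp
  also have "\<dots> = \<bar>dot d w v\<bar>"
    using c by (simp add: abs_mult power2_eq_1_iff) (metis abs_1 abs_minus_cancel mult_1)
  finally have "2 * \<rho> * (- c * dot d w v) \<le> 2 * \<rho> * \<bar>dot d w v\<bar>"
    using r by (intro mult_left_mono) simp_all
  with 1 have 2: "W\<^sup>2 + (\<rho>\<^sup>2 - r\<^sup>2) \<le> 2 * \<rho> * \<bar>dot d w v\<bar>" by linarith
  have "W \<noteq> 0"
  proof
    assume "W = 0"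
    then have "(\<Sum>i<d. (w i)\<^sup>2) = 0" using W by (simp add: dot_def power2_eq_square)
    then have "\<And>i. i < d \<Longrightarrow> w i = 0" by (simp add: sum_nonneg_eq_0_iff)
    then have "dot d w v = 0" by (simp add: dot_def)
    then show False using 2 rr zero_le_power2[of W] by simp
  qed
  moreover have "2 * (sqrt (\<rho>\<^sup>2 - r\<^sup>2) * W) \<le> W\<^sup>2 + (\<rho>\<^sup>2 - r\<^sup>2)"
  proof -
    have "(sqrt (\<rho>\<^sup>2 - r\<^sup>2))\<^sup>2 = \<rho>\<^sup>2 - r\<^sup>2" using rr by simp
    then show ?thesis
      using zero_le_power2[of "W - sqrt (\<rho>\<^sup>2 - r\<^sup>2)"] by (simp add: power2_diff algebra_simps)
  qed
  then have "sqrt (\<rho>\<^sup>2 - r\<^sup>2) * W \<le> \<rho> * \<bar>dot d w v\<bar>" using 2 by simp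
  then have "sqrt (\<rho>\<^sup>2 - r\<^sup>2) / \<rho> * W \<le> \<bar>dot d w v\<bar>"
    using r by (simp add: pos_divide_le_eq mult.commute)
  ultimately show ?thesis using W by (intro exI[of _ W]) simp
qed

section \<open>Running the algorithm against the null distribution\<close>

text \<open>Indexed by a number of steps, because the algorithm need not halt on null answers: these
  need not come from a valid oracle for any instance. An output is a fixed point, so the index may
  pass the halting time.\<close>

primrec null_run :: "(('a \<Rightarrow> real) \<Rightarrow> real) \<Rightarrow> nat \<Rightarrow> ('a, 'o) sq_alg \<Rightarrow> ('a, 'o) sq_alg" where
  "null_run st 0 alg = alg"
| "null_run st (Suc j) alg =
    null_run st j (case alg of Output w \<Rightarrow> Output w | Query q \<tau> k \<Rightarrow> k (st q))"

lemma null_run_Output: "null_run st j (Output w) = Output w"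
  by (induction j) simp_all

lemma null_run_add: "null_run st (i + j) alg = null_run st j (null_run st i alg)"
  by (induction i arbitrary: alg) simp_all

lemma null_run_unique:
  assumes "null_run st i alg = Output w" "null_run st j alg = Output w'"
  shows "w = w'"
  using assms null_run_add[of st i "j - i" alg] null_run_add[of st j "i - j" alg]
  by (cases "i \<le> j") (simp_all add: null_run_Output)

lemma sq_legal_null_run: "sq_legal M alg \<Longrightarrow> sq_legal M (null_run st j alg)"
proof (induction j arbitrary: alg)
  case (Suc j)
  then show ?case
    by (cases alg) (auto intro!: Suc.IH elim: sq_legal.cases intro: sq_legal.intros)
qed simp

text \<open>An oracle may answer with the null value \<open>st q\<close> as long as this is within the tolerance.\<close>

lemma sq_run_follows_null:
  assumes "sq_run orc alg \<tau>s w"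
    and "\<And>q \<tau>. orc q \<tau> = (if \<bar>E q - st q\<bar> \<le> \<tau> then st q else E q)"
  shows "(\<exists>j<length \<tau>s. \<exists>q k. null_run st j alg = Query q (\<tau>s ! j) k \<and> \<tau>s ! j < \<bar>E q - st q\<bar>) \<or>
    null_run st (length \<tau>s) alg = Output w"
  using assms(1)
proof induction
  case (2 k q \<tau> \<tau>s out)
  show ?case
  proof (cases "\<bar>E q - st q\<bar> \<le> \<tau>")
    case True
    then have "orc q \<tau> = st q" by (simp add: assms(2))
    then show ?thesis using "2.IH" by fastforce
  next
    case False
    then show ?thesis by (intro disjI1 exI[of _ 0]) auto
  qed
qed simp

text \<open>Until a run receives a non-null answer its queries do not depend on \<open>p\<close>.
  Hence each \<open>p\<close> either is distinguished by one of the first \<open>m\<close> queries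
  of the single null run or receives the output of that run, and a union bound over these cases
  covers \<open>F\<close>.\<close>

lemma sq_query_count:
  fixes E :: "'i \<Rightarrow> ('a \<Rightarrow> real) \<Rightarrow> real"
  assumes fin: "finite F" and legal: "sq_legal M alg"
    and run: "\<And>p. p \<in> F \<Longrightarrow> sq_run (\<lambda>q \<tau>. if \<bar>E p q - st q\<bar> \<le> \<tau> then st q else E p q) alg (\<tau>s p) (out p)"
    and tol: "\<And>p \<tau>. p \<in> F \<Longrightarrow> \<tau> \<in> set (\<tau>s p) \<Longrightarrow> \<tau>\<^sub>0 < \<tau>"
    and len: "\<And>p. p \<in> F \<Longrightarrow> length (\<tau>s p) \<le> m"
    and bad: "\<And>q. q \<in> borel_measurable M \<Longrightarrow> \<forall>x\<in>space M. q x \<in> {-1..1} \<Longrightarrow>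
      real (card {p \<in> F. \<tau>\<^sub>0 < \<bar>E p q - st q\<bar>}) \<le> \<beta>"
    and good: "\<And>w. real (card {p \<in> F. good p w}) \<le> real (card F) / 2"
    and out: "\<And>p. p \<in> F \<Longrightarrow> good p (out p)"
    and \<beta>: "\<beta> \<ge> 0"
  shows "real (card F) / 2 \<le> real m * \<beta>"
proof -
  define Bad where "Bad j = {p \<in> F. \<exists>q \<tau> k. null_run st j alg = Query q \<tau> k \<and> \<tau>\<^sub>0 < \<bar>E p q - st q\<bar>}" for j
  have cBad: "real (card (Bad j)) \<le> \<beta>" for j
  proof (cases "null_run st j alg")
    case (Query q \<tau> k)
    have "sq_legal M (Query q \<tau> k)" using sq_legal_null_run[OF legal, of st j] Query by simp
    then have "q \<in> borel_measurable M" "\<forall>x\<in>space M. q x \<in> {-1..1}"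
      by (auto elim: sq_legal.cases)
    from bad[OF this] show ?thesis by (simp add: Bad_def Query)
  qed (simp add: Bad_def \<beta>)
  \<comment> \<open>The only possible output on null answers; if the null run never halts, the
    condition is vacuous and any \<open>w\<close> will do.\<close>
  obtain w where w: "\<And>j w'. null_run st j alg = Output w' \<Longrightarrow> w' = w"
    using null_run_unique by metis
  have cover: "F \<subseteq> (\<Union>j<m. Bad j) \<union> {p \<in> F. good p w}"
  proof
    fix p assume p: "p \<in> F"
    from sq_run_follows_null[OF run[OF p] refl]
    show "p \<in> (\<Union>j<m. Bad j) \<union> {p \<in> F. good p w}"
    proof (elim disjE exE conjE)
      fix j q k assume j: "j < length (\<tau>s p)"
        and q: "null_run st j alg = Query q (\<tau>s p ! j) k" "\<tau>s p ! j < \<bar>E p q - st q\<bar>"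
      have "\<tau>\<^sub>0 < \<bar>E p q - st q\<bar>" using tol[OF p, of "\<tau>s p ! j"] j q by simp
      then have "p \<in> Bad j" using p q by (auto simp: Bad_def)
      then show ?thesis using j len[OF p] by auto
    next
      assume "null_run st (length (\<tau>s p)) alg = Output (out p)"
      then show ?thesis using w out[OF p] p by blast
    qed
  qed
  have finBad: "finite (Bad j)" for j using fin by (simp add: Bad_def)
  have "card F \<le> card ((\<Union>j<m. Bad j) \<union> {p \<in> F. good p w})"
    using fin finBad by (intro card_mono cover) auto
  also have "\<dots> \<le> card (\<Union>j<m. Bad j) + card {p \<in> F. good p w}"
    by (rule card_Un_le)
  also have "card (\<Union>j<m. Bad j) \<le> (\<Sum>j<m. card (Bad j))"
    by (rule card_UN_le) simp
  finally have "real (card F) \<le> (\<Sum>j<m. real (card (Bad j))) + real (card {p \<in> F. good p w})"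
    by (simp flip: of_nat_sum of_nat_add)
  also have "\<dots> \<le> (\<Sum>j<m. \<beta>) + real (card F) / 2"
    by (intro add_mono sum_mono cBad good)
  finally show ?thesis by simp
qed

section \<open>Combining the bounds\<close>

lemma gap_const_pos: "0 < \<epsilon> \<Longrightarrow> 0 < gap_const \<epsilon>"
  by (simp add: gap_const_def add_pos_nonneg)

lemma card_distinguished:
  fixes d n L :: nat and s :: real
  assumes n: "n \<ge> 4" and d: "d = n + 4" and L: "L > 0" and e: "0 < \<epsilon>" "\<epsilon> < 1"
    and t: "0 \<le> t" "t < 1" and tL: "1 / (real L)\<^sup>2 \<le> 1 - t\<^sup>2" and l: "l = (1 - \<epsilon>) * t / \<epsilon>"
    and T: "0 < T" "T \<le> 1 / 2" and \<tau>: "0 < \<tau>" "4 * gap_const \<epsilon> * T\<^sup>2 \<le> \<tau>\<^sup>2"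
    and q [measurable]: "q \<in> borel_measurable (sample_space d)"
    and q1: "\<forall>x\<in>space (sample_space d). q x \<in> {-1..1}"
  defines "F \<equiv> fam_index n L"
    and "E \<equiv> \<lambda>p. \<integral>x. q x \<partial>corrupt_law d s \<epsilon> t l (fam n L p)"
    and "N \<equiv> \<integral>x. q (rescale s x) * null_likelihood \<epsilon> x \<partial>gauss_samples d"
  shows "real (card {p \<in> F. \<tau> < \<bar>E p - N\<bar>}) \<le>
    4 * gap_const \<epsilon> * real (card F) * (8192 * real n * exp (- (real n * T / 4))) / \<tau>\<^sup>2"
proof -
  define C where "C = gap_const \<epsilon>"
  have C: "C > 0" unfolding C_def by (rule gap_const_pos[OF e(1)])
  define G where "G = 8192 * real n * exp (- (real n * T / 4))"
  have G: "G \<ge> 0" by (simp add: G_def)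
  \<comment> \<open>Advantages of equal sign cannot cancel in the sum to which the second moment
    bound applies. The two signs \<open>z\<close> are therefore treated separately and cost a factor
    2 at the end.\<close>
  have half: "real (card B) \<le> 2 * C * real (card F) * G / \<tau>\<^sup>2"
    if B: "B \<subseteq> F" and far: "\<And>p. p \<in> B \<Longrightarrow> \<tau> \<le> z * (E p - N)" and z: "z\<^sup>2 = 1" for B and z :: real
  proof (cases "B = {}")
    case True
    have "0 \<le> 2 * C * real (card F) * G / \<tau>\<^sup>2"
      using C G by (intro divide_nonneg_nonneg mult_nonneg_nonneg) simp_all
    then show ?thesis by (simp only: True card.empty of_nat_0)
  next
    case False
    have finB: "finite B" using finite_subset[OF B] by (simp add: F_def)
    define k where "k = real (card B)"
    have k: "k > 0" using False finB by (simp add: k_def card_gt_0_iff)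
    have unit: "dot d (fam n L p) (fam n L p) = 1" if "p \<in> B" for p
      using that B n by (auto simp: d F_def dot_fam_index)
    have "k * \<tau> \<le> (\<Sum>p\<in>B. z * (E p - N))"
      using sum_mono[of B "\<lambda>_. \<tau>" "\<lambda>p. z * (E p - N)"] far by (simp add: k_def)
    then have "(k * \<tau>)\<^sup>2 \<le> (\<Sum>p\<in>B. z * (E p - N))\<^sup>2"
      using k \<tau> by (intro power_mono) simp_all
    also have "\<dots> = (\<Sum>p\<in>B. E p - N)\<^sup>2"
      by (simp add: sum_distrib_left[symmetric] power_mult_distrib z)
    also have "\<dots> \<le> (\<Sum>p'\<in>B. \<Sum>p\<in>B. overlap \<epsilon> t l ((dot d (fam n L p') (fam n L p))\<^sup>2) - overlap \<epsilon> t l 0)"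
    proof -
      have "E p = (\<integral>x. q (rescale s x) * likelihood d \<epsilon> t l (fam n L p) x \<partial>gauss_samples d)" for p
        unfolding E_def using e t by (intro integral_corrupt_law) simp_all
      moreover have "\<bar>q (rescale s x)\<bar> \<le> 1" if "x \<in> space (gauss_samples d)" for x
        using q1 measurable_space[OF measurable_rescale that, of s] by (auto simp: abs_le_iff)
      ultimately show ?thesis
        unfolding N_def using e t finB unit
        by (simp only:) (intro query_second_moment, simp_all)
    qed
    also have "\<dots> \<le> (\<Sum>p'\<in>B. \<Sum>p\<in>B. C * (((dot d (fam n L p') (fam n L p))\<^sup>2)\<^sup>2 /
        (1 - t\<^sup>2 * (dot d (fam n L p') (fam n L p))\<^sup>2)))"
      unfolding C_def using e t unit
      by (intro sum_mono overlap_gap l dot_sq_le_1) simp_all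
    also have "\<dots> = C * (\<Sum>p'\<in>B. \<Sum>p\<in>B. ((dot d (fam n L p') (fam n L p))\<^sup>2)\<^sup>2 /
        (1 - t\<^sup>2 * (dot d (fam n L p') (fam n L p))\<^sup>2))"
      by (simp only: sum_distrib_left)
    also have "\<dots> \<le> C * (2 * T\<^sup>2 * k\<^sup>2 + k * real (card F) * G)"
      unfolding d k_def G_def F_def using B C
      by (intro mult_left_mono sum_fam_pairs n L t tL T) (simp_all add: F_def)
    finally have "k * (k * \<tau>\<^sup>2) \<le> k * (2 * C * T\<^sup>2 * k + C * real (card F) * G)"
      by (simp add: power2_eq_square algebra_simps)
    then have 1: "k * \<tau>\<^sup>2 \<le> 2 * C * T\<^sup>2 * k + C * real (card F) * G"
      using k by simp
    \<comment> \<open>The condition on \<tau> makes the contribution of weakly correlated pairs at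
      most half of the left-hand side, where it is absorbed.\<close>
    have "(4 * C * T\<^sup>2) * k \<le> \<tau>\<^sup>2 * k"
      using \<tau>(2) k unfolding C_def by (intro mult_right_mono) simp_all
    then have "k * \<tau>\<^sup>2 \<le> 2 * C * real (card F) * G" using 1 by (simp add: algebra_simps)
    then show ?thesis using \<tau> by (simp add: pos_le_divide_eq k_def)
  qed
  have "card {p \<in> F. \<tau> < \<bar>E p - N\<bar>} \<le> card ({p \<in> F. \<tau> < E p - N} \<union> {p \<in> F. \<tau> < - (E p - N)})"
    by (intro card_mono) (auto simp: F_def abs_real_def)
  also have "\<dots> \<le> card {p \<in> F. \<tau> < E p - N} + card {p \<in> F. \<tau> < - (E p - N)}"
    by (rule card_Un_le)
  finally have "real (card {p \<in> F. \<tau> < \<bar>E p - N\<bar>}) \<le>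
      real (card {p \<in> F. \<tau> < E p - N}) + real (card {p \<in> F. \<tau> < - (E p - N)})"
    by linarith
  also have "\<dots> \<le> 2 * C * real (card F) * G / \<tau>\<^sup>2 + 2 * C * real (card F) * G / \<tau>\<^sup>2"
    by (intro add_mono half[where z = 1] half[where z = "- 1"]) auto
  finally show ?thesis by (simp add: C_def G_def ac_simps)
qed

lemma sq_lower_bound:
  assumes n: "n \<ge> 4" and d: "d = n + 4" and e: "0 < \<epsilon>" "\<epsilon> < 1" and \<sigma>: "\<sigma> > 0"
    and r: "0 \<le> r" "r < \<rho>" and \<rho>: "ereal \<rho> \<le> R"
    and T: "0 < T" "T \<le> 1 / 2" and \<tau>: "0 < \<tau>\<^sub>0" "4 * gap_const \<epsilon> * T\<^sup>2 \<le> \<tau>\<^sub>0\<^sup>2"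
    and aligned: "2 * exp (1 - sqrt (\<rho>\<^sup>2 - r\<^sup>2) / \<rho> * sqrt (real n)) \<le> 1 / 2"
    and solves: "solves_sensing d \<epsilon> \<sigma> R r alg"
  shows "\<exists>u orc \<tau>s w. sensing_instance d \<epsilon> \<sigma> R u orc \<and> sq_run orc alg \<tau>s w \<and>
    (\<tau>\<^sub>0\<^sup>2 * exp (real n * T / 4) / (65536 * gap_const \<epsilon> * real n) \<le> real (length \<tau>s) \<or>
      (\<exists>\<tau>\<in>set \<tau>s. \<tau> \<le> \<tau>\<^sub>0))"
proof (rule ccontr)
  assume neg: "\<not> ?thesis"
  define s where "s = sqrt (\<rho> ^ 4 + \<sigma>\<^sup>2)"
  define t where "t = \<rho>\<^sup>2 / s"
  define l where "l = (1 - \<epsilon>) * t / \<epsilon>"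
  have \<rho>0: "\<rho> > 0" using r by simp
  have s2: "s\<^sup>2 = (\<rho>\<^sup>2)\<^sup>2 + \<sigma>\<^sup>2" by (simp add: s_def)
  have s0: "s > 0" using \<rho>0 \<sigma> by (simp add: s_def add_pos_pos)
  have "(\<rho>\<^sup>2)\<^sup>2 < s\<^sup>2" using \<sigma> by (simp add: s2)
  then have "t\<^sup>2 < 1" using s0 by (simp add: t_def power_divide)
  then have t1: "\<bar>t\<bar> < 1" by (simp add: abs_square_less_1)
  have t: "0 \<le> t" "t < 1" using t1 s0 by (simp_all add: t_def)
  \<comment> \<open>The grid is refined according to the noise through \<open>t\<close>. The final
    bound does not contain \<open>L\<close>, since the family is measured only relative to its own
    size.\<close>
  obtain L :: nat where L: "1 / (1 - t\<^sup>2) < real L" using reals_Archimedean2 by blast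
  have "0 < 1 / (1 - t\<^sup>2)" using \<open>t\<^sup>2 < 1\<close> by simp
  then have L0: "L > 0" using L by (metis less_trans of_nat_0_less_iff)
  have tL: "1 / (real L)\<^sup>2 \<le> 1 - t\<^sup>2"
  proof -
    have "real L \<le> (real L)\<^sup>2" using L0 by (simp add: power2_eq_square)
    then have "1 / (1 - t\<^sup>2) \<le> (real L)\<^sup>2" using L by linarith
    then show ?thesis using L0 \<open>t\<^sup>2 < 1\<close> by (simp add: divide_le_eq mult.commute)
  qed
  define F where "F = fam_index n L"
  define V where "V = fam n L"
  define U where "U p i = \<rho> * V p i" for p i
  have finF: "finite F" by (simp add: F_def)
  have cF: "real (card F) > 0" using L0 by (simp add: F_def real_card_fam_index card_grid)
  have unit: "dot d (V p) (V p) = 1" if "p \<in> F" for p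
    using that n by (simp add: V_def F_def d dot_fam_index)
  define E where "E p q = (\<integral>x. q x \<partial>corrupt_law d s \<epsilon> t l (V p))" for p and q :: "sample \<Rightarrow> real"
  define N where "N q = (\<integral>x. q (rescale s x) * null_likelihood \<epsilon> x \<partial>gauss_samples d)" for q
  let ?orc = "\<lambda>p (q :: sample \<Rightarrow> real) (\<tau> :: real). if \<bar>E p q - N q\<bar> \<le> \<tau> then N q else E p q"
  have inst: "sensing_instance d \<epsilon> \<sigma> R (U p) (?orc p)" if p: "p \<in> F" for p
  proof -
    have law: "huber \<epsilon> (clean_law d \<sigma> (U p)) (corrupt_law d s 1 t l (V p)) = corrupt_law d s \<epsilon> t l (V p)"
      using clean_law_eq_corrupt_law[OF \<rho>0 \<sigma> s_def t_def, of d "V p" l]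
        huber_eq_corrupt_law[of \<epsilon> t d s l "V p"] e t1 by (simp add: U_def[abs_def])
    have "L2_set (U p) {..<d} = \<rho>"
    proof -
      have "(\<Sum>i<d. (U p i)\<^sup>2) = \<rho>\<^sup>2 * dot d (V p) (V p)"
        by (simp add: U_def dot_def sum_distrib_left power2_eq_square ac_simps)
      then show ?thesis using unit[OF p] \<rho>0 by (simp add: L2_set_def)
    qed
    moreover have "prob_space (corrupt_law d s 1 t l (V p))"
      using t1 unit[OF p] by (intro prob_space_corrupt_law) simp_all
    moreover have "stat_oracle (corrupt_law d s \<epsilon> t l (V p)) (?orc p)"
      by (auto simp: stat_oracle_def E_def abs_minus_commute)
    ultimately show ?thesis
      unfolding sensing_instance_def using \<rho> law
      by (auto intro!: exI[of _ "corrupt_law d s 1 t l (V p)"])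
  qed
  have legal: "sq_legal (sample_space d) alg" using solves by (simp add: solves_sensing_def)
  have "\<exists>h. sq_run (?orc p) alg (fst h) (snd h) \<and> sign_err d (snd h) (U p) \<le> r" if "p \<in> F" for p
    using solves inst[OF that] unfolding solves_sensing_def by fastforce
  then obtain h where h: "\<And>p. p \<in> F \<Longrightarrow> sq_run (?orc p) alg (fst (h p)) (snd (h p)) \<and>
      sign_err d (snd (h p)) (U p) \<le> r"
    using bchoice[of F "\<lambda>p h. sq_run (?orc p) alg (fst h) (snd h) \<and> sign_err d (snd h) (U p) \<le> r"]
    by blast
  define \<tau>s where "\<tau>s p = fst (h p)" for p
  define out where "out p = snd (h p)" for p
  have run: "sq_run (?orc p) alg (\<tau>s p) (out p)" and err: "sign_err d (out p) (U p) \<le> r"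
    if "p \<in> F" for p
    using h[OF that] by (simp_all only: \<tau>s_def out_def)
  \<comment> \<open>This is \<open>\<tau>\<^sub>0\<^sup>2 / (8 * C * G)\<close> with the
    \<open>C\<close> and \<open>G\<close> below; \<open>65536 = 8 * 8192\<close>.\<close>
  define X where "X = \<tau>\<^sub>0\<^sup>2 * exp (real n * T / 4) / (65536 * gap_const \<epsilon> * real n)"
  have short: "\<not> (X \<le> real (length (\<tau>s p)) \<or> (\<exists>\<tau>\<in>set (\<tau>s p). \<tau> \<le> \<tau>\<^sub>0))" if "p \<in> F" for p
    using neg inst[OF that] run[OF that] unfolding X_def by blast
  have len: "real (length (\<tau>s p)) < X" and tol: "\<And>\<tau>. \<tau> \<in> set (\<tau>s p) \<Longrightarrow> \<tau>\<^sub>0 < \<tau>" if "p \<in> F" for p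
    using short[OF that] by force+
  \<comment> \<open>A maximum over the finite family is attained, so the strict bound on the lengths
    of the individual runs passes to \<open>m\<close>.\<close>
  define m where "m = Max ((\<lambda>p. length (\<tau>s p)) ` F)"
  have m_ge: "length (\<tau>s p) \<le> m" if "p \<in> F" for p
    using that finF by (simp add: m_def)
  have "F \<noteq> {}" using cF by auto
  then have "m \<in> (\<lambda>p. length (\<tau>s p)) ` F" unfolding m_def using finF by (intro Max_in) simp_all
  then have mX: "real m < X" using len by auto
  define G where "G = 8192 * real n * exp (- (real n * T / 4))"
  have G: "G > 0" using n by (simp add: G_def)
  define C where "C = gap_const \<epsilon>"
  have C: "C > 0" unfolding C_def by (rule gap_const_pos[OF e(1)])
  have good: "real (card {p \<in> F. sign_err d w (U p) \<le> r}) \<le> real (card F) / 2" for w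
  proof (cases "\<exists>p\<in>F. sign_err d w (U p) \<le> r")
    case False
    then have none: "{p \<in> F. sign_err d w (U p) \<le> r} = {}" by blast
    show ?thesis unfolding none by simp
  next
    case True
    define \<kappa> where "\<kappa> = sqrt (\<rho>\<^sup>2 - r\<^sup>2) / \<rho>"
    have al: "\<exists>W>0. dot d w w = W\<^sup>2 \<and> \<kappa> * W \<le> \<bar>dot d w (V p)\<bar>"
      if "p \<in> F" "sign_err d w (U p) \<le> r" for p
      unfolding \<kappa>_def using sign_err_imp_aligned[OF unit[OF that(1)] r] that(2) unfolding U_def by blast
    obtain W where W: "W > 0" "dot d w w = W\<^sup>2" using True al by blast
    have "{p \<in> F. sign_err d w (U p) \<le> r} \<subseteq> {p \<in> F. \<kappa> * W \<le> \<bar>dot d w (V p)\<bar>}"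
    proof safe
      fix s x assume "(s, x) \<in> F" "sign_err d w (U (s, x)) \<le> r"
      from al[OF this] obtain W' where "W' > 0" "dot d w w = W'\<^sup>2" "\<kappa> * W' \<le> \<bar>dot d w (V (s, x))\<bar>"
        by blast
      moreover from this W have "W' = W" by (metis less_imp_le power2_eq_imp_eq)
      ultimately show "\<kappa> * W \<le> \<bar>dot d w (V (s, x))\<bar>" by simp
    qed
    then have "card {p \<in> F. sign_err d w (U p) \<le> r} \<le> card {p \<in> F. \<kappa> * W \<le> \<bar>dot d w (V p)\<bar>}"
      using finF by (intro card_mono) simp_all
    moreover have "real (card {p \<in> F. \<kappa> * W \<le> \<bar>dot d w (V p)\<bar>}) \<le>
        real (card F) * (2 * exp (1 - \<kappa> * sqrt (real n)))"
      unfolding F_def V_def d using W d by (intro card_aligned n) simp_all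
    moreover have "real (card F) * (2 * exp (1 - \<kappa> * sqrt (real n))) \<le> real (card F) * (1 / 2)"
      using aligned cF unfolding \<kappa>_def by (intro mult_left_mono) simp_all
    ultimately show ?thesis by linarith
  qed
  have "real (card F) / 2 \<le> real m * (4 * C * real (card F) * G / \<tau>\<^sub>0\<^sup>2)"
  proof (rule sq_query_count[OF finF legal run tol m_ge,
        where good = "\<lambda>p w. sign_err d w (U p) \<le> r"])
    fix q :: "sample \<Rightarrow> real"
    assume "q \<in> borel_measurable (sample_space d)" "\<forall>x\<in>space (sample_space d). q x \<in> {-1..1}"
    then show "real (card {p \<in> F. \<tau>\<^sub>0 < \<bar>E p q - N q\<bar>}) \<le> 4 * C * real (card F) * G / \<tau>\<^sub>0\<^sup>2"
      unfolding C_def G_def F_def E_def V_def N_def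
      by (intro card_distinguished[OF n d L0 e t tL l_def T \<tau>])
  next
    show "0 \<le> 4 * C * real (card F) * G / \<tau>\<^sub>0\<^sup>2" using C G by simp
  qed (use good err in auto)
  also have "\<dots> = real (card F) / 2 * (real m * (8 * C * G / \<tau>\<^sub>0\<^sup>2))" by simp
  finally have "1 \<le> real m * (8 * C * G / \<tau>\<^sub>0\<^sup>2)"
    using cF by (simp only: mult_le_cancel_left1)
  then have "\<tau>\<^sub>0\<^sup>2 / (8 * C * G) \<le> real m"
    using C G \<tau> by (simp add: pos_divide_le_eq pos_le_divide_eq)
  moreover have "\<tau>\<^sub>0\<^sup>2 / (8 * C * G) = X"
  proof -
    have "G = 8192 * real n / exp (real n * T / 4)"
      by (simp add: G_def exp_minus inverse_eq_divide)
    then show ?thesis by (simp add: X_def C_def)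
  qed
  ultimately show False using mX by simp
qed

theorem theorem4p2:
  fixes S K :: real
  assumes "S > 0" and "K > 0"
  shows "\<exists>a>0. \<exists>b>0. \<exists>b'>0. \<forall>\<epsilon>\<in>{0<..<1/2}. \<forall>c\<in>{0<..<1/2}.
    \<forall>R. ereal (K * \<epsilon> powr (1/4)) < R \<longrightarrow>
    (\<forall>\<^sub>F d in sequentially. \<forall>\<sigma>>0. \<sigma>\<^sup>2 \<le> S \<longrightarrow>
      (\<forall>alg. solves_sensing d \<epsilon> \<sigma> R (K * \<epsilon> powr (1/4)) alg \<longrightarrow>
        (\<exists>u orc \<tau>s w. sensing_instance d \<epsilon> \<sigma> R u orc \<and> sq_run orc alg \<tau>s w \<and>
          (2 powr (a * real d powr c) / real d powr (2 - 4 * c) \<le> real (length \<tau>s) \<or>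
           (\<exists>\<tau>\<in>set \<tau>s. \<tau> \<le> exp (b / sqrt \<epsilon>) / (b' * real d powr (1 - 2 * c)))))))"
proof (rule exI[of _ "1 / 16"], rule conjI, simp, rule exI[of _ 1], rule conjI, simp,
    rule exI[of _ 1], rule conjI, simp, intro ballI allI impI)
  \<comment> \<open>The numerator \<open>exp (1 / sqrt \<epsilon>)\<close> need not compensate the
    much larger \<open>gap_const \<epsilon>\<close>: that constant depends on \<epsilon> alone and
    is absorbed by powers of \<open>d\<close>, so \<open>b = b' = 1\<close> suffice.\<close>
  fix \<epsilon> c :: real and R :: ereal
  assume "\<epsilon> \<in> {0<..<1/2}" and "c \<in> {0<..<1/2}" and R: "ereal (K * \<epsilon> powr (1/4)) < R"
  then have e: "0 < \<epsilon>" "\<epsilon> < 1" and c: "0 < c" "c < 1 / 2" by simp_all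
  define r where "r = K * \<epsilon> powr (1/4)"
  have r0: "r \<ge> 0" using \<open>K > 0\<close> by (simp add: r_def)
  \<comment> \<open>A norm above the accuracy is indispensable: if all admissible vectors had norm
    at most \<open>r\<close>, the output 0 would always be correct. The gap between \<open>r\<close>
    and \<rho> may be tiny, so \<kappa> is merely positive, and \<open>d\<close> is taken large
    depending on it.\<close>
  obtain \<rho> where r1: "r < \<rho>" and \<rho>R: "ereal \<rho> \<le> R"
  proof (cases R)
    case (real x)
    then show ?thesis using that[of x] R by (simp add: r_def)
  next
    case PInf
    then show ?thesis using that[of "r + 1"] by simp
  next
    case MInf
    then show ?thesis using R by simp
  qed
  define \<kappa> where "\<kappa> = sqrt (\<rho>\<^sup>2 - r\<^sup>2) / \<rho>"
  have "r\<^sup>2 < \<rho>\<^sup>2" using r0 r1 by (intro power_strict_mono) simp_all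
  then have \<kappa>: "\<kappa> > 0" using r0 r1 by (simp add: \<kappa>_def)
  define C where "C = gap_const \<epsilon>"
  have C: "C > 0" unfolding C_def by (rule gap_const_pos[OF e(1)])
  have ev2: "\<forall>\<^sub>F d in sequentially. 2 * exp (1 - \<kappa> * sqrt (real d - 4)) \<le> 1 / 2"
    using \<kappa> by real_asymp
  have ev3: "\<forall>\<^sub>F d in sequentially. 4 * C \<le> real d powr (2 * c)"
    using c by real_asymp
  have ev4: "\<forall>\<^sub>F d in sequentially. real d powr (c - 1) \<le> 1 / 2"
    using c by real_asymp
  have ev5: "\<forall>\<^sub>F d in sequentially. 65536 * C * real d \<le> exp (real d powr c / 16)"
    using c C by real_asymp
  show "\<forall>\<^sub>F d in sequentially. \<forall>\<sigma>>0. \<sigma>\<^sup>2 \<le> S \<longrightarrow>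
      (\<forall>alg. solves_sensing d \<epsilon> \<sigma> R (K * \<epsilon> powr (1/4)) alg \<longrightarrow>
        (\<exists>u orc \<tau>s w. sensing_instance d \<epsilon> \<sigma> R u orc \<and> sq_run orc alg \<tau>s w \<and>
          (2 powr (1 / 16 * real d powr c) / real d powr (2 - 4 * c) \<le> real (length \<tau>s) \<or>
           (\<exists>\<tau>\<in>set \<tau>s. \<tau> \<le> exp (1 / sqrt \<epsilon>) / (1 * real d powr (1 - 2 * c))))))"
    using eventually_ge_at_top[of "8 :: nat"] ev2 ev3 ev4 ev5
  proof (eventually_elim, intro allI impI)
    fix d :: nat and \<sigma> :: real and alg
    assume d8: "8 \<le> d" and c2: "2 * exp (1 - \<kappa> * sqrt (real d - 4)) \<le> 1 / 2"
      and c3: "4 * C \<le> real d powr (2 * c)" and c4: "real d powr (c - 1) \<le> 1 / 2"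
      and c5: "65536 * C * real d \<le> exp (real d powr c / 16)"
      and \<sigma>: "\<sigma> > 0" and sol: "solves_sensing d \<epsilon> \<sigma> R (K * \<epsilon> powr (1/4)) alg"
    define n where "n = d - 4"
    have n: "n \<ge> 4" "d = n + 4" "real n = real d - 4" using d8 by (simp_all add: n_def)
    \<comment> \<open>With this threshold \<open>n * T\<close> is of order \<open>d powr c\<close>,
      the exponent of the query bound, and \<open>T\<^sup>2\<close> is smaller than
      \<open>d powr (4 * c - 2)\<close> by the factor \<open>d powr (2 * c)\<close>, which absorbs
      \<open>4 * C\<close>.\<close>
    define T where "T = real d powr (c - 1)"
    define \<tau>\<^sub>0 where "\<tau>\<^sub>0 = exp (1 / sqrt \<epsilon>) / (1 * real d powr (1 - 2 * c))"
    have d0: "real d > 0" using d8 by simp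
    have T: "0 < T" "T \<le> 1 / 2" using d0 c4 by (simp_all add: T_def)
    have \<tau>0: "0 < \<tau>\<^sub>0" using d0 by (simp add: \<tau>\<^sub>0_def)
    have \<tau>1: "real d powr (4 * c - 2) \<le> \<tau>\<^sub>0\<^sup>2"
    proof -
      have "real d powr (2 * c - 1) * 1 \<le> real d powr (2 * c - 1) * exp (1 / sqrt \<epsilon>)"
        using e by (intro mult_left_mono) simp_all
      also have "\<dots> = \<tau>\<^sub>0" using d0 by (simp add: \<tau>\<^sub>0_def powr_diff)
      finally have "(real d powr (2 * c - 1))\<^sup>2 \<le> \<tau>\<^sub>0\<^sup>2" by (intro power_mono) simp_all
      then show ?thesis by (simp add: power2_eq_square powr_add[symmetric])
    qed
    have \<tau>2: "4 * C * T\<^sup>2 \<le> \<tau>\<^sub>0\<^sup>2"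
    proof -
      have "4 * C * T\<^sup>2 \<le> real d powr (2 * c) * T\<^sup>2"
        by (intro mult_right_mono c3) simp
      also have "\<dots> = real d powr (4 * c - 2)"
        by (simp add: T_def power2_eq_square powr_add[symmetric])
      finally show ?thesis using \<tau>1 by simp
    qed
    obtain u orc \<tau>s w where inst: "sensing_instance d \<epsilon> \<sigma> R u orc" and run: "sq_run orc alg \<tau>s w"
      and alt: "\<tau>\<^sub>0\<^sup>2 * exp (real n * T / 4) / (65536 * C * real n) \<le> real (length \<tau>s) \<or>
        (\<exists>\<tau>\<in>set \<tau>s. \<tau> \<le> \<tau>\<^sub>0)"
      using sq_lower_bound[OF n(1,2) e \<sigma> r0 r1 \<rho>R T \<tau>0, of alg] \<tau>2 c2 sol
      unfolding C_def \<kappa>_def n(3) r_def by blast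
    have "2 powr (1 / 16 * real d powr c) / real d powr (2 - 4 * c) \<le>
        \<tau>\<^sub>0\<^sup>2 * exp (real n * T / 4) / (65536 * C * real n)"
    proof -
      define x where "x = real d powr c"
      have x0: "x \<ge> 0" by (simp add: x_def)
      have "ln 2 \<le> (1 :: real)" using ln_2_less_1 by simp
      then have a: "2 powr (1 / 16 * x) \<le> exp (x / 16)"
        using x0 by (simp add: powr_def mult_left_le)
      \<comment> \<open>Of the available exponent \<open>x / 8\<close>, one half gives the claimed
        number of queries and the other pays for the factor \<open>65536 * C * n\<close>. This is
        where \<open>a = 1 / 16\<close> comes from.\<close>
      have nT: "x / 8 \<le> real n * T / 4"
      proof -
        have "real d * T = x" using d0 by (simp add: T_def x_def powr_diff)
        moreover have "real d / 2 * T \<le> real n * T"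
          using T n d8 by (intro mult_right_mono) simp_all
        ultimately show ?thesis by simp
      qed
      have b: "65536 * C * real n \<le> exp (x / 16)"
      proof -
        have "65536 * C * real n \<le> 65536 * C * real d" using C n by (intro mult_left_mono) simp_all
        then show ?thesis using c5 by (simp add: x_def)
      qed
      have pos: "0 < 65536 * C * real n" using C n(1) by simp
      have "2 powr (1 / 16 * x) * (65536 * C * real n) \<le> exp (x / 16) * exp (x / 16)"
        using pos by (intro mult_mono a b) simp_all
      also have "\<dots> \<le> exp (real n * T / 4)"
        using nT by (simp add: exp_add[symmetric])
      finally have 1: "2 powr (1 / 16 * x) \<le> exp (real n * T / 4) / (65536 * C * real n)"
        using pos by (simp only: pos_le_divide_eq)
      have "2 powr (1 / 16 * x) / real d powr (2 - 4 * c) = real d powr (4 * c - 2) * 2 powr (1 / 16 * x)"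
        using d0 by (simp add: powr_diff)
      also have "\<dots> \<le> \<tau>\<^sub>0\<^sup>2 * (exp (real n * T / 4) / (65536 * C * real n))"
        by (intro mult_mono \<tau>1 1) simp_all
      finally show ?thesis by (simp add: x_def)
    qed
    then show "\<exists>u orc \<tau>s w. sensing_instance d \<epsilon> \<sigma> R u orc \<and> sq_run orc alg \<tau>s w \<and>
          (2 powr (1 / 16 * real d powr c) / real d powr (2 - 4 * c) \<le> real (length \<tau>s) \<or>
           (\<exists>\<tau>\<in>set \<tau>s. \<tau> \<le> exp (1 / sqrt \<epsilon>) / (1 * real d powr (1 - 2 * c))))"
      using inst run alt unfolding \<tau>\<^sub>0_def[symmetric] by (meson order_trans)
  qed
qed

end
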